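(* $\mathsf{HT}$ fails in the Basic Cohen Model $\mathcal M_1$.
   Context: The Basic Cohen Model $\mathcal M_1$ is the symmetric model of $\mathsf{ZF}$ obtained from a ground model of $\mathsf{ZFC}$ by forcing with finite partial functions $p:F\times n\to 2$ ($F\subseteq\omega$ finite, $n<\omega$), which adds countably many Cohen reals $x_n\in 2^\omega$ (the columns of the generic function $\omega\times\omega\to2$), using the group of automorphisms induced by permutations of $\omega$ acting on the column index, and the normal filter generated by pointwise stabilizers of finite subsets of $\omega$; the set $\{x_n:n<\omega\}$ belongs to $\mathcal M_1$. $[X]^{<\omega}$ is the set of finite subsets of $X$; for $Y\subseteq[X]^{<\omega}$, $\mathrm{FU}(Y)=\{\bigcup_{y\in F}y : F\subseteq Y\text{ finite nonempty}\}$. $\mathsf{HT}$: for every infinite set $X$ and every $c:[X]^{<\omega}\to 2$ there is an infinite pairwise disjoint $Y\subseteq[X]^{<\omega}$ with $\mathrm{FU}(Y)$ $c$-monochromatic. *)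

theory Defs
  imports "HOL-Library.Countable_Set_Type" "HOL-Algebra.Group"
begin

section \<open>Hereditarily countable sets\<close>

text \<open>
  The ambient universe for transitive models. Two elements are equal iff they have the same
  members, membership is well-founded, and every countable set of elements is coded by an element;
  in particular every countable transitive model of ZFC is, up to isomorphism, a transitive subset
  of this type.
\<close>

datatype hc = HC (members: "hc cset")

definition elts :: "hc \<Rightarrow> hc set" where
  "elts x = rcset (members x)"

text \<open>Meaningful only for countable arguments.\<close>

definition mk :: "hc set \<Rightarrow> hc" where
  "mk A = HC (acset A)"

lemma countable_elts [simp]: "countable (elts x)"
  by (simp add: elts_def)

lemma elts_mk [simp]: "countable A \<Longrightarrow> elts (mk A) = A"
  by (simp add: elts_def mk_def acset_inverse)

lemma mk_elts [simp]: "mk (elts x) = x"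
  by (simp add: elts_def mk_def)

lemma hc_ext: "elts x = elts y \<Longrightarrow> x = y"
  by (metis mk_elts)

lemma wf_elts: "wf {(x, y). x \<in> elts y}"
proof (rule wfUNIVI)
  fix Q :: "hc \<Rightarrow> bool" and x
  assume *: "\<forall>y. (\<forall>z. (z, y) \<in> {(x, y). x \<in> elts y} \<longrightarrow> Q z) \<longrightarrow> Q y"
  show "Q x"
    by (induction x) (use * in \<open>auto simp: elts_def cin.rep_eq\<close>)
qed

definition pair :: "hc \<Rightarrow> hc \<Rightarrow> hc" where
  "pair a b = mk {mk {a}, mk {a, b}}"

lemma pair_inject [simp]: "pair a b = pair c d \<longleftrightarrow> a = c \<and> b = d"
proof -
  have "mk A = mk B \<longleftrightarrow> A = B" if "countable A" "countable B" for A B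
    using that elts_mk by metis
  then show ?thesis
    by (auto simp: pair_def doubleton_eq_iff)
qed

lemma pair_fst_trancl:
  assumes "pair a b \<in> elts x"
  shows "(a, x) \<in> {(x, y). x \<in> elts y}\<^sup>+"
proof -
  have "(a, mk {a}) \<in> {(x, y). x \<in> elts y}" "(mk {a}, pair a b) \<in> {(x, y). x \<in> elts y}"
    by (auto simp: pair_def)
  with assms show ?thesis
    by (meson CollectI case_prodI trancl.intros)
qed

fun num :: "nat \<Rightarrow> hc" where
  "num 0 = mk {}"
| "num (Suc n) = mk (insert (num n) (elts (num n)))"


section \<open>Set-theoretic notions relativized to a class\<close>

text \<open>
  For a class \<open>U\<close> each predicate below is the relativization to \<open>U\<close>
  of the usual formula in the language of set theory: all quantifiers range over \<open>U\<close>.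
\<close>

definition is_empty :: "hc set \<Rightarrow> hc \<Rightarrow> bool" where
  "is_empty U x \<longleftrightarrow> (\<forall>z\<in>U. z \<notin> elts x)"

definition is_subset :: "hc set \<Rightarrow> hc \<Rightarrow> hc \<Rightarrow> bool" where
  "is_subset U x y \<longleftrightarrow> (\<forall>z\<in>U. z \<in> elts x \<longrightarrow> z \<in> elts y)"

definition is_upair :: "hc set \<Rightarrow> hc \<Rightarrow> hc \<Rightarrow> hc \<Rightarrow> bool" where
  "is_upair U a b x \<longleftrightarrow> (\<forall>z\<in>U. z \<in> elts x \<longleftrightarrow> z = a \<or> z = b)"

definition is_pair :: "hc set \<Rightarrow> hc \<Rightarrow> hc \<Rightarrow> hc \<Rightarrow> bool" where
  "is_pair U a b x \<longleftrightarrow>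
     (\<exists>s\<in>U. \<exists>d\<in>U. is_upair U a a s \<and> is_upair U a b d \<and> is_upair U s d x)"

definition is_Union :: "hc set \<Rightarrow> hc \<Rightarrow> hc \<Rightarrow> bool" where
  "is_Union U x u \<longleftrightarrow> (\<forall>z\<in>U. z \<in> elts u \<longleftrightarrow> (\<exists>y\<in>U. y \<in> elts x \<and> z \<in> elts y))"

definition is_succ :: "hc set \<Rightarrow> hc \<Rightarrow> hc \<Rightarrow> bool" where
  "is_succ U x s \<longleftrightarrow> (\<forall>z\<in>U. z \<in> elts s \<longleftrightarrow> z \<in> elts x \<or> z = x)"

definition is_two :: "hc set \<Rightarrow> hc \<Rightarrow> bool" where
  "is_two U t \<longleftrightarrow> (\<exists>z\<in>U. \<exists>e\<in>U. is_empty U z \<and> is_succ U z e \<and> is_succ U e t)"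

definition is_inductive :: "hc set \<Rightarrow> hc \<Rightarrow> bool" where
  "is_inductive U x \<longleftrightarrow>
     (\<exists>z\<in>U. is_empty U z \<and> z \<in> elts x) \<and>
     (\<forall>y\<in>U. y \<in> elts x \<longrightarrow> (\<exists>s\<in>U. is_succ U y s \<and> s \<in> elts x))"

definition is_natural :: "hc set \<Rightarrow> hc \<Rightarrow> bool" where
  "is_natural U n \<longleftrightarrow> (\<forall>x\<in>U. is_inductive U x \<longrightarrow> n \<in> elts x)"

definition is_app :: "hc set \<Rightarrow> hc \<Rightarrow> hc \<Rightarrow> hc \<Rightarrow> bool" where
  "is_app U f a b \<longleftrightarrow> (\<exists>q\<in>U. is_pair U a b q \<and> q \<in> elts f)"

definition is_function :: "hc set \<Rightarrow> hc \<Rightarrow> hc \<Rightarrow> hc \<Rightarrow> bool" where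
  "is_function U f A B \<longleftrightarrow>
     (\<forall>q\<in>U. q \<in> elts f \<longrightarrow>
        (\<exists>a\<in>U. \<exists>b\<in>U. a \<in> elts A \<and> b \<in> elts B \<and> is_pair U a b q)) \<and>
     (\<forall>a\<in>U. a \<in> elts A \<longrightarrow> (\<exists>!b. b \<in> U \<and> is_app U f a b))"

definition is_bijection :: "hc set \<Rightarrow> hc \<Rightarrow> hc \<Rightarrow> hc \<Rightarrow> bool" where
  "is_bijection U f A B \<longleftrightarrow>
     is_function U f A B \<and>
     (\<forall>b\<in>U. b \<in> elts B \<longrightarrow> (\<exists>!a. a \<in> U \<and> is_app U f a b))"

definition is_finite :: "hc set \<Rightarrow> hc \<Rightarrow> bool" where
  "is_finite U x \<longleftrightarrow> (\<exists>n\<in>U. \<exists>f\<in>U. is_natural U n \<and> is_bijection U f n x)"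

definition is_pairwise_disjoint :: "hc set \<Rightarrow> hc \<Rightarrow> bool" where
  "is_pairwise_disjoint U A \<longleftrightarrow>
     (\<forall>x\<in>U. \<forall>y\<in>U. x \<in> elts A \<longrightarrow> y \<in> elts A \<longrightarrow> x \<noteq> y \<longrightarrow>
        \<not> (\<exists>z\<in>U. z \<in> elts x \<and> z \<in> elts y))"


section \<open>Transitive models of ZFC\<close>

datatype fm = Mem nat nat | Eq nat nat | Neg fm | And fm fm | All nat fm

fun sat :: "hc set \<Rightarrow> fm \<Rightarrow> (nat \<Rightarrow> hc) \<Rightarrow> bool" where
  "sat U (Mem i j) e \<longleftrightarrow> e i \<in> elts (e j)"
| "sat U (Eq i j) e \<longleftrightarrow> e i = e j"
| "sat U (Neg \<phi>) e \<longleftrightarrow> \<not> sat U \<phi> e"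
| "sat U (And \<phi> \<psi>) e \<longleftrightarrow> sat U \<phi> e \<and> sat U \<psi> e"
| "sat U (All i \<phi>) e \<longleftrightarrow> (\<forall>x\<in>U. sat U \<phi> (e(i := x)))"

definition ax_extensionality :: "hc set \<Rightarrow> bool" where
  "ax_extensionality U \<longleftrightarrow>
     (\<forall>x\<in>U. \<forall>y\<in>U. (\<forall>z\<in>U. z \<in> elts x \<longleftrightarrow> z \<in> elts y) \<longrightarrow> x = y)"

definition ax_foundation :: "hc set \<Rightarrow> bool" where
  "ax_foundation U \<longleftrightarrow>
     (\<forall>x\<in>U. \<not> is_empty U x \<longrightarrow>
        (\<exists>y\<in>U. y \<in> elts x \<and> \<not> (\<exists>z\<in>U. z \<in> elts x \<and> z \<in> elts y)))"

definition ax_pairing :: "hc set \<Rightarrow> bool" where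
  "ax_pairing U \<longleftrightarrow> (\<forall>a\<in>U. \<forall>b\<in>U. \<exists>x\<in>U. is_upair U a b x)"

definition ax_union :: "hc set \<Rightarrow> bool" where
  "ax_union U \<longleftrightarrow> (\<forall>x\<in>U. \<exists>u\<in>U. is_Union U x u)"

definition ax_powerset :: "hc set \<Rightarrow> bool" where
  "ax_powerset U \<longleftrightarrow> (\<forall>x\<in>U. \<exists>p\<in>U. \<forall>z\<in>U. z \<in> elts p \<longleftrightarrow> is_subset U z x)"

definition ax_infinity :: "hc set \<Rightarrow> bool" where
  "ax_infinity U \<longleftrightarrow> (\<exists>x\<in>U. is_inductive U x)"

text \<open>In the two schemata the variables other than 0 (and 1) serve as parameters.\<close>

definition ax_separation :: "hc set \<Rightarrow> bool" where
  "ax_separation U \<longleftrightarrow>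
     (\<forall>\<phi> e. range e \<subseteq> U \<longrightarrow>
        (\<forall>A\<in>U. \<exists>B\<in>U. \<forall>x\<in>U. x \<in> elts B \<longleftrightarrow> x \<in> elts A \<and> sat U \<phi> (e(0 := x))))"

definition ax_replacement :: "hc set \<Rightarrow> bool" where
  "ax_replacement U \<longleftrightarrow>
     (\<forall>\<phi> e. range e \<subseteq> U \<longrightarrow>
        (\<forall>A\<in>U.
           (\<forall>x\<in>U. x \<in> elts A \<longrightarrow>
              (\<forall>y\<in>U. \<forall>z\<in>U. sat U \<phi> (e(0 := x, 1 := y)) \<longrightarrow>
                 sat U \<phi> (e(0 := x, 1 := z)) \<longrightarrow> y = z)) \<longrightarrow>
           (\<exists>B\<in>U. \<forall>y\<in>U. y \<in> elts B \<longleftrightarrow>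
              (\<exists>x\<in>U. x \<in> elts A \<and> sat U \<phi> (e(0 := x, 1 := y))))))"

definition ax_choice :: "hc set \<Rightarrow> bool" where
  "ax_choice U \<longleftrightarrow>
     (\<forall>A\<in>U. (\<forall>x\<in>U. x \<in> elts A \<longrightarrow> \<not> is_empty U x) \<longrightarrow> is_pairwise_disjoint U A \<longrightarrow>
        (\<exists>C\<in>U. \<forall>x\<in>U. x \<in> elts A \<longrightarrow> (\<exists>!z. z \<in> U \<and> z \<in> elts x \<and> z \<in> elts C)))"

definition models_ZFC :: "hc set \<Rightarrow> bool" where
  "models_ZFC U \<longleftrightarrow>
     ax_extensionality U \<and> ax_foundation U \<and> ax_pairing U \<and> ax_union U \<and> ax_powerset U \<and>
     ax_infinity U \<and> ax_separation U \<and> ax_replacement U \<and> ax_choice U"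

definition transitive_model_ZFC :: "hc set \<Rightarrow> bool" where
  "transitive_model_ZFC M \<longleftrightarrow> (\<forall>x\<in>M. elts x \<subseteq> M) \<and> models_ZFC M"


section \<open>Forcing with names\<close>

text \<open>
  Conditions form a set \<open>P\<close> of elements of \<^typ>\<open>hc\<close> ordered by reverse inclusion,
  so that \<open>elts p \<subseteq> elts q\<close> says that \<open>q\<close> is stronger than \<open>p\<close>.
\<close>

definition dense :: "hc set \<Rightarrow> hc set \<Rightarrow> bool" where
  "dense P D \<longleftrightarrow> D \<subseteq> P \<and> (\<forall>p\<in>P. \<exists>d\<in>D. elts p \<subseteq> elts d)"

definition is_filter :: "hc set \<Rightarrow> hc set \<Rightarrow> bool" where
  "is_filter P G \<longleftrightarrow>
     G \<subseteq> P \<and> G \<noteq> {} \<and>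
     (\<forall>q\<in>G. \<forall>p\<in>P. elts p \<subseteq> elts q \<longrightarrow> p \<in> G) \<and>
     (\<forall>p\<in>G. \<forall>q\<in>G. \<exists>r\<in>G. elts p \<subseteq> elts r \<and> elts q \<subseteq> elts r)"

definition generic :: "hc set \<Rightarrow> hc set \<Rightarrow> hc set \<Rightarrow> bool" where
  "generic M P G \<longleftrightarrow> is_filter P G \<and> (\<forall>D\<in>M. dense P (elts D) \<longrightarrow> elts D \<inter> G \<noteq> {})"

text \<open>Evaluation of names; a \<open>P\<close>-name is a set of pairs of a \<open>P\<close>-name and a condition.\<close>

function val :: "hc set \<Rightarrow> hc \<Rightarrow> hc" where
  "val G \<tau> = mk (val G ` {\<sigma>. \<exists>p\<in>G. pair \<sigma> p \<in> elts \<tau>})"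
  by auto
termination
  by (relation "inv_image ({(x, y). x \<in> elts y}\<^sup>+) snd")
     (auto intro: wf_trancl wf_elts pair_fst_trancl)

declare val.simps [simp del]

text \<open>The action on names of a map \<open>\<alpha>\<close> on conditions.\<close>

function name_act :: "(hc \<Rightarrow> hc) \<Rightarrow> hc \<Rightarrow> hc" where
  "name_act \<alpha> \<tau> =
     mk ((\<lambda>(\<sigma>, p). pair (name_act \<alpha> \<sigma>) (\<alpha> p)) ` {(\<sigma>, p). pair \<sigma> p \<in> elts \<tau>})"
  by auto
termination
  by (relation "inv_image ({(x, y). x \<in> elts y}\<^sup>+) snd")
     (auto intro: wf_trancl wf_elts pair_fst_trancl)

declare name_act.simps [simp del]


section \<open>The Basic Cohen Model\<close>

text \<open>
  The conditions are the functions from \<open>F \<times> n\<close> to 2 with \<open>F\<close> finite.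
  The first argument is the column, that is, the index of the Cohen real.
\<close>

definition cohen_condition :: "nat set \<Rightarrow> nat \<Rightarrow> (nat \<Rightarrow> nat \<Rightarrow> bool) \<Rightarrow> hc" where
  "cohen_condition F n f =
     mk {pair (pair (num k) (num m)) (num (of_bool (f k m))) | k m. k \<in> F \<and> m < n}"

definition cohen_poset :: "hc set" where
  "cohen_poset = {cohen_condition F n f | F n f. finite F}"

definition perm_graph :: "(nat \<Rightarrow> nat) \<Rightarrow> hc" where
  "perm_graph \<pi> = mk (range (\<lambda>n. pair (num n) (num (\<pi> n))))"

text \<open>The permutations of the natural numbers that belong to the ground model.\<close>

definition cohen_group :: "hc set \<Rightarrow> (nat \<Rightarrow> nat) monoid" where
  "cohen_group M = \<lparr>carrier = {\<pi>. bij \<pi> \<and> perm_graph \<pi> \<in> M}, mult = (\<circ>), one = id\<rparr>"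

definition cohen_act :: "(nat \<Rightarrow> nat) \<Rightarrow> hc \<Rightarrow> hc" where
  "cohen_act \<pi> p =
     mk {pair (pair (num (\<pi> k)) m) i | k m i. pair (pair (num k) m) i \<in> elts p}"

definition normal_filter :: "('a, 'b) monoid_scheme \<Rightarrow> 'a set set \<Rightarrow> bool" where
  "normal_filter \<G> \<F> \<longleftrightarrow>
     (\<forall>H\<in>\<F>. subgroup H \<G>) \<and> carrier \<G> \<in> \<F> \<and>
     (\<forall>H\<in>\<F>. \<forall>K. subgroup K \<G> \<longrightarrow> H \<subseteq> K \<longrightarrow> K \<in> \<F>) \<and>
     (\<forall>H\<in>\<F>. \<forall>K\<in>\<F>. H \<inter> K \<in> \<F>) \<and>
     (\<forall>H\<in>\<F>. \<forall>g\<in>carrier \<G>. (\<lambda>h. g \<otimes>\<^bsub>\<G>\<^esub> h \<otimes>\<^bsub>\<G>\<^esub> inv\<^bsub>\<G>\<^esub> g) ` H \<in> \<F>)"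

definition generated_normal_filter :: "('a, 'b) monoid_scheme \<Rightarrow> 'a set set \<Rightarrow> 'a set set" where
  "generated_normal_filter \<G> B = \<Inter>{\<F>. normal_filter \<G> \<F> \<and> B \<subseteq> \<F>}"

definition fix_group :: "hc set \<Rightarrow> nat set \<Rightarrow> (nat \<Rightarrow> nat) set" where
  "fix_group M E = {\<pi> \<in> carrier (cohen_group M). \<forall>n\<in>E. \<pi> n = n}"

definition cohen_filter :: "hc set \<Rightarrow> (nat \<Rightarrow> nat) set set" where
  "cohen_filter M = generated_normal_filter (cohen_group M) {fix_group M E | E. finite E}"

definition sym_group :: "hc set \<Rightarrow> hc \<Rightarrow> (nat \<Rightarrow> nat) set" where
  "sym_group M \<tau> = {\<pi> \<in> carrier (cohen_group M). name_act (cohen_act \<pi>) \<tau> = \<tau>}"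

text \<open>Hereditarily symmetric names in the ground model.\<close>

inductive hered_sym :: "hc set \<Rightarrow> hc \<Rightarrow> bool" for M where
  "\<tau> \<in> M \<Longrightarrow>
   (\<And>z. z \<in> elts \<tau> \<Longrightarrow> \<exists>\<sigma> p. z = pair \<sigma> p \<and> p \<in> cohen_poset \<and> hered_sym M \<sigma>) \<Longrightarrow>
   sym_group M \<tau> \<in> cohen_filter M \<Longrightarrow> hered_sym M \<tau>"

definition basic_cohen_model :: "hc set \<Rightarrow> hc set \<Rightarrow> hc set" where
  "basic_cohen_model M G = {val G \<tau> | \<tau>. hered_sym M \<tau>}"


section \<open>The principle HT, relativized to a class\<close>

definition is_Fin :: "hc set \<Rightarrow> hc \<Rightarrow> hc \<Rightarrow> bool" where
  "is_Fin U X S \<longleftrightarrow> (\<forall>s\<in>U. s \<in> elts S \<longleftrightarrow> is_subset U s X \<and> is_finite U s)"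

definition in_FU :: "hc set \<Rightarrow> hc \<Rightarrow> hc \<Rightarrow> bool" where
  "in_FU U Y z \<longleftrightarrow>
     (\<exists>F\<in>U. is_subset U F Y \<and> is_finite U F \<and> \<not> is_empty U F \<and> is_Union U F z)"

definition FU_monochromatic :: "hc set \<Rightarrow> hc \<Rightarrow> hc \<Rightarrow> bool" where
  "FU_monochromatic U c Y \<longleftrightarrow> (\<exists>i\<in>U. \<forall>z\<in>U. in_FU U Y z \<longrightarrow> is_app U c z i)"

definition HT :: "hc set \<Rightarrow> bool" where
  "HT U \<longleftrightarrow>
     (\<forall>X\<in>U. \<forall>S\<in>U. \<forall>t\<in>U. \<forall>c\<in>U.
        \<not> is_finite U X \<longrightarrow> is_Fin U X S \<longrightarrow> is_two U t \<longrightarrow> is_function U c S t \<longrightarrow>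
        (\<exists>Y\<in>U. is_subset U Y S \<and> \<not> is_finite U Y \<and> is_pairwise_disjoint U Y \<and>
               FU_monochromatic U c Y))"

end

(*
  Let X be the set of the Cohen reals x_n and let c(s) = 1 if s is a singleton and c(s) = 0 otherwise.
  Suppose that Y is an infinite pairwise disjoint family of finite subsets of X in the symmetric
  model, with a name supported by the finite set E. A member {x_n : n in F} of Y with F disjoint
  from E is a singleton or empty: otherwise let k in F; some condition p in G forces the membership,
  by genericity there is a fresh column l that agrees with column k as far as p can see, and the
  transposition (k l) fixes E and maps p into G. Hence Y also contains the image of that member
  under (k l), which meets it and differs from it. All but finitely many members of Y are disjoint
  from E, so Y contains two singletons, and their union has the other colour.

  Forcing is only needed for membership of one name in another, and symmetry is applied to generic
  filters instead of to a forcing relation.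
*)

theory Submission
  imports Defs "HOL-Combinatorics.Transposition"
begin

section \<open>Definability and closure properties of the ground model\<close>

text \<open>The ground model is given only through first-order schemata, so every dense set to which
  genericity is applied must first be exhibited as an element of \<open>M\<close> cut out by a
  formula. The predicates \<open>dfn\<close>, \<open>tm\<close> and \<open>lv\<close> reduce this to
  a syntax-directed check; the names of the reals, of X, of its finite subsets and of the colouring
  are placed in \<open>M\<close> in the same way.

  The symmetry step is semantic. A condition p that guarantees a membership does so for every
  generic filter containing p. The preimage of G under an automorphism is again generic, and
  evaluating a name along it equals evaluating the permuted name along G. If the automorphism maps p
  into G, then p lies in the preimage and the guarantee applies there.

  The colouring matches what symmetry yields: it depends only on the size of a finite set, so it is
  invariant under all permutations and has a name with empty support; and since symmetry leaves
  singletons as the only infinite supply of members, it suffices to separate a singleton from a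
  union of two.\<close>

lemma countable_subset_elts: "A \<subseteq> elts x \<Longrightarrow> countable A"
  using countable_elts countable_subset by blast

lemma eq_mk_iff: "countable A \<Longrightarrow> x = mk A \<longleftrightarrow> elts x = A"
  by (metis elts_mk mk_elts)

lemma elts_pair: "elts (pair a b) = {mk {a}, mk {a, b}}"
  by (simp add: pair_def)

text \<open>Adjunction of one element. Finite sets, numerals and pairs are iterated adjunctions
  starting from \<open>mk {}\<close>, so closure and definability need to be checked for this
  operation alone.\<close>

definition ins :: "hc \<Rightarrow> hc \<Rightarrow> hc" where
  "ins a x = mk (insert a (elts x))"

lemma elts_ins [simp]: "elts (ins a x) = insert a (elts x)"
  by (simp add: ins_def)

lemma pair_ins: "pair a b = ins (ins a (mk {})) (ins (ins a (ins b (mk {}))) (mk {}))"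
  by (rule hc_ext) (auto simp: elts_pair ins_def)

lemma num_Suc_ins: "num (Suc n) = ins (num n) (num n)"
  by (simp add: ins_def)

text \<open>Stated for an arbitrary class because it serves both the ground model and the symmetric
  model.\<close>

lemma mk_finite_closed:
  assumes "mk {} \<in> U" "\<And>a x. a \<in> U \<Longrightarrow> x \<in> U \<Longrightarrow> ins a x \<in> U"
  shows "finite A \<Longrightarrow> A \<subseteq> U \<Longrightarrow> mk A \<in> U"
proof (induction A rule: finite_induct)
  case (insert a A)
  then have "ins a (mk A) \<in> U" using assms(2) by simp
  then show ?case using insert.hyps by (simp add: ins_def countable_finite)
qed (rule assms(1))

lemma elts_num: "elts (num n) = num ` {..<n}"
  by (induction n) (auto simp: lessThan_Suc)

lemma elt_irrefl: "x \<notin> elts x"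
proof -
  have "acyclic {(x, y). x \<in> elts y}"
    by (rule wf_acyclic[OF wf_elts])
  then show ?thesis by (auto simp: acyclic_def)
qed

lemma elt_induct [case_names elt]: "(\<And>x. (\<And>y. y \<in> elts x \<Longrightarrow> Q y) \<Longrightarrow> Q x) \<Longrightarrow> Q x"
  by (rule wf_induct[OF wf_elts]) auto

lemma num_inject [simp]: "num m = num n \<longleftrightarrow> m = n"
proof -
  have "num m \<noteq> num n" if "m < n" for m n
  proof
    assume "num m = num n"
    then have "num m \<in> elts (num m)"
      using that by (metis elts_num imageI lessThan_iff)
    then show False using elt_irrefl by blast
  qed
  then show ?thesis by (metis linorder_neqE_nat)
qed

lemma num_mem_iff [simp]: "num m \<in> elts (num n) \<longleftrightarrow> m < n"
  by (auto simp: elts_num)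

definition omega :: hc where
  "omega = mk (range num)"

lemma elts_omega [simp]: "elts omega = range num"
  by (simp add: omega_def)

text \<open>Variables beyond the list have the junk value \<open>mk {}\<close>.\<close>

definition env :: "hc list \<Rightarrow> nat \<Rightarrow> hc" where
  "env xs i = (if i < length xs then xs ! i else mk {})"

lemma env_Cons_0 [simp]: "env (x # xs) 0 = x"
  by (simp add: env_def)

lemma env_Cons_Suc [simp]: "env (x # xs) (Suc i) = env xs i"
  by (simp add: env_def)

lemma env_Cons_numeral [simp]: "env (x # xs) (numeral k) = env xs (pred_numeral k)"
  by (simp add: numeral_eq_Suc)

section \<open>Closure of the ground model under the basic set operations\<close>

locale ctm =
  fixes M :: "hc set"
  assumes transitive_model: "transitive_model_ZFC M"
begin

lemma M_trans: "x \<in> M \<Longrightarrow> y \<in> elts x \<Longrightarrow> y \<in> M"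
  using transitive_model by (auto simp: transitive_model_ZFC_def)

lemma models: "models_ZFC M"
  using transitive_model by (simp add: transitive_model_ZFC_def)

lemma is_empty_iff: "x \<in> M \<Longrightarrow> is_empty M x \<longleftrightarrow> x = mk {}"
  using M_trans by (auto simp: is_empty_def eq_mk_iff)

lemma empty_in_M [simp]: "mk {} \<in> M"
  using models is_empty_iff
  by (auto simp: models_ZFC_def ax_infinity_def is_inductive_def)

lemma upair_in_M: "a \<in> M \<Longrightarrow> b \<in> M \<Longrightarrow> mk {a, b} \<in> M"
proof -
  assume ab: "a \<in> M" "b \<in> M"
  then obtain x where x: "x \<in> M" "is_upair M a b x"
    using models by (auto simp: models_ZFC_def ax_pairing_def)
  have "elts x = {a, b}" using x ab M_trans unfolding is_upair_def by blast
  then show ?thesis using x(1) by (metis mk_elts)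
qed

lemma Union_in_M: "x \<in> M \<Longrightarrow> mk (\<Union> (elts ` elts x)) \<in> M"
proof -
  assume x: "x \<in> M"
  then obtain u where u: "u \<in> M" "is_Union M x u"
    using models by (auto simp: models_ZFC_def ax_union_def)
  have "elts u = \<Union> (elts ` elts x)"
    using u x M_trans unfolding is_Union_def by blast
  then show ?thesis using u(1) by (metis mk_elts)
qed

lemma Un_in_M: "x \<in> M \<Longrightarrow> y \<in> M \<Longrightarrow> mk (elts x \<union> elts y) \<in> M"
  using Union_in_M[OF upair_in_M, of x y] by simp

lemma ins_in_M [simp]: "a \<in> M \<Longrightarrow> x \<in> M \<Longrightarrow> ins a x \<in> M"
  using Un_in_M[OF upair_in_M, of a a x] by (simp add: ins_def)

lemma pair_in_M [simp]: "a \<in> M \<Longrightarrow> b \<in> M \<Longrightarrow> pair a b \<in> M"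
  by (simp add: pair_ins)

lemma num_in_M [simp]: "num n \<in> M"
  by (induction n) (simp_all add: num_Suc_ins del: num.simps(2))

definition Pw :: "hc \<Rightarrow> hc" where
  "Pw x = mk {z \<in> M. elts z \<subseteq> elts x}"

lemma Pw: assumes "x \<in> M" shows Pw_in_M: "Pw x \<in> M" and elts_Pw: "elts (Pw x) = {z \<in> M. elts z \<subseteq> elts x}"
proof -
  obtain p where p: "p \<in> M" "\<And>z. z \<in> M \<Longrightarrow> z \<in> elts p \<longleftrightarrow> is_subset M z x"
    using models assms by (auto simp: models_ZFC_def ax_powerset_def)
  have "elts p = {z \<in> M. elts z \<subseteq> elts x}"
    using p M_trans unfolding is_subset_def by blast
  then have "Pw x = p" by (metis Pw_def mk_elts)
  with p \<open>elts p = _\<close> show "Pw x \<in> M" "elts (Pw x) = {z \<in> M. elts z \<subseteq> elts x}" by auto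
qed

text \<open>Definability over \<open>M\<close> from the semantic side: relations are written as HOL
  predicates of assignments, and the closure lemmas below supply the formula.\<close>

definition dfn :: "((nat \<Rightarrow> hc) \<Rightarrow> bool) \<Rightarrow> bool" where
  "dfn P \<longleftrightarrow> (\<exists>\<phi>. \<forall>e. range e \<subseteq> M \<longrightarrow> sat M \<phi> e = P e)"

lemma dfn_cong: "dfn P \<Longrightarrow> (\<And>e. range e \<subseteq> M \<Longrightarrow> P e = Q e) \<Longrightarrow> dfn Q"
  unfolding dfn_def by metis

lemma dfn_not: "dfn P \<Longrightarrow> dfn (\<lambda>e. \<not> P e)"
  unfolding dfn_def by (elim exE, rule_tac x = "Neg \<phi>" in exI) simp

lemma dfn_and: "dfn P \<Longrightarrow> dfn Q \<Longrightarrow> dfn (\<lambda>e. P e \<and> Q e)"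
  unfolding dfn_def by (elim exE, rule_tac x = "And \<phi> \<phi>'" in exI) simp

lemma dfn_or: "dfn P \<Longrightarrow> dfn Q \<Longrightarrow> dfn (\<lambda>e. P e \<or> Q e)"
  using dfn_not[OF dfn_and[OF dfn_not dfn_not], of P Q] by simp

lemma dfn_imp: "dfn P \<Longrightarrow> dfn Q \<Longrightarrow> dfn (\<lambda>e. P e \<longrightarrow> Q e)"
  unfolding imp_conv_disj by (intro dfn_or dfn_not)

lemma dfn_iff: "dfn P \<Longrightarrow> dfn Q \<Longrightarrow> dfn (\<lambda>e. P e \<longleftrightarrow> Q e)"
  unfolding iff_conv_conj_imp by (intro dfn_and dfn_imp)

lemma range_upd: "range e \<subseteq> M \<Longrightarrow> x \<in> M \<Longrightarrow> range (e(k := x)) \<subseteq> M"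
  by auto

text \<open>The HOL-bound variable is stored in slot \<open>k\<close> of the assignment. The second
  premise says that \<open>Q\<close> does not otherwise read this slot, so overwriting it captures
  nothing.\<close>

lemma dfn_all:
  assumes "dfn (\<lambda>e. Q e (e k))" and fresh: "\<And>e x y. Q (e(k := y)) x = Q e x"
  shows "dfn (\<lambda>e. \<forall>x\<in>M. Q e x)"
proof -
  obtain \<phi> where \<phi>: "\<And>e. range e \<subseteq> M \<Longrightarrow> sat M \<phi> e = Q e (e k)"
    using assms(1) unfolding dfn_def by blast
  have "sat M (All k \<phi>) e \<longleftrightarrow> (\<forall>x\<in>M. Q e x)" if "range e \<subseteq> M" for e
    using that by (simp add: \<phi>[OF range_upd] fresh del: fun_upd_apply) simp
  then show ?thesis unfolding dfn_def by blast
qed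

lemma dfn_ex:
  assumes "dfn (\<lambda>e. Q e (e k))" and "\<And>e x y. Q (e(k := y)) x = Q e x"
  shows "dfn (\<lambda>e. \<exists>x\<in>M. Q e x)"
  using dfn_not[OF dfn_all[where Q = "\<lambda>e x. \<not> Q e x", OF dfn_not]] assms by simp

lemma dfn_mem_var: "dfn (\<lambda>e. e i \<in> elts (e j))"
  unfolding dfn_def by (rule exI[of _ "Mem i j"]) simp

lemma dfn_eq_var: "dfn (\<lambda>e. e i = e j)"
  unfolding dfn_def by (rule exI[of _ "Eq i j"]) simp

lemma dfn_False: "dfn (\<lambda>e. False)"
  by (rule dfn_cong[OF dfn_not[OF dfn_eq_var[of 0 0]]]) auto

text \<open>What a term must satisfy to be substituted into a definable predicate: its values stay
  in \<open>M\<close>, its graph is definable, and it reads only slots below some \<open>n\<close>,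
  which leaves fresh slots for auxiliary quantifiers.\<close>

definition tm :: "((nat \<Rightarrow> hc) \<Rightarrow> hc) \<Rightarrow> bool" where
  "tm t \<longleftrightarrow> (\<forall>e. range e \<subseteq> M \<longrightarrow> t e \<in> M) \<and> (\<exists>n. \<forall>e i y. i \<ge> n \<longrightarrow> t (e(i := y)) = t e) \<and>
     (\<forall>k. dfn (\<lambda>e. e k = t e))"

lemma tm_in_M: "tm t \<Longrightarrow> range e \<subseteq> M \<Longrightarrow> t e \<in> M"
  by (simp add: tm_def)

lemma tm_supp2:
  assumes "tm s" "tm t"
  obtains n where "n > m" "\<And>e i y. i \<ge> n \<Longrightarrow> s (e(i := y)) = s e" "\<And>e i y. i \<ge> n \<Longrightarrow> t (e(i := y)) = t e"
proof -
  obtain n1 where n1: "\<And>e i y. i \<ge> n1 \<Longrightarrow> s (e(i := y)) = s e" using assms(1) unfolding tm_def by blast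
  obtain n2 where n2: "\<And>e i y. i \<ge> n2 \<Longrightarrow> t (e(i := y)) = t e" using assms(2) unfolding tm_def by blast
  show ?thesis
    by (rule that[of "Suc (max m (max n1 n2))"]) (auto simp: n1 n2)
qed

text \<open>Terms are eliminated by quantifying over their values: some x = \<open>s e\<close> and y
  = \<open>t e\<close> satisfy \<open>R x y\<close>. The slots \<open>n\<close> and
  \<open>Suc n\<close> that hold the two values lie beyond both supports.\<close>

lemma dfn_subst2:
  assumes "tm s" "tm t" and R: "\<And>i j. dfn (\<lambda>e. R (e i) (e j))"
  shows "dfn (\<lambda>e. R (s e) (t e))"
proof -
  obtain n where n: "\<And>e i y. i \<ge> n \<Longrightarrow> s (e(i := y)) = s e" "\<And>e i y. i \<ge> n \<Longrightarrow> t (e(i := y)) = t e"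
    using tm_supp2[OF assms(1,2)] by metis
  have "dfn (\<lambda>e. e n = s e)" "dfn (\<lambda>e. e (Suc n) = t e)"
    using assms by (auto simp: tm_def)
  then have "dfn (\<lambda>e. (e n = s e \<and> e (Suc n) = t e) \<and> R (e n) (e (Suc n)))"
    using R dfn_and by blast
  then have "dfn (\<lambda>e. \<exists>y\<in>M. (e n = s e \<and> y = t e) \<and> R (e n) y)"
    by (intro dfn_ex[where k = "Suc n" and Q = "\<lambda>e y. (e n = s e \<and> y = t e) \<and> R (e n) y"]) (simp_all add: n)
  then have "dfn (\<lambda>e. \<exists>x\<in>M. \<exists>y\<in>M. (x = s e \<and> y = t e) \<and> R x y)"
    by (intro dfn_ex[where k = n and Q = "\<lambda>e x. \<exists>y\<in>M. (x = s e \<and> y = t e) \<and> R x y"]) (simp_all add: n)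
  then show ?thesis
    by (rule dfn_cong) (use assms tm_in_M in auto)
qed

lemma dfn_mem: "tm s \<Longrightarrow> tm t \<Longrightarrow> dfn (\<lambda>e. s e \<in> elts (t e))"
  using dfn_subst2[where R = "\<lambda>x y. x \<in> elts y"] dfn_mem_var by blast

lemma dfn_eq: "tm s \<Longrightarrow> tm t \<Longrightarrow> dfn (\<lambda>e. s e = t e)"
  using dfn_subst2[where R = "\<lambda>x y. x = y"] dfn_eq_var by blast

lemma tm_var: "tm (\<lambda>e. e i)"
  unfolding tm_def by (intro conjI exI[of _ "Suc i"]) (auto intro: dfn_eq_var)

text \<open>Definability of membership in the value is enough for definability of the graph: by
  transitivity of \<open>M\<close>, two of its elements are equal as soon as they have the same
  members in \<open>M\<close>.\<close>

lemma tmI: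
  assumes "\<And>e. range e \<subseteq> M \<Longrightarrow> t e \<in> M"
    and supp: "\<And>e i y. i \<ge> n \<Longrightarrow> t (e(i := y)) = t e"
    and "\<And>i. dfn (\<lambda>e. e i \<in> elts (t e))"
  shows "tm t"
proof -
  have "dfn (\<lambda>e. e k = t e)" for k
  proof -
    let ?m = "Suc (k + n)"
    have "dfn (\<lambda>e. e ?m \<in> elts (e k) \<longleftrightarrow> e ?m \<in> elts (t e))"
      by (intro dfn_iff dfn_mem_var assms)
    then have "dfn (\<lambda>e. \<forall>z\<in>M. z \<in> elts (e k) \<longleftrightarrow> z \<in> elts (t e))"
      by (intro dfn_all[where k = ?m]) (auto simp: supp)
    then show ?thesis
    proof (rule dfn_cong)
      fix e :: "nat \<Rightarrow> hc" assume e: "range e \<subseteq> M"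
      then have "e k \<in> M" "t e \<in> M" using assms(1) by auto
      then show "(\<forall>z\<in>M. z \<in> elts (e k) \<longleftrightarrow> z \<in> elts (t e)) \<longleftrightarrow> e k = t e"
        using M_trans by (auto intro!: hc_ext)
    qed
  qed
  then show ?thesis using assms unfolding tm_def by blast
qed

lemma tm_empty: "tm (\<lambda>e. mk {})"
  by (rule tmI) (auto simp: dfn_False)

lemma tm_ins: assumes "tm s" "tm t" shows "tm (\<lambda>e. ins (s e) (t e))"
proof -
  obtain n where n: "\<And>e i y. i \<ge> n \<Longrightarrow> s (e(i := y)) = s e" "\<And>e i y. i \<ge> n \<Longrightarrow> t (e(i := y)) = t e"
    using tm_supp2[OF assms(1,2)] by metis
  show ?thesis
  proof (rule tmI[where n = n])
    fix i show "dfn (\<lambda>e. e i \<in> elts (ins (s e) (t e)))"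
      using assms by (simp add: dfn_or dfn_eq dfn_mem tm_var)
  qed (use assms n in \<open>auto simp: tm_in_M\<close>)
qed

lemma tm_pair: "tm s \<Longrightarrow> tm t \<Longrightarrow> tm (\<lambda>e. pair (s e) (t e))"
  by (simp add: pair_ins tm_ins tm_empty)

lemma tm_num: "tm (\<lambda>e. num n)"
  by (induction n) (simp_all add: tm_empty tm_ins num_Suc_ins del: num.simps(2))

text \<open>The tag \<open>k\<close> has no logical content: it is the variable used for the next quantifier.\<close>

definition lv :: "nat \<Rightarrow> ((nat \<Rightarrow> hc) \<Rightarrow> bool) \<Rightarrow> bool" where
  "lv k P \<longleftrightarrow> dfn P"

lemma lv_all:
  "lv (Suc k) (\<lambda>e. Q e (e k)) \<Longrightarrow> (\<And>e x y. Q (e(k := y)) x = Q e x) \<Longrightarrow> lv k (\<lambda>e. \<forall>x\<in>M. Q e x)"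
  unfolding lv_def by (rule dfn_all)

lemma lv_ex:
  "lv (Suc k) (\<lambda>e. Q e (e k)) \<Longrightarrow> (\<And>e x y. Q (e(k := y)) x = Q e x) \<Longrightarrow> lv k (\<lambda>e. \<exists>x\<in>M. Q e x)"
  unfolding lv_def by (rule dfn_ex)

text \<open>Formulas quantify over \<open>M\<close> only; a quantifier bounded by a set of
  \<open>M\<close> reduces to this because \<open>M\<close> is transitive.\<close>

lemma lv_ball:
  assumes "tm t" "lv (Suc k) (\<lambda>e. Q e (e k))" and "\<And>e x y. Q (e(k := y)) x = Q e x"
    and "\<And>e y. t (e(k := y)) = t e"
  shows "lv k (\<lambda>e. \<forall>x\<in>elts (t e). Q e x)"
proof -
  have "dfn (\<lambda>e. \<forall>x\<in>M. x \<in> elts (t e) \<longrightarrow> Q e x)"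
    by (rule dfn_all[where k = k])
      (use assms in \<open>auto simp: lv_def intro!: dfn_imp dfn_mem tm_var\<close>)
  then show ?thesis
    unfolding lv_def by (rule dfn_cong) (use M_trans tm_in_M[OF assms(1)] in blast)
qed

lemma lv_bex:
  assumes "tm t" "lv (Suc k) (\<lambda>e. Q e (e k))" and "\<And>e x y. Q (e(k := y)) x = Q e x"
    and "\<And>e y. t (e(k := y)) = t e"
  shows "lv k (\<lambda>e. \<exists>x\<in>elts (t e). Q e x)"
proof -
  have "dfn (\<lambda>e. \<exists>x\<in>M. x \<in> elts (t e) \<and> Q e x)"
    by (rule dfn_ex[where k = k])
      (use assms in \<open>auto simp: lv_def intro!: dfn_and dfn_mem tm_var\<close>)
  then show ?thesis
    unfolding lv_def by (rule dfn_cong) (use M_trans tm_in_M[OF assms(1)] in blast)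
qed

lemma lv_not: "lv k P \<Longrightarrow> lv k (\<lambda>e. \<not> P e)"
  and lv_and: "lv k P \<Longrightarrow> lv k Q \<Longrightarrow> lv k (\<lambda>e. P e \<and> Q e)"
  and lv_or: "lv k P \<Longrightarrow> lv k Q \<Longrightarrow> lv k (\<lambda>e. P e \<or> Q e)"
  and lv_imp: "lv k P \<Longrightarrow> lv k Q \<Longrightarrow> lv k (\<lambda>e. P e \<longrightarrow> Q e)"
  and lv_iff: "lv k P \<Longrightarrow> lv k Q \<Longrightarrow> lv k (\<lambda>e. P e \<longleftrightarrow> Q e)"
  and lv_mem: "tm s \<Longrightarrow> tm t \<Longrightarrow> lv k (\<lambda>e. s e \<in> elts (t e))"
  and lv_eq: "tm s \<Longrightarrow> tm t \<Longrightarrow> lv k (\<lambda>e. s e = t e)"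
  unfolding lv_def
  by (simp_all add: dfn_not dfn_and dfn_or dfn_imp dfn_iff dfn_mem dfn_eq)

lemma lv_subset:
  assumes "tm s" "tm t" shows "lv k (\<lambda>e. elts (s e) \<subseteq> elts (t e))"
proof -
  obtain n where n: "\<And>e i y. i \<ge> n \<Longrightarrow> s (e(i := y)) = s e" "\<And>e i y. i \<ge> n \<Longrightarrow> t (e(i := y)) = t e"
    using tm_supp2[OF assms(1,2)] by metis
  have "lv n (\<lambda>e. \<forall>x\<in>elts (s e). x \<in> elts (t e))"
    by (rule lv_ball) (use assms n in \<open>auto intro: lv_mem tm_var\<close>)
  then show ?thesis unfolding lv_def subset_iff Ball_def .
qed

text \<open>Applied in a loop, with \<open>simp\<close> discharging the freshness conditions, these
  rules take a relation apart down to its atoms. The index grows with every quantifier, so nested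
  quantifiers get different slots; each use starts it beyond the slots of the element and the
  parameters.\<close>

lemmas lv_rules = lv_not lv_and lv_or lv_imp lv_iff lv_ball lv_bex lv_all lv_ex lv_subset lv_mem lv_eq
  tm_var tm_empty tm_num tm_ins tm_pair

section \<open>Separation and replacement for definable predicates\<close>

lemma range_env: "set ps \<subseteq> M \<Longrightarrow> range (env ps) \<subseteq> M"
  by (auto simp: env_def subset_iff)

lemma env_upd_0: "(env (y # ps))(0 := x) = env (x # ps)"
  by (auto simp: fun_eq_iff env_def nth_Cons split: nat.splits)

lemma env_upd_1: "(env (x # z # ps))(Suc 0 := y) = env (x # y # ps)"
  by (auto simp: fun_eq_iff env_def nth_Cons split: nat.splits)

text \<open>The element under test sits in slot 0 and the parameters \<open>ps\<close> follow from
  slot 1 on.\<close>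

lemma separation:
  assumes "A \<in> M" "lv k P" "set ps \<subseteq> M"
  shows "mk {x \<in> elts A. P (env (x # ps))} \<in> M"
proof -
  obtain \<phi> where \<phi>: "\<And>e. range e \<subseteq> M \<Longrightarrow> sat M \<phi> e = P e"
    using assms(2) unfolding dfn_def lv_def by blast
  have r: "range (env (x # ps)) \<subseteq> M" if "x \<in> M" for x
    using range_env[of "x # ps"] that assms by auto
  obtain B where B: "B \<in> M"
    "\<And>x. x \<in> M \<Longrightarrow> x \<in> elts B \<longleftrightarrow> x \<in> elts A \<and> sat M \<phi> ((env (mk {} # ps))(0 := x))"
    using models r[of "mk {}"] assms(1) unfolding models_ZFC_def ax_separation_def by (metis empty_in_M)
  then have "elts B = {x \<in> elts A. P (env (x # ps))}"
    using M_trans[OF B(1)] M_trans[OF assms(1)] \<phi>[OF r] by (auto simp: env_upd_0)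
  then show ?thesis using B(1) by (metis mk_elts)
qed

text \<open>The argument sits in slot 0, the value in slot 1, the parameters from slot 2 on. The
  function \<open>f\<close> is one of HOL; what puts its image into \<open>M\<close> is that its
  graph over \<open>elts A\<close> is definable.\<close>

lemma replacement:
  assumes "A \<in> M" "lv k P" "set ps \<subseteq> M"
    and f: "\<And>x. x \<in> elts A \<Longrightarrow> f x \<in> M"
    and Pf: "\<And>x y. x \<in> elts A \<Longrightarrow> y \<in> M \<Longrightarrow> P (env (x # y # ps)) \<longleftrightarrow> y = f x"
  shows "mk (f ` elts A) \<in> M"
proof -
  obtain \<phi> where \<phi>: "\<And>e. range e \<subseteq> M \<Longrightarrow> sat M \<phi> e = P e"
    using assms(2) unfolding dfn_def lv_def by blast
  have r: "range (env (x # y # ps)) \<subseteq> M" if "x \<in> M" "y \<in> M" for x y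
    using range_env[of "x # y # ps"] that assms by auto
  have s: "sat M \<phi> ((env (mk {} # mk {} # ps))(0 := x, 1 := y)) \<longleftrightarrow> y = f x"
    if "x \<in> elts A" "y \<in> M" for x y
    using \<phi>[OF r[of x y]] Pf[OF that] that(2) M_trans[OF assms(1) that(1)]
    by (simp only: env_upd_0 env_upd_1 One_nat_def)
  have fn: "y = z" if "x \<in> elts A" "y \<in> M" "z \<in> M" "sat M \<phi> ((env (mk {} # mk {} # ps))(0 := x, 1 := y))"
    "sat M \<phi> ((env (mk {} # mk {} # ps))(0 := x, 1 := z))" for x y z
    using that s by auto
  have "ax_replacement M" using models by (simp add: models_ZFC_def)
  then have "\<exists>B\<in>M. \<forall>y\<in>M. y \<in> elts B \<longleftrightarrow>
       (\<exists>x\<in>M. x \<in> elts A \<and> sat M \<phi> ((env (mk {} # mk {} # ps))(0 := x, 1 := y)))"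
    unfolding ax_replacement_def
    using r[OF empty_in_M empty_in_M] assms(1) fn by (elim allE[of _ \<phi>] allE[of _ "env (mk {} # mk {} # ps)"]) auto
  then obtain B where B: "B \<in> M"
    "\<And>y. y \<in> M \<Longrightarrow> y \<in> elts B \<longleftrightarrow>
       (\<exists>x\<in>M. x \<in> elts A \<and> sat M \<phi> ((env (mk {} # mk {} # ps))(0 := x, 1 := y)))"
    by blast
  have "elts B = f ` elts A"
  proof (rule Set.set_eqI)
    fix y
    show "y \<in> elts B \<longleftrightarrow> y \<in> f ` elts A"
      using M_trans[OF B(1), of y] M_trans[OF assms(1)] f B(2)[of y] s[of _ y]
      by (cases "y \<in> M") (auto simp: image_iff)
  qed
  then show ?thesis using B(1) by (metis mk_elts)
qed

end

section \<open>Conditions and names\<close>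

text \<open>One entry of a condition: column, row and bit.\<close>

definition tr :: "nat \<Rightarrow> nat \<Rightarrow> bool \<Rightarrow> hc" where
  "tr k m b = pair (pair (num k) (num m)) (num (of_bool b))"

lemma tr_inject [simp]: "tr k m b = tr k' m' b' \<longleftrightarrow> k = k' \<and> m = m' \<and> b = b'"
  by (auto simp: tr_def simp del: num.simps)

lemma elts_cohen_condition: "elts (cohen_condition F n f) = {tr k m (f k m) | k m. k \<in> F \<and> m < n}"
proof -
  have "countable ((\<lambda>(k, m). tr k m (f k m)) ` UNIV)"
    by (rule countable_image) simp
  then have "countable {tr k m (f k m) | k m. k \<in> F \<and> m < n}"
    by (rule countable_subset[rotated]) auto
  then show ?thesis
    by (simp add: cohen_condition_def tr_def)
qed

lemma tr_mem_cohen_condition: "tr k m b \<in> elts (cohen_condition F n f) \<longleftrightarrow> k \<in> F \<and> m < n \<and> b = f k m"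
  by (auto simp: elts_cohen_condition)

text \<open>Describes a condition by its entries alone; the function \<open>f\<close> is recovered
  from the positions that carry bit 1. In this shape the poset can be defined by a formula.\<close>

lemma cohen_poset_iff:
  "p \<in> cohen_poset \<longleftrightarrow> (\<exists>F n. finite F \<and> (\<forall>t\<in>elts p. \<exists>k\<in>F. \<exists>m<n. \<exists>b. t = tr k m b) \<and>
     (\<forall>k\<in>F. \<forall>m<n. tr k m True \<in> elts p \<longleftrightarrow> tr k m False \<notin> elts p))"
  (is "_ \<longleftrightarrow> ?R")
proof
  assume "p \<in> cohen_poset"
  then obtain F n f where "finite F" "p = cohen_condition F n f"
    by (auto simp: cohen_poset_def)
  then show ?R
    by (intro exI[of _ F] exI[of _ n]) (auto simp: tr_mem_cohen_condition, auto simp: elts_cohen_condition)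
next
  assume ?R
  then obtain F n where "finite F" "\<forall>t\<in>elts p. \<exists>k\<in>F. \<exists>m<n. \<exists>b. t = tr k m b"
    "\<forall>k\<in>F. \<forall>m<n. tr k m True \<in> elts p \<longleftrightarrow> tr k m False \<notin> elts p" by blast
  then have F: "finite F" "\<And>t. t \<in> elts p \<Longrightarrow> \<exists>k\<in>F. \<exists>m<n. \<exists>b. t = tr k m b"
    "\<And>k m. k \<in> F \<Longrightarrow> m < n \<Longrightarrow> tr k m True \<in> elts p \<longleftrightarrow> tr k m False \<notin> elts p" by blast+
  have "tr k m b \<in> elts p \<longleftrightarrow> (tr k m True \<in> elts p) = b" if "k \<in> F" "m < n" for k m b
    using F(3)[OF that] by (cases b) auto
  then have "elts p = elts (cohen_condition F n (\<lambda>k m. tr k m True \<in> elts p))"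
    using F(2) by (auto simp: tr_mem_cohen_condition) (auto simp: elts_cohen_condition, metis)
  then have "p = cohen_condition F n (\<lambda>k m. tr k m True \<in> elts p)" by (rule hc_ext)
  then show "p \<in> cohen_poset" using F(1) unfolding cohen_poset_def by blast
qed

lemma cohen_poset_tr:
  assumes "p \<in> cohen_poset" "t \<in> elts p"
  obtains k m b where "t = tr k m b"
  using assms unfolding cohen_poset_iff by blast

lemma cohen_poset_fun: "p \<in> cohen_poset \<Longrightarrow> tr k m b \<in> elts p \<Longrightarrow> tr k m b' \<in> elts p \<Longrightarrow> b = b'"
  by (auto simp: cohen_poset_def tr_mem_cohen_condition)

lemma finite_cohen: assumes "p \<in> cohen_poset" shows "finite (elts p)"
proof -
  obtain F n f where F: "finite F" "p = cohen_condition F n f"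
    using assms by (auto simp: cohen_poset_def)
  have "elts p \<subseteq> (\<lambda>(k, m). tr k m (f k m)) ` (F \<times> {..<n})"
    by (auto simp: F elts_cohen_condition)
  then show ?thesis by (rule finite_subset) (simp add: F)
qed

lemma empty_in_poset [simp]: "mk {} \<in> cohen_poset"
  unfolding cohen_poset_iff by (intro exI[of _ "{}"] exI[of _ 0]) auto

text \<open>The domain of a condition is a rectangle, so prescribing the bits on \<open>D\<close>
  means passing to a larger rectangle, filled with \<open>h\<close> outside the old one. Where
  \<open>D\<close> meets the old rectangle, the hypothesis makes \<open>p\<close> agree with
  \<open>h\<close>.\<close>

lemma cohen_extend:
  assumes "p \<in> cohen_poset" "finite D" "\<And>k m. (k, m) \<in> D \<Longrightarrow> tr k m (\<not> h k m) \<notin> elts p"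
  obtains q where "q \<in> cohen_poset" "elts p \<subseteq> elts q" "\<And>k m. (k, m) \<in> D \<Longrightarrow> tr k m (h k m) \<in> elts q"
proof -
  obtain F n f where F: "finite F" "p = cohen_condition F n f"
    using assms by (auto simp: cohen_poset_def)
  obtain N where N: "\<forall>m\<in>snd ` D. m \<le> N"
    using assms(2) finite_nat_set_iff_bounded_le[of "snd ` D"] by auto
  let ?q = "cohen_condition (F \<union> fst ` D) (max n (Suc N)) (\<lambda>k m. if k \<in> F \<and> m < n then f k m else h k m)"
  show ?thesis
  proof (rule that[of ?q])
    show "?q \<in> cohen_poset" using F(1) assms(2) unfolding cohen_poset_def by blast
    show "elts p \<subseteq> elts ?q"
      unfolding F elts_cohen_condition by auto (metis less_max_iff_disj)
    show "tr k m (h k m) \<in> elts ?q" if "(k, m) \<in> D" for k m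
      using assms(3)[OF that] N that unfolding tr_mem_cohen_condition F
      by (force simp: less_Suc_eq_le max_def)
  qed
qed

text \<open>The canonical name of n. All its conditions are the weakest one, \<open>mk {}\<close>,
  which every generic filter contains.\<close>

fun chk :: "nat \<Rightarrow> hc" where
  "chk 0 = mk {}"
| "chk (Suc n) = ins (pair (chk n) (mk {})) (chk n)"

lemma elts_chk: "elts (chk n) = (\<lambda>j. pair (chk j) (mk {})) ` {..<n}"
  by (induction n) (auto simp: lessThan_Suc)

text \<open>The Cohen real is coded as a subset of omega: the rows in which column n carries bit
  1.\<close>

definition xn :: "nat \<Rightarrow> hc" where
  "xn n = mk {pair (chk m) p | m p. p \<in> cohen_poset \<and> tr n m True \<in> elts p}"

definition Xname :: hc where
  "Xname = mk (range (\<lambda>n. pair (xn n) (mk {})))"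

lemma elts_Xname: "elts Xname = range (\<lambda>n. pair (xn n) (mk {}))"
  by (simp add: Xname_def)

definition cart :: "hc \<Rightarrow> hc \<Rightarrow> hc" where
  "cart A B = mk ((\<lambda>(a, b). pair a b) ` (elts A \<times> elts B))"

lemma elts_cart: "elts (cart A B) = (\<lambda>(a, b). pair a b) ` (elts A \<times> elts B)"
  unfolding cart_def by (intro elts_mk countable_image countable_SIGMA countable_elts)

lemma pair_mem_cart [simp]: "pair a b \<in> elts (cart A B) \<longleftrightarrow> a \<in> elts A \<and> b \<in> elts B"
  by (auto simp: elts_cart)

definition Fin :: "hc \<Rightarrow> hc" where
  "Fin A = mk {s. elts s \<subseteq> elts A \<and> finite (elts s)}"

lemma elts_Fin [simp]: "elts (Fin A) = {s. elts s \<subseteq> elts A \<and> finite (elts s)}"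
proof -
  have "{s. elts s \<subseteq> elts A \<and> finite (elts s)} \<subseteq> mk ` {F. F \<subseteq> elts A \<and> finite F}"
    by (auto intro: image_eqI[where x = "elts _"])
  moreover have "countable {F. F \<subseteq> elts A \<and> finite F}"
    using countable_Collect_finite_subset[OF countable_elts, of A] by (simp add: conj_commute)
  ultimately have "countable {s. elts s \<subseteq> elts A \<and> finite (elts s)}"
    using countable_subset[OF _ countable_image] by blast
  then show ?thesis by (simp add: Fin_def)
qed

text \<open>The expression in \<open>pair_ins\<close> with each adjoined element paired with the
  trivial condition, hence a name of the ordered pair.\<close>

definition opn :: "hc \<Rightarrow> hc \<Rightarrow> hc" where
  "opn a b = ins (pair (ins (pair a (mk {})) (mk {})) (mk {}))
    (ins (pair (ins (pair a (mk {})) (ins (pair b (mk {})) (mk {}))) (mk {})) (mk {}))"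

text \<open>A finite subset of \<open>Xname\<close> is itself the name of a finite set of Cohen
  reals. As \<open>num 1\<close> has \<open>mk {}\<close> as its only member, the product attaches
  the trivial condition to each of them.\<close>

definition Sname :: hc where
  "Sname = cart (Fin Xname) (num 1)"

text \<open>The colour is read off the name \<open>s\<close> instead of its value. The two agree
  because different columns have different names (\<open>xn_inject\<close>) and different values
  (\<open>creal_inject\<close>).\<close>

definition cname :: hc where
  "cname = mk ((\<lambda>s. pair (opn s (chk (of_bool (\<exists>t. elts s = {t})))) (mk {})) ` elts (Fin Xname))"

definition omega_name :: hc where
  "omega_name = mk (range (\<lambda>n. pair (chk n) (mk {})))"

lemma countable_cohen_poset: "countable cohen_poset"
proof -
  let ?T = "mk (range (\<lambda>(k, m, b). tr k m b))"
  have "cohen_poset \<subseteq> elts (Fin ?T)"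
  proof
    fix p assume p: "p \<in> cohen_poset"
    have "t \<in> elts ?T" if "t \<in> elts p" for t
      by (rule cohen_poset_tr[OF p that]) (auto intro: range_eqI[where x = "(_, _, _)"])
    then show "p \<in> elts (Fin ?T)" using finite_cohen[OF p] by auto
  qed
  then show ?thesis using countable_subset[OF _ countable_elts] by blast
qed

lemma elts_xn: "elts (xn n) = {pair (chk m) p | m p. p \<in> cohen_poset \<and> tr n m True \<in> elts p}"
proof -
  have "{pair (chk m) p | m p. p \<in> cohen_poset \<and> tr n m True \<in> elts p} \<subseteq>
    (\<lambda>(m, p). pair (chk m) p) ` (UNIV \<times> cohen_poset)"
    by auto
  then have "countable {pair (chk m) p | m p. p \<in> cohen_poset \<and> tr n m True \<in> elts p}"
    by (rule countable_subset) (intro countable_image countable_SIGMA countable_cohen_poset countableI_type)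
  then show ?thesis by (simp add: xn_def)
qed

section \<open>Omega, products and finite subsets in the ground model\<close>

context ctm
begin

lemma finite_in_M: "finite A \<Longrightarrow> A \<subseteq> M \<Longrightarrow> mk A \<in> M"
  by (rule mk_finite_closed) auto

text \<open>The elements of \<open>I\<close> that lie in all inductive sets of \<open>M\<close> form
  a set \<open>N\<close> of \<open>M\<close> containing the numerals. An \<in>-minimal non-numeral n
  in \<open>N\<close> could be removed, and the rest would be an inductive set of \<open>M\<close>
  that omits n.\<close>

lemma omega_in_M [simp]: "omega \<in> M"
proof -
  obtain I where I: "I \<in> M" "is_inductive M I"
    using models by (auto simp: models_ZFC_def ax_infinity_def)
  have succ: "is_succ M y s \<longleftrightarrow> s = ins y y" if "y \<in> M" "s \<in> M" for y s
    using that M_trans[of y] M_trans[of s] by (auto simp: is_succ_def intro!: hc_ext)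
  have I': "mk {} \<in> elts I" "\<And>y. y \<in> elts I \<Longrightarrow> ins y y \<in> elts I"
    using I M_trans[OF I(1)] by (auto simp: is_inductive_def is_empty_iff succ)
  define N where "N = mk {n \<in> elts I. \<forall>y\<in>M. mk {} \<in> elts y \<and> (\<forall>z\<in>elts y. ins z z \<in> elts y) \<longrightarrow> n \<in> elts y}"
  have "lv 1 (\<lambda>e. \<forall>y\<in>M. mk {} \<in> elts y \<and> (\<forall>z\<in>elts y. ins z z \<in> elts y) \<longrightarrow> e 0 \<in> elts y)"
    by (rule lv_rules | simp)+
  from separation[OF I(1) this, of "[]"] have N: "N \<in> M" by (simp add: N_def)
  have eN: "elts N = {n \<in> elts I. \<forall>y\<in>M. mk {} \<in> elts y \<and> (\<forall>z\<in>elts y. ins z z \<in> elts y) \<longrightarrow> n \<in> elts y}"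
    unfolding N_def by (rule elts_mk, rule countable_subset_elts[of _ I]) auto
  have "num k \<in> elts N" for k
    by (induction k) (auto simp: eN I' num_Suc_ins simp del: num.simps(2))
  moreover have "n \<in> range num" if "n \<in> elts N" for n
    using that
  proof (induction n rule: elt_induct)
    case (elt n)
    show ?case
    proof (rule ccontr)
      assume n: "n \<notin> range num"
      have "lv 2 (\<lambda>e. e 0 \<noteq> e 1)"
        by (rule lv_rules)+
      from separation[OF N this, of "[n]"] have "mk {x \<in> elts N. x \<noteq> n} \<in> M"
        using M_trans[OF N elt.prems] by simp
      moreover have e: "elts (mk {x \<in> elts N. x \<noteq> n}) = {x \<in> elts N. x \<noteq> n}"
        by (rule elts_mk, rule countable_subset_elts[of _ N]) auto
      moreover have "mk {} \<in> elts N" "mk {} \<noteq> n"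
        using n \<open>num 0 \<in> elts N\<close> by (auto simp: eN I' intro: range_eqI[of _ _ 0])
      moreover have "ins z z \<in> elts N \<and> ins z z \<noteq> n" if "z \<in> elts N" "z \<noteq> n" for z
      proof
        show "ins z z \<in> elts N" using that by (simp add: eN I')
        \<comment> \<open>A predecessor z of n is a member of n, hence a numeral by induction, and n
          would be the next one.\<close>
        show "ins z z \<noteq> n"
        proof
          assume z: "ins z z = n"
          then have "z \<in> range num" using elt.IH[of z] that by auto
          then obtain k where "z = num k" by auto
          then have "ins z z = num (Suc k)" by (simp only: num_Suc_ins)
          with z n show False by (metis rangeI)
        qed
      qed
      ultimately have "\<exists>y\<in>M. mk {} \<in> elts y \<and> (\<forall>z\<in>elts y. ins z z \<in> elts y) \<and> n \<notin> elts y"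
        by (intro bexI[of _ "mk {x \<in> elts N. x \<noteq> n}"]) (simp_all only: e, auto)
      moreover have "\<forall>y\<in>M. mk {} \<in> elts y \<and> (\<forall>z\<in>elts y. ins z z \<in> elts y) \<longrightarrow> n \<in> elts y"
        using elt.prems by (simp only: eN mem_Collect_eq, elim conjE)
      ultimately show False by blast
    qed
  qed
  ultimately have "elts N = elts omega" by auto
  then show ?thesis using N hc_ext by blast
qed

text \<open>Kuratowski pairs over \<open>A\<close> and \<open>B\<close> are sets of subsets of their
  union, so the twofold power set bounds the product.\<close>

lemma cart_in_M [simp]: assumes "A \<in> M" "B \<in> M" shows "cart A B \<in> M"
proof -
  let ?U = "mk (elts A \<union> elts B)"
  have U: "?U \<in> M" by (rule Un_in_M[OF assms])
  have D: "Pw (Pw ?U) \<in> M" by (intro Pw_in_M U)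
  have "lv 3 (\<lambda>e. \<exists>a\<in>elts (e 1). \<exists>b\<in>elts (e 2). e 0 = pair a b)"
    by (rule lv_rules | simp)+
  from separation[OF D this, of "[A, B]"]
  have *: "mk {x \<in> elts (Pw (Pw ?U)). \<exists>a\<in>elts A. \<exists>b\<in>elts B. x = pair a b} \<in> M"
    using assms by simp
  have "pair a b \<in> elts (Pw (Pw ?U))" if "a \<in> elts A" "b \<in> elts B" for a b
    using that M_trans[OF assms(1)] M_trans[OF assms(2)]
    by (auto simp: elts_Pw U Pw_in_M elts_pair upair_in_M upair_in_M[of a a, simplified])
  then have "{x \<in> elts (Pw (Pw ?U)). \<exists>a\<in>elts A. \<exists>b\<in>elts B. x = pair a b} = (\<lambda>(a, b). pair a b) ` (elts A \<times> elts B)"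
    by auto
  with * show ?thesis by (simp add: cart_def)
qed

text \<open>Finiteness is expressed inside \<open>M\<close> by a labelling: each element of s gets a
  label below some numeral, and no two elements share one. A labelling injects s into a numeral;
  conversely, an enumeration of a finite s is a finite set of pairs and so belongs to
  \<open>M\<close>.\<close>

lemma Fin_in_M [simp]: assumes A: "A \<in> M" shows "Fin A \<in> M"
proof -
  let ?Q = "\<lambda>s. \<exists>f\<in>M. \<exists>n\<in>elts omega. (\<forall>x\<in>elts s. \<exists>k\<in>elts n. pair k x \<in> elts f) \<and>
    (\<forall>k\<in>elts n. \<forall>x\<in>elts s. \<forall>y\<in>elts s. pair k x \<in> elts f \<longrightarrow> pair k y \<in> elts f \<longrightarrow> x = y)"
  have "lv 2 (\<lambda>e. \<exists>f\<in>M. \<exists>n\<in>elts (e 1). (\<forall>x\<in>elts (e 0). \<exists>k\<in>elts n. pair k x \<in> elts f) \<and>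
    (\<forall>k\<in>elts n. \<forall>x\<in>elts (e 0). \<forall>y\<in>elts (e 0). pair k x \<in> elts f \<longrightarrow> pair k y \<in> elts f \<longrightarrow> x = y))"
    by (rule lv_rules | simp)+
  from separation[OF Pw_in_M[OF A] this, of "[omega]"]
  have *: "mk {s \<in> elts (Pw A). ?Q s} \<in> M" by (simp del: elts_omega)
  have "?Q s \<longleftrightarrow> finite (elts s)" if s: "s \<in> M" for s
  proof
    assume "?Q s"
    then obtain f N where N: "N \<in> elts omega" and f: "\<forall>x\<in>elts s. \<exists>k\<in>elts N. pair k x \<in> elts f"
      "\<forall>k\<in>elts N. \<forall>x\<in>elts s. \<forall>y\<in>elts s. pair k x \<in> elts f \<longrightarrow> pair k y \<in> elts f \<longrightarrow> x = y"
      by blast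
    from N obtain n where n: "N = num n" by auto
    obtain g where g: "\<And>x. x \<in> elts s \<Longrightarrow> g x \<in> elts N \<and> pair (g x) x \<in> elts f"
      using f(1) by metis
    have "inj_on g (elts s)" using g f(2) by (metis inj_onI)
    moreover have "finite (g ` elts s)"
      by (rule finite_subset[of _ "elts N"]) (use g in \<open>auto simp: n elts_num simp del: num.simps\<close>)
    ultimately show "finite (elts s)" by (rule finite_imageD[rotated])
  next
    assume "finite (elts s)"
    then obtain h and n :: nat where h: "elts s = h ` {i. i < n}" "inj_on h {i. i < n}"
      using finite_imp_nat_seg_image_inj_on by metis
    let ?f = "mk ((\<lambda>i. pair (num i) (h i)) ` {i. i < n})"
    have f: "elts ?f = (\<lambda>i. pair (num i) (h i)) ` {i. i < n}"
      by simp
    have "?f \<in> M"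
      by (rule finite_in_M) (use h M_trans[OF s] in auto)
    moreover have "num n \<in> elts omega" by simp
    moreover have "\<forall>x\<in>elts s. \<exists>k\<in>elts (num n). pair k x \<in> elts ?f"
      unfolding f h(1) by (auto simp: elts_num simp del: num.simps)
    moreover have "\<forall>k\<in>elts (num n). \<forall>x\<in>elts s. \<forall>y\<in>elts s. pair k x \<in> elts ?f \<longrightarrow> pair k y \<in> elts ?f \<longrightarrow> x = y"
      unfolding f by (auto simp del: num.simps)
    ultimately show "?Q s" by blast
  qed
  then have "{s \<in> elts (Pw A). ?Q s} = {s. elts s \<subseteq> elts A \<and> finite (elts s)}"
    using finite_in_M[of "elts _"] M_trans[OF A] by (auto simp: elts_Pw[OF A] subset_iff)
  then show ?thesis using * by (simp add: Fin_def)
qed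

end

definition PP :: hc where
  "PP = mk cohen_poset"

lemma elts_PP [simp]: "elts PP = cohen_poset"
  by (simp add: PP_def countable_cohen_poset)

lemma elts_num_2: "elts (num 2) = {num 0, num 1}"
  by (auto simp: elts_num numeral_2_eq_2 lessThan_Suc simp del: num.simps)

lemma chk_inject [simp]: "chk m = chk n \<longleftrightarrow> m = n"
proof -
  have "chk m \<noteq> chk n" if "m < n" for m n
  proof
    assume "chk m = chk n"
    then have "pair (chk n) (mk {}) \<in> elts (chk n)"
      using that by (metis elts_chk imageI lessThan_iff)
    then have "(chk n, chk n) \<in> {(x, y). x \<in> elts y}\<^sup>+" by (rule pair_fst_trancl)
    then show False
      using wf_acyclic[OF wf_elts] by (auto simp: acyclic_def)
  qed
  then show ?thesis by (metis linorder_neqE_nat)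
qed

section \<open>The poset and the names as elements of the ground model\<close>

context ctm
begin

lemma PP_in_M [simp]: "PP \<in> M"
proof -
  let ?T = "cart (cart omega omega) (num 2)"
  have T: "Fin ?T \<in> M" by (simp del: num.simps)
  let ?Q = "\<lambda>p. \<exists>F\<in>M. \<exists>n\<in>elts omega. elts F \<subseteq> elts omega \<and>
     (\<forall>t\<in>elts p. \<exists>k\<in>elts F. \<exists>m\<in>elts n. \<exists>i\<in>elts (num 2). t = pair (pair k m) i) \<and>
     (\<forall>k\<in>elts F. \<forall>m\<in>elts n. pair (pair k m) (num 1) \<in> elts p \<longleftrightarrow> \<not> pair (pair k m) (num 0) \<in> elts p)"
  have "lv 2 (\<lambda>e. \<exists>F\<in>M. \<exists>n\<in>elts (e 1). elts F \<subseteq> elts (e 1) \<and>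
     (\<forall>t\<in>elts (e 0). \<exists>k\<in>elts F. \<exists>m\<in>elts n. \<exists>i\<in>elts (num 2). t = pair (pair k m) i) \<and>
     (\<forall>k\<in>elts F. \<forall>m\<in>elts n. pair (pair k m) (num 1) \<in> elts (e 0) \<longleftrightarrow> \<not> pair (pair k m) (num 0) \<in> elts (e 0)))"
    by (rule lv_rules | simp)+
  from separation[OF T this, of "[omega]"]
  have *: "mk {p \<in> elts (Fin ?T). ?Q p} \<in> M" by (simp del: elts_omega num.simps elts_Fin)
  have "p \<in> elts (Fin ?T) \<and> ?Q p \<longleftrightarrow> p \<in> cohen_poset" for p
  proof (intro iffI conjI; (elim conjE)?)
    assume p: "p \<in> elts (Fin ?T)" and "?Q p"
    then obtain F N where F: "N \<in> elts omega" "elts F \<subseteq> elts omega"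
      "\<forall>t\<in>elts p. \<exists>k\<in>elts F. \<exists>m\<in>elts N. \<exists>i\<in>elts (num 2). t = pair (pair k m) i"
      "\<forall>k\<in>elts F. \<forall>m\<in>elts N. pair (pair k m) (num 1) \<in> elts p \<longleftrightarrow> \<not> pair (pair k m) (num 0) \<in> elts p"
      by blast
    then obtain n where n: "N = num n" by auto
    have F3: "\<exists>k m b. num k \<in> elts F \<and> m < n \<and> t = tr k m b" if t: "t \<in> elts p" for t
    proof -
      obtain k m i where k: "k \<in> elts F" "m \<in> elts N" "i \<in> elts (num 2)" "t = pair (pair k m) i"
        using F(3) t by blast
      obtain k' where "k = num k'" using k F(2) by auto
      moreover obtain m' where "m = num m'" "m' < n" using k n by (auto simp: elts_num simp del: num.simps)
      moreover obtain b where "i = num (of_bool b)"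
        using k(3) unfolding elts_num_2 by (metis insertE of_bool_eq singletonD)
      ultimately show ?thesis using k unfolding tr_def by blast
    qed
    have F4: "tr k m True \<in> elts p \<longleftrightarrow> tr k m False \<notin> elts p" if "num k \<in> elts F" "m < n" for k m
      using F(4) that unfolding tr_def n by (auto simp del: num.simps)
    show "p \<in> cohen_poset"
    \<comment> \<open>The formula does not say that \<open>F\<close> is finite. For n = 0 the
      condition is empty and the empty set can replace \<open>F\<close>; otherwise every column of
      \<open>F\<close> has an entry in row 0, and these are distinct members of the finite set
      p.\<close>
    proof (cases "n = 0")
      case True
      then show ?thesis using F3 unfolding cohen_poset_iff
        by (intro exI[of _ "{}"] exI[of _ 0]) auto
    next
      case False
      let ?F = "{k. num k \<in> elts F}"
      have "finite (elts p)" using p by simp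
      moreover have "\<exists>t\<in>elts p. \<exists>b. t = tr k 0 b" if "k \<in> ?F" for k
        using F4[of k 0] that False by auto
      then obtain g where g: "\<And>k. k \<in> ?F \<Longrightarrow> g k \<in> elts p \<and> (\<exists>b. g k = tr k 0 b)" by metis
      have "inj_on g ?F" by (rule inj_onI) (metis g tr_inject)
      moreover have "g ` ?F \<subseteq> elts p" using g by auto
      ultimately have "finite ?F" using finite_subset finite_imageD by metis
      then show ?thesis unfolding cohen_poset_iff
        by (intro exI[of _ ?F] exI[of _ n]) (use F3 F4 in blast)
    qed
  next
    assume p: "p \<in> cohen_poset"
    have b2: "num (of_bool b) \<in> elts (num 2)" for b unfolding elts_num_2 by (cases b) auto
    have "t \<in> elts ?T" if "t \<in> elts p" for t
      by (rule cohen_poset_tr[OF p that]) (auto simp: tr_def b2 simp del: num.simps num_mem_iff)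
    then show "p \<in> elts (Fin ?T)" using finite_cohen[OF p] by auto
    obtain F n where F: "finite F" "\<forall>t\<in>elts p. \<exists>k\<in>F. \<exists>m<n. \<exists>b. t = tr k m b"
      "\<forall>k\<in>F. \<forall>m<n. tr k m True \<in> elts p \<longleftrightarrow> tr k m False \<notin> elts p"
      using p unfolding cohen_poset_iff by blast
    let ?F = "mk (num ` F)"
    have eF: "elts ?F = num ` F" using F(1) by (simp add: countable_finite)
    have "?F \<in> M" by (rule finite_in_M) (use F in auto)
    moreover have "num n \<in> elts omega" by simp
    moreover have "elts ?F \<subseteq> elts omega" by (auto simp: eF)
    moreover have "\<forall>t\<in>elts p. \<exists>k\<in>elts ?F. \<exists>m\<in>elts (num n). \<exists>i\<in>elts (num 2). t = pair (pair k m) i"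
    proof
      fix t assume "t \<in> elts p"
      then obtain k m b where "k \<in> F" "m < n" "t = tr k m b" using F by blast
      then show "\<exists>k\<in>elts ?F. \<exists>m\<in>elts (num n). \<exists>i\<in>elts (num 2). t = pair (pair k m) i"
        unfolding eF tr_def
        by (intro bexI[of _ "num k"] bexI[of _ "num m"] bexI[of _ "num (of_bool b)"] b2)
          (auto simp del: num.simps)
    qed
    moreover have "\<forall>k\<in>elts ?F. \<forall>m\<in>elts (num n). pair (pair k m) (num 1) \<in> elts p \<longleftrightarrow> \<not> pair (pair k m) (num 0) \<in> elts p"
      using F(3) unfolding eF elts_num tr_def by (auto simp del: num.simps)
    ultimately show "?Q p" by blast
  qed
  then have "{p \<in> elts (Fin ?T). ?Q p} = cohen_poset" by blast
  with * show ?thesis by (simp only: PP_def)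
qed

lemma M_poset [simp]: "p \<in> cohen_poset \<Longrightarrow> p \<in> M"
  using M_trans[OF PP_in_M] by simp

definition chk_graph :: hc where
  "chk_graph = mk (range (\<lambda>n. pair (num n) (chk n)))"

lemma chk_in_M [simp]: "chk n \<in> M"
  by (induction n) auto

lemma elts_chk_graph: "elts chk_graph = range (\<lambda>n. pair (num n) (chk n))"
  by (simp add: chk_graph_def)

lemma pair_mem_chk_graph [simp]: "pair (num n) c \<in> elts chk_graph \<longleftrightarrow> c = chk n"
  by (auto simp: elts_chk_graph)

text \<open>The recursion for \<open>chk\<close> is carried out in \<open>M\<close> by
  approximations: \<open>con\<close> says that each pair in g is the initial one or arises from
  another pair in g by a recursion step. An approximation can give n only the value
  \<open>chk n\<close>, and the finite initial segments of the graph are approximations in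
  \<open>M\<close>.\<close>

lemma chk_graph_in_M [simp]: "chk_graph \<in> M"
proof -
  define con where "con = (\<lambda>w g. \<forall>t\<in>elts g. \<exists>k\<in>elts w. \<exists>z\<in>M. t = pair k z \<and> ((k = mk {} \<and> z = mk {}) \<or>
     (\<exists>k'\<in>elts w. \<exists>z'\<in>M. k = ins k' k' \<and> z = ins (pair z' (mk {})) z' \<and> pair k' z' \<in> elts g)))"
  have L: "lv 3 (\<lambda>e. \<exists>g\<in>M. con (e 2) g \<and> (\<exists>z\<in>M. e 1 = pair (e 0) z \<and> pair (e 0) z \<in> elts g))"
    unfolding con_def
    by (rule lv_rules | simp)+
  have "(\<exists>g\<in>M. con omega g \<and> (\<exists>z\<in>M. y = pair (num n) z \<and> pair (num n) z \<in> elts g)) \<longleftrightarrow>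
    y = pair (num n) (chk n)" for n y
  proof
    assume "\<exists>g\<in>M. con omega g \<and> (\<exists>z\<in>M. y = pair (num n) z \<and> pair (num n) z \<in> elts g)"
    then obtain g z where g: "con omega g" "pair (num n) z \<in> elts g" "y = pair (num n) z" by blast
    have "pair (num n) z \<in> elts g \<Longrightarrow> z = chk n"
    proof (induction n arbitrary: z)
      case 0
      then obtain k w where "pair (num 0) z = pair k w" "k = mk {} \<and> w = mk {} \<or> (\<exists>k'\<in>elts omega. k = ins k' k')"
        using g(1) unfolding con_def by blast
      moreover have "mk {} \<noteq> ins k k" for k by (metis elts_ins elts_mk countable_empty insert_not_empty)
      ultimately show ?case by auto
    next
      case (Suc n)
      then obtain k w where kw: "pair (num (Suc n)) z = pair k w" "k = mk {} \<and> w = mk {} \<or>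
        (\<exists>k'\<in>elts omega. \<exists>z'\<in>M. k = ins k' k' \<and> w = ins (pair z' (mk {})) z' \<and> pair k' z' \<in> elts g)"
        using g(1) unfolding con_def by blast
      have "num (Suc n) \<noteq> num 0" unfolding num_inject by simp
      then have "k \<noteq> mk {}" using kw(1) by simp
      with kw obtain k' z' where k': "k' \<in> elts omega" "num (Suc n) = ins k' k'" "z = ins (pair z' (mk {})) z'" "pair k' z' \<in> elts g"
        by auto
      from k' obtain j where j: "k' = num j" by auto
      have "num (Suc n) = num (Suc j)" using k'(2) unfolding j num_Suc_ins .
      then have "j = n" by (simp only: num_inject nat.inject)
      with j k' Suc.IH show ?case by simp
    qed
    with g show "y = pair (num n) (chk n)" by simp
  next
    assume y: "y = pair (num n) (chk n)"
    let ?g = "mk ((\<lambda>i. pair (num i) (chk i)) ` {..n})"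
    have e: "elts ?g = (\<lambda>i. pair (num i) (chk i)) ` {..n}" by simp
    have "?g \<in> M" by (rule finite_in_M) auto
    moreover have "con omega ?g"
      unfolding con_def
    proof
      fix t assume "t \<in> elts ?g"
      then obtain i where i: "i \<le> n" "t = pair (num i) (chk i)" unfolding e by blast
      have "(num i = mk {} \<and> chk i = mk {}) \<or> (\<exists>k'\<in>elts omega. \<exists>z'\<in>M. num i = ins k' k' \<and>
        chk i = ins (pair z' (mk {})) z' \<and> pair k' z' \<in> elts ?g)"
      proof (cases i)
        case (Suc j)
        then have "pair (num j) (chk j) \<in> elts ?g" using i unfolding e by auto
        moreover have "num i = ins (num j) (num j)" "chk i = ins (pair (chk j) (mk {})) (chk j)"
          unfolding Suc num_Suc_ins by simp_all
        ultimately show ?thesis by (intro disjI2 bexI[of _ "num j"] bexI[of _ "chk j"]) auto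
      qed simp
      with i show "\<exists>k\<in>elts omega. \<exists>z\<in>M. t = pair k z \<and> ((k = mk {} \<and> z = mk {}) \<or>
     (\<exists>k'\<in>elts omega. \<exists>z'\<in>M. k = ins k' k' \<and> z = ins (pair z' (mk {})) z' \<and> pair k' z' \<in> elts ?g))"
        by (intro bexI[of _ "num i"] bexI[of _ "chk i"]) auto
    qed
    moreover have "pair (num n) (chk n) \<in> elts ?g" unfolding e by auto
    ultimately show "\<exists>g\<in>M. con omega g \<and> (\<exists>z\<in>M. y = pair (num n) z \<and> pair (num n) z \<in> elts g)"
      using y by (intro bexI[of _ ?g] conjI bexI[of _ "chk n"]) auto
  qed
  note eq = this
  have "mk ((\<lambda>x. pair x (chk (the_inv num x))) ` elts omega) \<in> M"
  proof (rule replacement[OF omega_in_M L, where ps = "[omega]"])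
    fix x y assume "x \<in> elts omega" "y \<in> M"
    then obtain n where n: "x = num n" by auto
    show "(\<exists>g\<in>M. con (env [x, y, omega] 2) g \<and> (\<exists>z\<in>M. env [x, y, omega] 1 = pair (env [x, y, omega] 0) z \<and>
      pair (env [x, y, omega] 0) z \<in> elts g)) \<longleftrightarrow> y = pair x (chk (the_inv num x))"
      using eq[of y n] by (simp add: n the_inv_f_f inj_on_def)
  qed auto
  then show ?thesis
    by (simp add: chk_graph_def image_image the_inv_f_f inj_on_def)
qed

text \<open>Two unions lead from a set of Kuratowski pairs to their components. The result bounds
  the separations that define names built from \<open>chk\<close>.\<close>

lemma chk_superset: obtains D where "D \<in> M" "\<And>n. chk n \<in> elts D"
proof -
  let ?D = "mk (\<Union> (elts ` elts (mk (\<Union> (elts ` elts chk_graph)))))"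
  have "?D \<in> M" by (intro Union_in_M chk_graph_in_M)
  moreover have "chk n \<in> elts ?D" for n
  proof -
    have "mk {num n, chk n} \<in> elts (mk (\<Union> (elts ` elts chk_graph)))"
      by (auto simp: elts_chk_graph elts_pair)
    moreover have "chk n \<in> elts (mk {num n, chk n})" by simp
    ultimately have "chk n \<in> \<Union> (elts ` elts (mk (\<Union> (elts ` elts chk_graph))))" by blast
    then show ?thesis by simp
  qed
  ultimately show ?thesis using that by blast
qed

lemma xn_in_M [simp]: "xn n \<in> M"
proof -
  obtain D where D: "D \<in> M" "\<And>n. chk n \<in> elts D" using chk_superset by metis
  have "lv 3 (\<lambda>e. \<exists>m\<in>elts (e 1). \<exists>c\<in>M. \<exists>p\<in>M. pair m c \<in> elts (e 2) \<and> pair (pair (num n) m) (num 1) \<in> elts p \<and>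
     e 0 = pair c p)"
    by (rule lv_rules | simp)+
  from separation[OF cart_in_M[OF D(1) PP_in_M] this, of "[omega, chk_graph]"]
  have *: "mk {x \<in> elts (cart D PP). \<exists>m\<in>elts omega. \<exists>c\<in>M. \<exists>p\<in>M. pair m c \<in> elts chk_graph \<and>
     pair (pair (num n) m) (num 1) \<in> elts p \<and> x = pair c p} \<in> M"
    by (simp del: elts_omega num.simps)
  have "{x \<in> elts (cart D PP). \<exists>m\<in>elts omega. \<exists>c\<in>M. \<exists>p\<in>M. pair m c \<in> elts chk_graph \<and>
     pair (pair (num n) m) (num 1) \<in> elts p \<and> x = pair c p} = elts (xn n)"
    unfolding elts_xn using D(2) by (auto simp: tr_def simp del: num.simps)
  with * show ?thesis by simp
qed

text \<open>Replacement along n, where the formula identifies \<open>xn n\<close> by its members,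
  uniformly in n, with \<open>chk_graph\<close> as a parameter.\<close>

lemma Xname_in_M [simp]: "Xname \<in> M"
proof -
  have L: "lv 5 (\<lambda>e. \<exists>z\<in>M. e 1 = pair z (mk {}) \<and> (\<forall>w\<in>M. w \<in> elts z \<longleftrightarrow>
     (\<exists>m\<in>elts (e 2). \<exists>c\<in>M. \<exists>p\<in>elts (e 4). pair m c \<in> elts (e 3) \<and> pair (pair (e 0) m) (num 1) \<in> elts p \<and> w = pair c p)))"
    by (rule lv_rules | simp)+
  have *: "(\<forall>w\<in>M. w \<in> elts z \<longleftrightarrow>
     (\<exists>m\<in>elts omega. \<exists>c\<in>M. \<exists>p\<in>elts PP. pair m c \<in> elts chk_graph \<and> pair (pair (num n) m) (num 1) \<in> elts p \<and> w = pair c p))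
     \<longleftrightarrow> z = xn n" if "z \<in> M" for z n
  proof -
    have "(\<exists>m\<in>elts omega. \<exists>c\<in>M. \<exists>p\<in>elts PP. pair m c \<in> elts chk_graph \<and> pair (pair (num n) m) (num 1) \<in> elts p \<and> w = pair c p)
      \<longleftrightarrow> w \<in> elts (xn n)" for w
      by (auto simp: elts_xn tr_def simp del: num.simps)
    moreover have "(\<forall>w\<in>M. w \<in> elts z \<longleftrightarrow> w \<in> elts (xn n)) \<longleftrightarrow> z = xn n"
    proof
      assume "\<forall>w\<in>M. w \<in> elts z \<longleftrightarrow> w \<in> elts (xn n)"
      then have "elts z = elts (xn n)" using M_trans[OF that] M_trans[OF xn_in_M] by blast
      then show "z = xn n" by (rule hc_ext)
    qed simp
    ultimately show ?thesis by simp
  qed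
  have "mk ((\<lambda>x. pair (xn (the_inv num x)) (mk {})) ` elts omega) \<in> M"
  proof (rule replacement[OF omega_in_M L, where ps = "[omega, chk_graph, PP]"])
    fix x y assume "x \<in> elts omega" "y \<in> M"
    then obtain n where n: "x = num n" by auto
    have "(\<exists>z\<in>M. y = pair z (mk {}) \<and> (\<forall>w\<in>M. w \<in> elts z \<longleftrightarrow>
     (\<exists>m\<in>elts omega. \<exists>c\<in>M. \<exists>p\<in>elts PP. pair m c \<in> elts chk_graph \<and> pair (pair (num n) m) (num 1) \<in> elts p \<and> w = pair c p)))
      \<longleftrightarrow> y = pair (xn n) (mk {})"
      (is "(\<exists>z\<in>M. _ = _ \<and> ?\<phi> z) \<longleftrightarrow> _")
    proof -
      have "(\<exists>z\<in>M. y = pair z (mk {}) \<and> ?\<phi> z) \<longleftrightarrow> (\<exists>z\<in>M. y = pair z (mk {}) \<and> z = xn n)"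
        by (intro bex_cong conj_cong refl *)
      then show ?thesis by auto
    qed
    then show "(\<exists>z\<in>M. env [x, y, omega, chk_graph, PP] 1 = pair z (mk {}) \<and> (\<forall>w\<in>M. w \<in> elts z \<longleftrightarrow>
     (\<exists>m\<in>elts (env [x, y, omega, chk_graph, PP] 2). \<exists>c\<in>M. \<exists>p\<in>elts (env [x, y, omega, chk_graph, PP] 4).
       pair m c \<in> elts (env [x, y, omega, chk_graph, PP] 3) \<and> pair (pair (env [x, y, omega, chk_graph, PP] 0) m) (num 1) \<in> elts p \<and> w = pair c p)))
      \<longleftrightarrow> y = pair (xn (the_inv num x)) (mk {})"
      by (simp add: n the_inv_f_f inj_on_def del: elts_omega elts_PP num.simps)
  qed auto
  then show ?thesis
    by (simp add: Xname_def image_image the_inv_f_f inj_on_def)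
qed

lemma Sname_in_M [simp]: "Sname \<in> M"
  unfolding Sname_def by (simp del: num.simps)

lemma opn_in_M [simp]: "a \<in> M \<Longrightarrow> b \<in> M \<Longrightarrow> opn a b \<in> M"
  by (simp add: opn_def)

lemma omega_name_in_M [simp]: "omega_name \<in> M"
proof -
  obtain D where D: "D \<in> M" "\<And>n. chk n \<in> elts D" using chk_superset by metis
  have "lv 3 (\<lambda>e. \<exists>m\<in>elts (e 1). \<exists>c\<in>M. pair m c \<in> elts (e 2) \<and> e 0 = pair c (mk {}))"
    by (rule lv_rules | simp)+
  from separation[OF cart_in_M[OF D(1) num_in_M[of 1]] this, of "[omega, chk_graph]"]
  have *: "mk {x \<in> elts (cart D (num 1)). \<exists>m\<in>elts omega. \<exists>c\<in>M. pair m c \<in> elts chk_graph \<and> x = pair c (mk {})} \<in> M"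
    by (simp del: elts_omega num.simps)
  have "{x \<in> elts (cart D (num 1)). \<exists>m\<in>elts omega. \<exists>c\<in>M. pair m c \<in> elts chk_graph \<and> x = pair c (mk {})} =
    range (\<lambda>n. pair (chk n) (mk {}))"
    using D(2) by auto
  with * show ?thesis by (simp add: omega_name_def)
qed

text \<open>Singletons are the sets \<open>ins t (mk {})\<close>; the two disjuncts of the formula
  spell out \<open>chk 1\<close> and \<open>chk 0\<close>.\<close>

lemma cname_in_M [simp]: "cname \<in> M"
proof -
  have L: "lv 2 (\<lambda>e. ((\<exists>t\<in>M. e 0 = ins t (mk {})) \<and> e 1 = pair (opn (e 0) (ins (pair (mk {}) (mk {})) (mk {}))) (mk {})) \<or>
     (\<not> (\<exists>t\<in>M. e 0 = ins t (mk {})) \<and> e 1 = pair (opn (e 0) (mk {})) (mk {})))"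
    unfolding opn_def
    by (rule lv_rules | simp)+
  show ?thesis
    unfolding cname_def
  proof (rule replacement[OF Fin_in_M[OF Xname_in_M] L, where ps = "[]"])
    fix x y assume "x \<in> elts (Fin Xname)" "y \<in> M"
    then have x: "x \<in> M" using M_trans by (meson Fin_in_M Xname_in_M)
    have "(\<exists>t\<in>M. x = ins t (mk {})) \<longleftrightarrow> (\<exists>t. elts x = {t})"
      using M_trans[OF x] by (auto intro!: hc_ext)
    then show "(((\<exists>t\<in>M. env [x, y] 0 = ins t (mk {})) \<and> env [x, y] 1 = pair (opn (env [x, y] 0) (ins (pair (mk {}) (mk {})) (mk {}))) (mk {})) \<or>
     (\<not> (\<exists>t\<in>M. env [x, y] 0 = ins t (mk {})) \<and> env [x, y] 1 = pair (opn (env [x, y] 0) (mk {})) (mk {}))) \<longleftrightarrow>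
       y = pair (opn x (chk (of_bool (\<exists>t. elts x = {t})))) (mk {})"
      by (cases "\<exists>t. elts x = {t}") simp_all
  next
    fix x assume "x \<in> elts (Fin Xname)"
    then have x: "x \<in> M" using M_trans by (meson Fin_in_M Xname_in_M)
    then show "pair (opn x (chk (of_bool (\<exists>t. elts x = {t})))) (mk {}) \<in> M" by simp
  qed auto
qed

end

section \<open>Automorphisms\<close>

text \<open>Gives the countability without which \<open>mk\<close> in \<open>cohen_act\<close>,
  \<open>name_act\<close> and \<open>val\<close> would not have the intended members.\<close>

lemma countable_inj_vimage:
  assumes "inj f" shows "countable {x. f x \<in> elts z}"
proof -
  have "f ` {x. f x \<in> elts z} \<subseteq> elts z" by auto
  then have "countable (f ` {x. f x \<in> elts z})" by (rule countable_subset_elts)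
  then show ?thesis
    by (rule countable_image_inj_on) (use assms in \<open>auto intro: inj_on_subset\<close>)
qed

lemma elts_cohen_act:
  "elts (cohen_act \<pi> p) = {pair (pair (num (\<pi> k)) m) i | k m i. pair (pair (num k) m) i \<in> elts p}"
proof -
  have "inj (\<lambda>(k, m, i). pair (pair (num k) m) i)"
    by (auto simp: inj_on_def simp del: num.simps)
  from countable_inj_vimage[OF this, of p]
  have "countable ((\<lambda>(k, m, i). pair (pair (num (\<pi> k)) m) i) ` {(k, m, i). pair (pair (num k) m) i \<in> elts p})"
    by (intro countable_image) (simp add: case_prod_unfold)
  moreover have "(\<lambda>(k, m, i). pair (pair (num (\<pi> k)) m) i) ` {(k, m, i). pair (pair (num k) m) i \<in> elts p} =
    {pair (pair (num (\<pi> k)) m) i | k m i. pair (pair (num k) m) i \<in> elts p}"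
    by (auto simp: image_iff)
  ultimately show ?thesis by (simp add: cohen_act_def)
qed

lemma elts_name_act: "elts (name_act \<alpha> \<tau>) = {pair (name_act \<alpha> \<sigma>) (\<alpha> p) | \<sigma> p. pair \<sigma> p \<in> elts \<tau>}"
proof -
  have "inj (\<lambda>(\<sigma>, p). pair \<sigma> p)" by (auto simp: inj_on_def)
  from countable_inj_vimage[OF this, of \<tau>]
  have "countable ((\<lambda>(\<sigma>, p). pair (name_act \<alpha> \<sigma>) (\<alpha> p)) ` {(\<sigma>, p). pair \<sigma> p \<in> elts \<tau>})"
    by (intro countable_image) (simp add: case_prod_unfold)
  then have "elts (name_act \<alpha> \<tau>) = (\<lambda>(\<sigma>, p). pair (name_act \<alpha> \<sigma>) (\<alpha> p)) ` {(\<sigma>, p). pair \<sigma> p \<in> elts \<tau>}"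
    by (subst name_act.simps) (rule elts_mk)
  then show ?thesis by auto
qed

lemma elts_val: "elts (val G \<tau>) = val G ` {\<sigma>. \<exists>p\<in>G. pair \<sigma> p \<in> elts \<tau>}"
proof -
  have "inj (\<lambda>(\<sigma>, p). pair \<sigma> p)" by (auto simp: inj_on_def)
  from countable_inj_vimage[OF this, of \<tau>]
  have "countable (fst ` {(\<sigma>, p). pair \<sigma> p \<in> elts \<tau>})"
    by (intro countable_image) (simp add: case_prod_unfold)
  then have "countable {\<sigma>. \<exists>p\<in>G. pair \<sigma> p \<in> elts \<tau>}"
    by (rule countable_subset[rotated]) force
  then show ?thesis
    by (subst val.simps) (intro elts_mk countable_image)
qed

text \<open>The first component of a pair in \<tau> lies several membership steps below \<tau>, so
  the induction follows the transitive closure.\<close>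

lemma name_induct [case_names name]:
  assumes "\<And>\<tau>. (\<And>\<sigma> p. pair \<sigma> p \<in> elts \<tau> \<Longrightarrow> Q \<sigma>) \<Longrightarrow> Q \<tau>"
  shows "Q \<tau>"
  by (rule wf_induct[OF wf_trancl[OF wf_elts]]) (use assms pair_fst_trancl in blast)

lemma cohen_act_comp: "cohen_act (\<pi> \<circ> \<rho>) p = cohen_act \<pi> (cohen_act \<rho> p)"
proof (rule hc_ext)
  have "{pair (pair (num (\<pi> k)) m) i | k m i. pair (pair (num k) m) i \<in> elts (cohen_act \<rho> p)} =
    {pair (pair (num (\<pi> (\<rho> k))) m) i | k m i. pair (pair (num k) m) i \<in> elts p}"
    unfolding elts_cohen_act by auto
  then show "elts (cohen_act (\<pi> \<circ> \<rho>) p) = elts (cohen_act \<pi> (cohen_act \<rho> p))"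
    by (simp add: elts_cohen_act[of _ "cohen_act \<rho> p"] elts_cohen_act[of "\<pi> \<circ> \<rho>"])
qed

lemma conj_cong1: "(B \<Longrightarrow> A = A') \<Longrightarrow> (A \<and> B) = (A' \<and> B)"
  by blast

lemma name_act_comp: "name_act (cohen_act (\<pi> \<circ> \<rho>)) \<tau> = name_act (cohen_act \<pi>) (name_act (cohen_act \<rho>) \<tau>)"
proof (induction \<tau> rule: name_induct)
  case (name \<tau>)
  have "elts (name_act (cohen_act (\<pi> \<circ> \<rho>)) \<tau>) =
    {pair (name_act (cohen_act \<pi>) (name_act (cohen_act \<rho>) \<sigma>)) (cohen_act \<pi> (cohen_act \<rho> p)) | \<sigma> p. pair \<sigma> p \<in> elts \<tau>}"
    unfolding elts_name_act[of _ \<tau>]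
  proof (rule Collect_cong)
    fix z
    show "(\<exists>\<sigma> p. z = pair (name_act (cohen_act (\<pi> \<circ> \<rho>)) \<sigma>) (cohen_act (\<pi> \<circ> \<rho>) p) \<and> pair \<sigma> p \<in> elts \<tau>) \<longleftrightarrow>
      (\<exists>\<sigma> p. z = pair (name_act (cohen_act \<pi>) (name_act (cohen_act \<rho>) \<sigma>)) (cohen_act \<pi> (cohen_act \<rho> p)) \<and> pair \<sigma> p \<in> elts \<tau>)"
      by (intro ex_cong1 conj_cong1) (simp add: name cohen_act_comp)
  qed
  also have "\<dots> = elts (name_act (cohen_act \<pi>) (name_act (cohen_act \<rho>) \<tau>))"
    unfolding elts_name_act by auto
  finally show ?case by (rule hc_ext)
qed

lemma tr_mem_cohen_act: "tr l m b \<in> elts (cohen_act \<pi> p) \<longleftrightarrow> (\<exists>k. l = \<pi> k \<and> tr k m b \<in> elts p)"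
  by (auto simp: elts_cohen_act tr_def simp del: num.simps)

lemma tr_mem_cohen_act_bij: "bij \<pi> \<Longrightarrow> tr (\<pi> k) m b \<in> elts (cohen_act \<pi> p) \<longleftrightarrow> tr k m b \<in> elts p"
  by (auto simp: tr_mem_cohen_act bij_def inj_eq)

lemma cohen_act_in_poset:
  assumes "bij \<pi>" "p \<in> cohen_poset" shows "cohen_act \<pi> p \<in> cohen_poset"
proof -
  obtain F n where F: "finite F" "\<forall>t\<in>elts p. \<exists>k\<in>F. \<exists>m<n. \<exists>b. t = tr k m b"
    "\<forall>k\<in>F. \<forall>m<n. tr k m True \<in> elts p \<longleftrightarrow> tr k m False \<notin> elts p"
    using assms unfolding cohen_poset_iff by blast
  have "\<exists>k\<in>\<pi> ` F. \<exists>m<n. \<exists>b. t = tr k m b" if t': "t \<in> elts (cohen_act \<pi> p)" for t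
  proof -
    obtain k m i where t: "t = pair (pair (num (\<pi> k)) m) i" "pair (pair (num k) m) i \<in> elts p"
      using t' by (auto simp: elts_cohen_act)
    then obtain k' m' b where "k' \<in> F" "m' < n" "pair (pair (num k) m) i = tr k' m' b" using F(2) by blast
    with t show ?thesis by (auto simp: tr_def simp del: num.simps)
  qed
  then show ?thesis
    unfolding cohen_poset_iff using F assms(1)
    by (intro exI[of _ "\<pi> ` F"] exI[of _ n]) (auto simp: tr_mem_cohen_act_bij)
qed

lemma cohen_act_id [simp]: assumes "p \<in> cohen_poset" shows "cohen_act id p = p"
proof (rule hc_ext)
  have "t \<in> elts (cohen_act id p)" if "t \<in> elts p" for t
    by (rule cohen_poset_tr[OF assms that]) (use that in \<open>auto simp: elts_cohen_act tr_def simp del: num.simps\<close>)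
  then show "elts (cohen_act id p) = elts p" by (auto simp: elts_cohen_act)
qed

lemma cohen_act_empty [simp]: "cohen_act \<pi> (mk {}) = mk {}"
  by (rule hc_ext) (simp add: elts_cohen_act)

lemma cohen_act_mono: "elts p \<subseteq> elts q \<Longrightarrow> elts (cohen_act \<pi> p) \<subseteq> elts (cohen_act \<pi> q)"
  by (auto simp: elts_cohen_act)

text \<open>Members that are not pairs are erased by \<open>name_act\<close>, and parts of a
  condition that are not entries by \<open>cohen_act\<close>; the identity permutation is sure to
  act trivially only on names of this kind.\<close>

inductive pname :: "hc \<Rightarrow> bool" where
  "(\<And>z. z \<in> elts \<tau> \<Longrightarrow> \<exists>\<sigma> p. z = pair \<sigma> p \<and> p \<in> cohen_poset \<and> pname \<sigma>) \<Longrightarrow> pname \<tau>"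

lemma hered_sym_pname: "hered_sym M \<tau> \<Longrightarrow> pname \<tau>"
proof (induction rule: hered_sym.induct)
  case (1 \<tau>)
  show ?case
  proof (rule pname.intros)
    fix z assume "z \<in> elts \<tau>"
    then show "\<exists>\<sigma> p. z = pair \<sigma> p \<and> p \<in> cohen_poset \<and> pname \<sigma>" using 1 by metis
  qed
qed

lemma pname_pair: "pname \<tau> \<Longrightarrow> pair \<sigma> p \<in> elts \<tau> \<Longrightarrow> p \<in> cohen_poset \<and> pname \<sigma>"
  by (erule pname.cases) force

lemma pname_elt: "pname \<tau> \<Longrightarrow> z \<in> elts \<tau> \<Longrightarrow> \<exists>\<sigma> p. z = pair \<sigma> p"
  by (erule pname.cases) blast

lemma name_act_id: "pname \<tau> \<Longrightarrow> name_act (cohen_act id) \<tau> = \<tau>"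
proof (induction \<tau> rule: name_induct)
  case (name \<tau>)
  have h: "name_act (cohen_act id) \<sigma> = \<sigma>" "cohen_act id p = p" if "pair \<sigma> p \<in> elts \<tau>" for \<sigma> p
    using name.IH[OF that] pname_pair[OF name.prems that] cohen_act_id by blast+
  have "elts (name_act (cohen_act id) \<tau>) = {pair \<sigma> p | \<sigma> p. pair \<sigma> p \<in> elts \<tau>}"
    unfolding elts_name_act[of _ \<tau>]
  proof (rule Collect_cong)
    fix z
    show "(\<exists>\<sigma> p. z = pair (name_act (cohen_act id) \<sigma>) (cohen_act id p) \<and> pair \<sigma> p \<in> elts \<tau>) \<longleftrightarrow>
      (\<exists>\<sigma> p. z = pair \<sigma> p \<and> pair \<sigma> p \<in> elts \<tau>)"
      by (intro ex_cong1 conj_cong1) (simp only: h)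
  qed
  also have "\<dots> = elts \<tau>" using pname_elt[OF name.prems] by blast
  finally show ?case by (rule hc_ext)
qed

definition pull :: "(nat \<Rightarrow> nat) \<Rightarrow> hc set \<Rightarrow> hc set" where
  "pull \<pi> G = {p \<in> cohen_poset. cohen_act \<pi> p \<in> G}"

text \<open>Takes the place of the symmetry lemma for forcing: a pair in \<tau> is active for the
  preimage filter exactly when its permuted copy is active for \<open>G\<close>.\<close>

lemma val_pull: "pname \<tau> \<Longrightarrow> val (pull \<pi> G) \<tau> = val G (name_act (cohen_act \<pi>) \<tau>)"
proof (induction \<tau> rule: name_induct)
  case (name \<tau>)
  have "elts (val (pull \<pi> G) \<tau>) = {val (pull \<pi> G) \<sigma> | \<sigma> p. cohen_act \<pi> p \<in> G \<and> pair \<sigma> p \<in> elts \<tau>}"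
    unfolding elts_val pull_def using pname_pair[OF name.prems] by auto
  also have "\<dots> = {val G (name_act (cohen_act \<pi>) \<sigma>) | \<sigma> p. cohen_act \<pi> p \<in> G \<and> pair \<sigma> p \<in> elts \<tau>}"
  proof (rule Collect_cong)
    fix z
    show "(\<exists>\<sigma> p. z = val (pull \<pi> G) \<sigma> \<and> cohen_act \<pi> p \<in> G \<and> pair \<sigma> p \<in> elts \<tau>) \<longleftrightarrow>
      (\<exists>\<sigma> p. z = val G (name_act (cohen_act \<pi>) \<sigma>) \<and> cohen_act \<pi> p \<in> G \<and> pair \<sigma> p \<in> elts \<tau>)"
      by (intro ex_cong1 conj_cong1) (use name.IH pname_pair[OF name.prems] in auto)
  qed
  also have "\<dots> = elts (val G (name_act (cohen_act \<pi>) \<tau>))"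
    unfolding elts_val elts_name_act by auto
  finally show ?case by (rule hc_ext)
qed

lemma elts_perm_graph: "elts (perm_graph \<pi>) = range (\<lambda>n. pair (num n) (num (\<pi> n)))"
  by (simp add: perm_graph_def)

lemma pair_mem_perm_graph [simp]: "pair (num k) (num l) \<in> elts (perm_graph \<pi>) \<longleftrightarrow> l = \<pi> k"
  by (auto simp: elts_perm_graph simp del: num.simps)

lemma carrier_cohen: "\<pi> \<in> carrier (cohen_group M) \<longleftrightarrow> bij \<pi> \<and> perm_graph \<pi> \<in> M"
  by (simp add: cohen_group_def)

section \<open>The automorphism group, its normal filter and the generic filters\<close>

context ctm
begin

lemma perm_graph_in_M_I:
  assumes "lv k P" "set ps \<subseteq> M" "\<And>k l. P (env (pair (num k) (num l) # ps)) \<longleftrightarrow> l = \<pi> k"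
  shows "perm_graph \<pi> \<in> M"
proof -
  have "mk {x \<in> elts (cart omega omega). P (env (x # ps))} \<in> M"
    by (rule separation[OF _ assms(1,2)]) simp
  moreover have "{x \<in> elts (cart omega omega). P (env (x # ps))} = elts (perm_graph \<pi>)"
    using assms(3) by (auto simp: elts_cart elts_perm_graph simp del: num.simps)
  ultimately show ?thesis by simp
qed

lemma perm_graph_comp:
  assumes "perm_graph \<pi> \<in> M" "perm_graph \<rho> \<in> M" shows "perm_graph (\<pi> \<circ> \<rho>) \<in> M"
proof (rule perm_graph_in_M_I[where ps = "[omega, perm_graph \<pi>, perm_graph \<rho>]"])
  show "lv 4 (\<lambda>e. \<exists>k\<in>elts (e 1). \<exists>l\<in>elts (e 1). \<exists>j\<in>elts (e 1). e 0 = pair k j \<and> pair k l \<in> elts (e 3) \<and> pair l j \<in> elts (e 2))"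
    by (rule lv_rules | simp)+
qed (use assms in \<open>auto simp del: num.simps\<close>)

lemma perm_graph_inv:
  assumes "perm_graph \<pi> \<in> M" "bij \<pi>" shows "perm_graph (inv_into UNIV \<pi>) \<in> M"
proof (rule perm_graph_in_M_I[where ps = "[omega, perm_graph \<pi>]"])
  show "lv 4 (\<lambda>e. \<exists>k\<in>elts (e 1). \<exists>l\<in>elts (e 1). e 0 = pair k l \<and> pair l k \<in> elts (e 2))"
    by (rule lv_rules | simp)+
qed (use assms(1) bij_is_surj[OF assms(2)] bij_is_inj[OF assms(2)] in \<open>auto simp: surj_f_inv_f simp del: num.simps\<close>)

lemma perm_graph_id: "perm_graph id \<in> M"
proof (rule perm_graph_in_M_I[where ps = "[omega]"])
  show "lv 4 (\<lambda>e. \<exists>k\<in>elts (e 1). e 0 = pair k k)"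
    by (rule lv_rules | simp)+
qed (auto simp del: num.simps)

lemma perm_graph_swap: "perm_graph (transpose a b) \<in> M"
proof (rule perm_graph_in_M_I[where ps = "[omega]"])
  show "lv 4 (\<lambda>e. \<exists>k\<in>elts (e 1). \<exists>l\<in>elts (e 1). e 0 = pair k l \<and>
     (k = num a \<longrightarrow> l = num b) \<and> (k = num b \<longrightarrow> l = num a) \<and> (k \<noteq> num a \<and> k \<noteq> num b \<longrightarrow> l = k))"
    by (rule lv_rules | simp)+
qed (auto simp: transpose_def simp del: num.simps)

lemma group_cohen: "group (cohen_group M)"
proof (rule groupI)
  fix x assume x: "x \<in> carrier (cohen_group M)"
  show "\<exists>y\<in>carrier (cohen_group M). y \<otimes>\<^bsub>cohen_group M\<^esub> x = \<one>\<^bsub>cohen_group M\<^esub>"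
    by (rule bexI[of _ "inv_into UNIV x"])
      (use x perm_graph_inv in \<open>auto simp: cohen_group_def bij_imp_bij_inv bij_is_inj\<close>)
qed (auto simp: cohen_group_def perm_graph_comp perm_graph_id bij_comp comp_assoc)

lemma subgroup_fix: "subgroup (fix_group M E) (cohen_group M)"
proof -
  interpret group "cohen_group M" by (rule group_cohen)
  show ?thesis
  proof (rule subgroupI)
    show "fix_group M E \<noteq> {}" using one_closed by (auto simp: fix_group_def cohen_group_def)
    fix a assume a: "a \<in> fix_group M E"
    then have c: "a \<in> carrier (cohen_group M)" by (simp add: fix_group_def)
    let ?b = "inv\<^bsub>cohen_group M\<^esub> a"
    have "?b \<circ> a = id" using l_inv[OF c] by (simp add: cohen_group_def)
    then have "?b n = n" if "a n = n" for n using that by (metis comp_apply id_apply)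
    then show "?b \<in> fix_group M E" using a inv_closed[OF c] by (simp add: fix_group_def)
  next
    fix a b assume "a \<in> fix_group M E" "b \<in> fix_group M E"
    then show "a \<otimes>\<^bsub>cohen_group M\<^esub> b \<in> fix_group M E"
      using m_closed[of a b] by (auto simp: fix_group_def cohen_group_def)
  qed (auto simp: fix_group_def)
qed

text \<open>The subgroups that contain some \<open>fix_group M E\<close> with E finite already form
  a normal filter, because conjugating by g turns the stabilizer of E into that of the image of E.
  Upward closure gives the converse.\<close>

lemma cohen_filter_iff:
  assumes "subgroup H (cohen_group M)"
  shows "H \<in> cohen_filter M \<longleftrightarrow> (\<exists>E. finite E \<and> fix_group M E \<subseteq> H)"
proof
  interpret group "cohen_group M" by (rule group_cohen)
  let ?\<F> = "{H. subgroup H (cohen_group M) \<and> (\<exists>E. finite E \<and> fix_group M E \<subseteq> H)}"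
  have "normal_filter (cohen_group M) ?\<F>"
    unfolding normal_filter_def
  proof (intro conjI ballI allI impI)
    show "carrier (cohen_group M) \<in> ?\<F>"
      using subgroup_self by (auto simp: fix_group_def intro: exI[of _ "{}"])
  next
    fix H K assume "H \<in> ?\<F>" "K \<in> ?\<F>"
    then obtain E1 E2 where E: "finite E1" "finite E2" "fix_group M E1 \<subseteq> H" "fix_group M E2 \<subseteq> K"
      "subgroup H (cohen_group M)" "subgroup K (cohen_group M)" by blast
    then have "fix_group M (E1 \<union> E2) \<subseteq> H \<inter> K" by (auto simp: fix_group_def)
    with E show "H \<inter> K \<in> ?\<F>" using subgroups_Inter_pair by blast
  next
    fix H g assume "H \<in> ?\<F>" and g: "g \<in> carrier (cohen_group M)"
    then obtain E where E: "finite E" "fix_group M E \<subseteq> H" and H: "subgroup H (cohen_group M)" by blast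
    let ?c = "\<lambda>h. g \<otimes>\<^bsub>cohen_group M\<^esub> h \<otimes>\<^bsub>cohen_group M\<^esub> inv\<^bsub>cohen_group M\<^esub> g"
    have "?c \<in> hom (cohen_group M) (cohen_group M)"
      using g by (auto simp: hom_def m_assoc inv_solve_left' simp flip: m_assoc) (simp_all add: m_assoc)
    then interpret group_hom "cohen_group M" "cohen_group M" ?c
      by (simp add: group_hom_def group_hom_axioms_def group_cohen)
    have "subgroup (?c ` H) (cohen_group M)" using H by (rule subgroup_img_is_subgroup)
    moreover have "fix_group M (g ` E) \<subseteq> ?c ` H"
    proof
      fix k assume k: "k \<in> fix_group M (g ` E)"
      then have kc: "k \<in> carrier (cohen_group M)" by (simp add: fix_group_def)
      let ?g' = "inv\<^bsub>cohen_group M\<^esub> g"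
      \<comment> \<open>As k fixes the image of E under g, conjugating it back by g gives an element
        that fixes E and hence lies in H.\<close>
      let ?h = "?g' \<otimes>\<^bsub>cohen_group M\<^esub> k \<otimes>\<^bsub>cohen_group M\<^esub> g"
      have "?g' \<circ> g = id" using l_inv[OF g] by (simp add: cohen_group_def)
      then have g'g: "?g' (g n) = n" for n by (metis comp_apply id_apply)
      have "?h \<in> carrier (cohen_group M)" using g kc by simp
      moreover have "?h n = n" if "n \<in> E" for n
        using k that g'g by (simp add: fix_group_def) (simp add: cohen_group_def)
      ultimately have "?h \<in> H" using E by (auto simp: fix_group_def)
      moreover have "k = ?c ?h"
        using g kc by (simp add: m_assoc) (simp flip: m_assoc)
      ultimately show "k \<in> ?c ` H" by blast
    qed
    ultimately show "?c ` H \<in> ?\<F>" using E(1) by blast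
  qed blast+
  moreover have "{fix_group M E | E. finite E} \<subseteq> ?\<F>" using subgroup_fix by auto
  ultimately show "\<exists>E. finite E \<and> fix_group M E \<subseteq> H" if "H \<in> cohen_filter M"
    using that unfolding cohen_filter_def generated_normal_filter_def by blast
  show "H \<in> cohen_filter M" if "\<exists>E. finite E \<and> fix_group M E \<subseteq> H"
    using that assms unfolding cohen_filter_def generated_normal_filter_def normal_filter_def by blast
qed

lemma subgroup_sym: assumes "pname \<tau>" shows "subgroup (sym_group M \<tau>) (cohen_group M)"
proof -
  interpret group "cohen_group M" by (rule group_cohen)
  show ?thesis
  proof (rule subgroupI)
    show "sym_group M \<tau> \<noteq> {}"
      using one_closed name_act_id[OF assms] by (auto simp: sym_group_def cohen_group_def)
    fix a assume a: "a \<in> sym_group M \<tau>"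
    then have c: "a \<in> carrier (cohen_group M)" by (simp add: sym_group_def)
    let ?b = "inv\<^bsub>cohen_group M\<^esub> a"
    have "?b \<circ> a = id" using l_inv[OF c] by (simp add: cohen_group_def)
    then have "name_act (cohen_act ?b) \<tau> = \<tau>"
      using a name_act_comp[of ?b a \<tau>] name_act_id[OF assms] by (simp add: sym_group_def)
    then show "?b \<in> sym_group M \<tau>" using inv_closed[OF c] by (simp add: sym_group_def)
  next
    fix a b assume "a \<in> sym_group M \<tau>" "b \<in> sym_group M \<tau>"
    then show "a \<otimes>\<^bsub>cohen_group M\<^esub> b \<in> sym_group M \<tau>"
      using m_closed[of a b] name_act_comp[of a b \<tau>] by (auto simp: sym_group_def cohen_group_def)
  qed (auto simp: sym_group_def)
qed

text \<open>Being symmetric amounts to having a finite support \<open>E\<close>; together with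
  \<open>hered_symE\<close> this hides the filter from later arguments.\<close>

lemma hered_symI:
  assumes "\<tau> \<in> M" "finite E"
    and "\<And>z. z \<in> elts \<tau> \<Longrightarrow> \<exists>\<sigma> p. z = pair \<sigma> p \<and> p \<in> cohen_poset \<and> hered_sym M \<sigma>"
    and "\<And>\<pi>. \<pi> \<in> fix_group M E \<Longrightarrow> name_act (cohen_act \<pi>) \<tau> = \<tau>"
  shows "hered_sym M \<tau>"
proof (rule hered_sym.intros[OF assms(1,3)])
  have "pname \<tau>"
    by (rule pname.intros) (use assms(3) hered_sym_pname in blast)
  then show "sym_group M \<tau> \<in> cohen_filter M"
    unfolding cohen_filter_iff[OF subgroup_sym[OF \<open>pname \<tau>\<close>]]
    using assms(2,4) by (auto simp: sym_group_def fix_group_def)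
qed

lemma hered_symE:
  assumes "hered_sym M \<tau>"
  obtains E where "finite E" "\<And>\<pi>. \<pi> \<in> fix_group M E \<Longrightarrow> name_act (cohen_act \<pi>) \<tau> = \<tau>"
proof -
  have "sym_group M \<tau> \<in> cohen_filter M" using assms by (cases rule: hered_sym.cases) auto
  then show ?thesis
    using cohen_filter_iff[OF subgroup_sym[OF hered_sym_pname[OF assms]]] that
    by (auto simp: sym_group_def)
qed

lemma hered_sym_in_M: "hered_sym M \<tau> \<Longrightarrow> \<tau> \<in> M"
  by (erule hered_sym.cases) auto

text \<open>The image under \<pi> of a dense set \<open>D\<close> of \<open>M\<close> is dense, and
  it belongs to \<open>M\<close> because the graph of \<pi> does. \<open>G\<close> meets the image,
  so the preimage filter meets \<open>D\<close>.\<close>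

lemma generic_pull:
  assumes "generic M cohen_poset G" and \<pi>: "\<pi> \<in> carrier (cohen_group M)"
  shows "generic M cohen_poset (pull \<pi> G)"
proof -
  let ?\<rho> = "inv_into UNIV \<pi>"
  have b: "bij \<pi>" "bij ?\<rho>" "perm_graph \<pi> \<in> M" using \<pi> by (auto simp: carrier_cohen bij_imp_bij_inv)
  have inv: "cohen_act \<pi> (cohen_act ?\<rho> p) = p" "cohen_act ?\<rho> (cohen_act \<pi> p) = p" if "p \<in> cohen_poset" for p
    using that b(1) cohen_act_comp[of \<pi> ?\<rho> p] cohen_act_comp[of ?\<rho> \<pi> p]
    by (simp_all add: bij_is_inj bij_is_surj surj_iff[THEN iffD1])
  have f: "G \<subseteq> cohen_poset" "G \<noteq> {}" "\<And>p q. q \<in> G \<Longrightarrow> p \<in> cohen_poset \<Longrightarrow> elts p \<subseteq> elts q \<Longrightarrow> p \<in> G"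
    "\<And>p q. p \<in> G \<Longrightarrow> q \<in> G \<Longrightarrow> \<exists>r\<in>G. elts p \<subseteq> elts r \<and> elts q \<subseteq> elts r"
    using assms(1) unfolding generic_def is_filter_def by blast+
  have "is_filter cohen_poset (pull \<pi> G)"
    unfolding is_filter_def
  proof (intro conjI ballI impI)
    show "pull \<pi> G \<subseteq> cohen_poset" by (auto simp: pull_def)
    have "mk {} \<in> G" using f(2,3) by (metis elts_mk countable_empty empty_subsetI ex_in_conv empty_in_poset)
    then have "mk {} \<in> pull \<pi> G" by (simp add: pull_def)
    then show "pull \<pi> G \<noteq> {}" by blast
    show "p \<in> pull \<pi> G" if "q \<in> pull \<pi> G" "p \<in> cohen_poset" "elts p \<subseteq> elts q" for p q
      using that f(3)[of "cohen_act \<pi> q" "cohen_act \<pi> p"] cohen_act_mono cohen_act_in_poset[OF b(1)]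
      by (simp add: pull_def)
    show "\<exists>r\<in>pull \<pi> G. elts p \<subseteq> elts r \<and> elts q \<subseteq> elts r" if pq: "p \<in> pull \<pi> G" "q \<in> pull \<pi> G" for p q
    proof -
      obtain r where r: "r \<in> G" "elts (cohen_act \<pi> p) \<subseteq> elts r" "elts (cohen_act \<pi> q) \<subseteq> elts r"
        using f(4)[of "cohen_act \<pi> p" "cohen_act \<pi> q"] pq unfolding pull_def by blast
      then have "r \<in> cohen_poset" using f(1) by blast
      then have "cohen_act ?\<rho> r \<in> pull \<pi> G"
        using r inv cohen_act_in_poset[OF b(2)] by (simp add: pull_def)
      moreover have "elts p \<subseteq> elts (cohen_act ?\<rho> r)" "elts q \<subseteq> elts (cohen_act ?\<rho> r)"
        using cohen_act_mono[OF r(2), of ?\<rho>] cohen_act_mono[OF r(3), of ?\<rho>] inv pq by (auto simp: pull_def)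
      ultimately show ?thesis by blast
    qed
  qed
  moreover have "elts D \<inter> pull \<pi> G \<noteq> {}" if D: "D \<in> M" "dense cohen_poset (elts D)" for D
  proof -
    \<comment> \<open>For conditions, \<open>Q q p\<close> says entry by entry that q is the image
      of p, which turns the image of \<open>D\<close> into a definable set.\<close>
    define Q where "Q = (\<lambda>q p. \<forall>k\<in>elts omega. \<forall>l\<in>elts omega. pair k l \<in> elts (perm_graph \<pi>) \<longrightarrow>
       (\<forall>m\<in>elts omega. pair (pair k m) (num 0) \<in> elts p \<longleftrightarrow> pair (pair l m) (num 0) \<in> elts q) \<and>
       (\<forall>m\<in>elts omega. pair (pair k m) (num 1) \<in> elts p \<longleftrightarrow> pair (pair l m) (num 1) \<in> elts q))"
    have Q: "Q q p \<longleftrightarrow> q = cohen_act \<pi> p" if pq: "q \<in> cohen_poset" "p \<in> cohen_poset" for q p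
    proof
      have "Q q p \<longleftrightarrow> (\<forall>k m b. tr k m b \<in> elts p \<longleftrightarrow> tr (\<pi> k) m b \<in> elts q)"
        unfolding Q_def tr_def by (auto simp: all_bool_eq simp del: num.simps)
      also have "\<dots> \<longleftrightarrow> (\<forall>k m b. tr (\<pi> k) m b \<in> elts (cohen_act \<pi> p) \<longleftrightarrow> tr (\<pi> k) m b \<in> elts q)"
        using b by (simp add: tr_mem_cohen_act_bij)
      also have "\<dots> \<longleftrightarrow> (\<forall>k m b. tr k m b \<in> elts (cohen_act \<pi> p) \<longleftrightarrow> tr k m b \<in> elts q)"
        using b by (metis bij_pointE)
      finally have *: "Q q p \<longleftrightarrow> (\<forall>k m b. tr k m b \<in> elts (cohen_act \<pi> p) \<longleftrightarrow> tr k m b \<in> elts q)" .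
      show "q = cohen_act \<pi> p" if "Q q p"
      proof (rule hc_ext, rule Set.set_eqI)
        fix t show "t \<in> elts q \<longleftrightarrow> t \<in> elts (cohen_act \<pi> p)"
          using that * cohen_poset_tr[OF pq(1)] cohen_poset_tr[OF cohen_act_in_poset[OF b(1) pq(2)]] by metis
      qed
      show "Q q p" if "q = cohen_act \<pi> p" using * that by simp
    qed
    have "lv 4 (\<lambda>e. \<exists>p\<in>elts (e 1). \<forall>k\<in>elts (e 2). \<forall>l\<in>elts (e 2). pair k l \<in> elts (e 3) \<longrightarrow>
       (\<forall>m\<in>elts (e 2). pair (pair k m) (num 0) \<in> elts p \<longleftrightarrow> pair (pair l m) (num 0) \<in> elts (e 0)) \<and>
       (\<forall>m\<in>elts (e 2). pair (pair k m) (num 1) \<in> elts p \<longleftrightarrow> pair (pair l m) (num 1) \<in> elts (e 0)))"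
      by (rule lv_rules | simp)+
    from separation[OF PP_in_M this, of "[D, omega, perm_graph \<pi>]"]
    have *: "mk {q \<in> cohen_poset. \<exists>p\<in>elts D. Q q p} \<in> M"
      using D(1) b(3) by (simp add: Q_def del: elts_omega num.simps)
    have e: "elts (mk {q \<in> cohen_poset. \<exists>p\<in>elts D. Q q p}) = {q \<in> cohen_poset. \<exists>p\<in>elts D. Q q p}"
      by (rule elts_mk) (rule countable_subset[OF _ countable_cohen_poset], auto)
    have Dp: "elts D \<subseteq> cohen_poset" using D by (simp add: dense_def)
    have "dense cohen_poset {q \<in> cohen_poset. \<exists>p\<in>elts D. Q q p}"
      unfolding dense_def
    proof (intro conjI ballI)
      fix p assume p: "p \<in> cohen_poset"
      then obtain d where d: "d \<in> elts D" "elts (cohen_act ?\<rho> p) \<subseteq> elts d"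
        using D(2) cohen_act_in_poset[OF b(2)] unfolding dense_def by blast
      then have "elts p \<subseteq> elts (cohen_act \<pi> d)"
        using cohen_act_mono[OF d(2), of \<pi>] inv(1)[OF p] by simp
      moreover have "cohen_act \<pi> d \<in> {q \<in> cohen_poset. \<exists>p\<in>elts D. Q q p}"
        using d Dp Q cohen_act_in_poset[OF b(1)] by blast
      ultimately show "\<exists>q\<in>{q \<in> cohen_poset. \<exists>p\<in>elts D. Q q p}. elts p \<subseteq> elts q" by blast
    qed auto
    then have "dense cohen_poset (elts (mk {q \<in> cohen_poset. \<exists>p\<in>elts D. Q q p}))" by (simp only: e)
    then have "elts (mk {q \<in> cohen_poset. \<exists>p\<in>elts D. Q q p}) \<inter> G \<noteq> {}"
      using assms(1) * unfolding generic_def by blast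
    then obtain q p where q: "q \<in> G" "p \<in> elts D" "Q q p" "q \<in> cohen_poset"
      unfolding e by blast
    then have "q = cohen_act \<pi> p" using Q Dp by blast
    then show ?thesis using q Dp unfolding pull_def by blast
  qed
  ultimately show ?thesis by (simp add: generic_def)
qed

end

section \<open>The truth lemma for membership\<close>

lemma pair_mem_trans:
  assumes "pair a b \<in> elts x" "x \<in> elts A" "\<And>y. y \<in> elts A \<Longrightarrow> elts y \<subseteq> elts A"
  shows "a \<in> elts A"
proof -
  have "pair a b \<in> elts A" using assms by blast
  then have "mk {a} \<in> elts A" using assms(3)[of "pair a b"] by (auto simp: elts_pair)
  then show ?thesis using assms(3)[of "mk {a}"] by simp
qed

context ctm
begin

text \<open>Induction on membership outside \<open>M\<close>: the closures of the elements of x are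
  collected by replacement and joined with x. Minimality is carried along because it makes the
  closure unique, as replacement requires.\<close>

lemma trcl_in_M:
  assumes "x \<in> M"
  shows "\<exists>A\<in>M. elts x \<subseteq> elts A \<and> (\<forall>y\<in>elts A. elts y \<subseteq> elts A) \<and>
    (\<forall>B\<in>M. elts x \<subseteq> elts B \<and> (\<forall>y\<in>elts B. elts y \<subseteq> elts B) \<longrightarrow> elts A \<subseteq> elts B)"
  using assms
proof (induction x rule: elt_induct)
  case (elt x)
  define T where "T = (\<lambda>x A. elts x \<subseteq> elts A \<and> (\<forall>y\<in>elts A. elts y \<subseteq> elts A) \<and>
    (\<forall>B\<in>M. elts x \<subseteq> elts B \<and> (\<forall>y\<in>elts B. elts y \<subseteq> elts B) \<longrightarrow> elts A \<subseteq> elts B))"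
  have "\<exists>A\<in>M. T y A" if "y \<in> elts x" for y
    using elt.IH[OF that] M_trans[OF elt.prems that] unfolding T_def by blast
  then obtain t where t: "\<And>y. y \<in> elts x \<Longrightarrow> t y \<in> M" "\<And>y. y \<in> elts x \<Longrightarrow> T y (t y)" by metis
  have uniq: "A = B" if "T y A" "T y B" "A \<in> M" "B \<in> M" for y A B
    using that unfolding T_def by (intro hc_ext equalityI) blast+
  have "lv 2 (\<lambda>e. T (e 0) (e 1))"
    unfolding T_def by (rule lv_rules | simp)+
  then have "mk (t ` elts x) \<in> M"
    by (rule replacement[OF elt.prems, where ps = "[]"]) (use t uniq in auto)
  then have "mk (\<Union> (elts ` elts (mk (t ` elts x)))) \<in> M" by (rule Union_in_M)
  then have V: "mk (\<Union> (elts ` t ` elts x)) \<in> M" by simp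
  have U: "mk (elts x \<union> elts (mk (\<Union> (elts ` t ` elts x)))) \<in> M"
    by (rule Un_in_M[OF elt.prems V])
  let ?A = "mk (elts x \<union> elts (mk (\<Union> (elts ` t ` elts x))))"
  have A: "elts ?A = elts x \<union> (\<Union>y\<in>elts x. elts (t y))" by simp
  have "T x ?A"
    unfolding T_def A
  proof (intro conjI ballI impI)
    fix y assume "y \<in> elts x \<union> (\<Union>y\<in>elts x. elts (t y))"
    then show "elts y \<subseteq> elts x \<union> (\<Union>y\<in>elts x. elts (t y))"
      using t(2) unfolding T_def by blast
  next
    fix B assume "B \<in> M" "elts x \<subseteq> elts B \<and> (\<forall>y\<in>elts B. elts y \<subseteq> elts B)"
    then have "elts (t y) \<subseteq> elts B" if "y \<in> elts x" for y
      using t(2)[OF that] that unfolding T_def by blast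
    then show "elts x \<union> (\<Union>y\<in>elts x. elts (t y)) \<subseteq> elts B"
      using \<open>elts x \<subseteq> elts B \<and> _\<close> by blast
  qed blast
  with U show ?case unfolding T_def by blast
qed

text \<open>
  \<open>gam\<close> unfolds the forcing relation for \<open>\<sigma> \<subseteq> \<tau>\<close> once. The relation occurs only positively, so on a
  set \<open>A\<close> of names it is the greatest fixed point: the union \<open>frc A\<close> of all consistent sets in the
  power set of the model. No recursion inside the model is needed.
\<close>

definition gam :: "hc \<Rightarrow> hc \<Rightarrow> hc \<Rightarrow> hc \<Rightarrow> hc \<Rightarrow> bool" where
  "gam A W p \<sigma> \<tau> \<longleftrightarrow> (\<forall>\<rho>\<in>elts A. \<forall>s\<in>cohen_poset. pair \<rho> s \<in> elts \<sigma> \<longrightarrow>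
     (\<forall>q\<in>cohen_poset. elts p \<subseteq> elts q \<and> elts s \<subseteq> elts q \<longrightarrow>
       (\<exists>r\<in>cohen_poset. elts q \<subseteq> elts r \<and> (\<exists>\<rho>'\<in>elts A. \<exists>s'\<in>cohen_poset.
          pair \<rho>' s' \<in> elts \<tau> \<and> elts s' \<subseteq> elts r \<and> pair r (pair \<rho> \<rho>') \<in> elts W \<and> pair r (pair \<rho>' \<rho>) \<in> elts W))))"

definition consistent :: "hc \<Rightarrow> hc \<Rightarrow> bool" where
  "consistent A W \<longleftrightarrow> (\<forall>t\<in>elts W. \<exists>p\<in>cohen_poset. \<exists>\<sigma>\<in>elts A. \<exists>\<tau>\<in>elts A. t = pair p (pair \<sigma> \<tau>) \<and> gam A W p \<sigma> \<tau>)"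

definition frc :: "hc \<Rightarrow> hc" where
  "frc A = mk (\<Union> (elts ` {W \<in> elts (Pw (cart PP (cart A A))). consistent A W}))"

lemma gam_mono: "gam A W p \<sigma> \<tau> \<Longrightarrow> elts W \<subseteq> elts W' \<Longrightarrow> gam A W' p \<sigma> \<tau>"
  unfolding gam_def by (meson subsetD)

lemma gam_stronger: "gam A W p \<sigma> \<tau> \<Longrightarrow> elts p \<subseteq> elts p' \<Longrightarrow> gam A W p' \<sigma> \<tau>"
  unfolding gam_def by (meson subset_trans)

text \<open>A union of consistent sets is consistent since \<open>gam\<close> is monotone, so
  \<open>frc A\<close> satisfies one direction of the fixed-point equation; maximality yields the
  other.\<close>

lemma frc:
  assumes A: "A \<in> M"
  shows frc_in_M: "frc A \<in> M"
    and frc_iff: "pair p (pair \<sigma> \<tau>) \<in> elts (frc A) \<longleftrightarrow>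
      p \<in> cohen_poset \<and> \<sigma> \<in> elts A \<and> \<tau> \<in> elts A \<and> gam A (frc A) p \<sigma> \<tau>"
proof -
  let ?T = "cart PP (cart A A)"
  have T: "?T \<in> M" using A by simp
  have "lv 3 (\<lambda>e. \<forall>t\<in>elts (e 0). \<exists>p\<in>elts (e 1). \<exists>\<sigma>\<in>elts (e 2). \<exists>\<tau>\<in>elts (e 2). t = pair p (pair \<sigma> \<tau>) \<and>
    (\<forall>\<rho>\<in>elts (e 2). \<forall>s\<in>elts (e 1). pair \<rho> s \<in> elts \<sigma> \<longrightarrow>
     (\<forall>q\<in>elts (e 1). elts p \<subseteq> elts q \<and> elts s \<subseteq> elts q \<longrightarrow>
       (\<exists>r\<in>elts (e 1). elts q \<subseteq> elts r \<and> (\<exists>\<rho>'\<in>elts (e 2). \<exists>s'\<in>elts (e 1).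
          pair \<rho>' s' \<in> elts \<tau> \<and> elts s' \<subseteq> elts r \<and> pair r (pair \<rho> \<rho>') \<in> elts (e 0) \<and> pair r (pair \<rho>' \<rho>) \<in> elts (e 0))))))"
    by (rule lv_rules | simp)+
  from separation[OF Pw_in_M[OF T] this, of "[PP, A]"]
  have C: "mk {W \<in> elts (Pw ?T). consistent A W} \<in> M"
    using A by (simp add: consistent_def gam_def)
  have eC: "elts (mk {W \<in> elts (Pw ?T). consistent A W}) = {W \<in> elts (Pw ?T). consistent A W}"
    by (rule elts_mk, rule countable_subset_elts[of _ "Pw ?T"]) auto
  show U: "frc A \<in> M"
    using Union_in_M[OF C] unfolding eC frc_def .
  have "countable (\<Union> (elts ` {W \<in> elts (Pw ?T). consistent A W}))"
    by (rule countable_UN) (auto intro: countable_subset_elts[of _ "Pw ?T"])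
  then have eU: "elts (frc A) = \<Union> (elts ` {W \<in> elts (Pw ?T). consistent A W})"
    unfolding frc_def by (rule elts_mk)
  have sub: "elts W \<subseteq> elts (frc A)" if "W \<in> M" "elts W \<subseteq> elts ?T" "consistent A W" for W
    using that unfolding eU elts_Pw[OF T] by blast
  have UT: "elts (frc A) \<subseteq> elts ?T" unfolding eU elts_Pw[OF T] by blast
  have con: "consistent A (frc A)"
    unfolding consistent_def
  proof
    fix t assume "t \<in> elts (frc A)"
    then obtain W where W: "W \<in> elts (Pw ?T)" "consistent A W" "t \<in> elts W" unfolding eU by blast
    then have "elts W \<subseteq> elts (frc A)" unfolding eU by blast
    then show "\<exists>p\<in>cohen_poset. \<exists>\<sigma>\<in>elts A. \<exists>\<tau>\<in>elts A. t = pair p (pair \<sigma> \<tau>) \<and> gam A (frc A) p \<sigma> \<tau>"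
      using W(2,3) gam_mono unfolding consistent_def by blast
  qed
  show "pair p (pair \<sigma> \<tau>) \<in> elts (frc A) \<longleftrightarrow>
      p \<in> cohen_poset \<and> \<sigma> \<in> elts A \<and> \<tau> \<in> elts A \<and> gam A (frc A) p \<sigma> \<tau>"
  proof
    assume "pair p (pair \<sigma> \<tau>) \<in> elts (frc A)"
    then show "p \<in> cohen_poset \<and> \<sigma> \<in> elts A \<and> \<tau> \<in> elts A \<and> gam A (frc A) p \<sigma> \<tau>"
      using con unfolding consistent_def by auto
  next
    assume *: "p \<in> cohen_poset \<and> \<sigma> \<in> elts A \<and> \<tau> \<in> elts A \<and> gam A (frc A) p \<sigma> \<tau>"
    \<comment> \<open>Adjoining one triple that satisfies \<open>gam\<close> keeps the set
      consistent and in \<open>M\<close>, so the triple was there already.\<close>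
    let ?W = "ins (pair p (pair \<sigma> \<tau>)) (frc A)"
    have "?W \<in> M" using * U M_trans[OF A] by simp
    moreover have "elts ?W \<subseteq> elts ?T" using * UT by simp
    moreover have "consistent A ?W"
      unfolding consistent_def
    proof
      fix t assume "t \<in> elts ?W"
      then have "\<exists>p\<in>cohen_poset. \<exists>\<sigma>\<in>elts A. \<exists>\<tau>\<in>elts A. t = pair p (pair \<sigma> \<tau>) \<and> gam A (frc A) p \<sigma> \<tau>"
        using * con unfolding consistent_def by auto
      then show "\<exists>p\<in>cohen_poset. \<exists>\<sigma>\<in>elts A. \<exists>\<tau>\<in>elts A. t = pair p (pair \<sigma> \<tau>) \<and> gam A ?W p \<sigma> \<tau>"
        using gam_mono[of A "frc A" _ _ _ ?W] by (metis elts_ins subset_insertI)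
    qed
    ultimately show "pair p (pair \<sigma> \<tau>) \<in> elts (frc A)" using sub[of ?W] by simp
  qed
qed

lemma generic_subset: "generic M cohen_poset H \<Longrightarrow> p \<in> H \<Longrightarrow> p \<in> cohen_poset"
  unfolding generic_def is_filter_def by blast

lemma generic_up: "generic M cohen_poset H \<Longrightarrow> q \<in> H \<Longrightarrow> p \<in> cohen_poset \<Longrightarrow> elts p \<subseteq> elts q \<Longrightarrow> p \<in> H"
  unfolding generic_def is_filter_def by blast

lemma generic_common:
  "generic M cohen_poset H \<Longrightarrow> p \<in> H \<Longrightarrow> q \<in> H \<Longrightarrow> \<exists>r\<in>H. elts p \<subseteq> elts r \<and> elts q \<subseteq> elts r"
  unfolding generic_def is_filter_def by blast

text \<open>Adding to \<open>D\<close> the conditions that have no extension in \<open>D\<close>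
  makes it dense everywhere; an added condition in \<open>H\<close> would be compatible with
  \<open>q0\<close>, below which \<open>D\<close> is dense.\<close>

lemma generic_dense_below:
  assumes H: "generic M cohen_poset H" and D: "D \<in> M" "elts D \<subseteq> cohen_poset" and "q0 \<in> H"
    and below: "\<And>q. q \<in> cohen_poset \<Longrightarrow> elts q0 \<subseteq> elts q \<Longrightarrow> \<exists>d\<in>elts D. elts q \<subseteq> elts d"
  shows "\<exists>d\<in>H. d \<in> elts D"
proof -
  let ?D = "mk {r \<in> cohen_poset. r \<in> elts D \<or> \<not> (\<exists>d\<in>elts D. elts r \<subseteq> elts d)}"
  have "lv 2 (\<lambda>e. e 0 \<in> elts (e 1) \<or> \<not> (\<exists>d\<in>elts (e 1). elts (e 0) \<subseteq> elts d))"
    by (rule lv_rules | simp)+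
  from separation[OF PP_in_M this, of "[D]"] have DM: "?D \<in> M" using D by simp
  have e: "elts ?D = {r \<in> cohen_poset. r \<in> elts D \<or> \<not> (\<exists>d\<in>elts D. elts r \<subseteq> elts d)}"
    by (rule elts_mk) (rule countable_subset[OF _ countable_cohen_poset], auto)
  have "dense cohen_poset (elts ?D)" using D(2) unfolding dense_def e by blast
  then have "elts ?D \<inter> H \<noteq> {}" using H DM unfolding generic_def by blast
  then obtain r where r: "r \<in> H" "r \<in> elts D \<or> \<not> (\<exists>d\<in>elts D. elts r \<subseteq> elts d)" unfolding e by blast
  obtain q where q: "q \<in> H" "elts r \<subseteq> elts q" "elts q0 \<subseteq> elts q" using generic_common[OF H r(1) \<open>q0 \<in> H\<close>] by blast
  then obtain d where "d \<in> elts D" "elts q \<subseteq> elts d" using below[OF generic_subset[OF H]] by blast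
  with r q show ?thesis by blast
qed

lemma frc_stronger:
  assumes "A \<in> M" "pair p (pair \<sigma> \<tau>) \<in> elts (frc A)" "elts p \<subseteq> elts q" "q \<in> cohen_poset"
  shows "pair q (pair \<sigma> \<tau>) \<in> elts (frc A)"
  using assms gam_stronger unfolding frc_iff[OF assms(1)] by blast

text \<open>One level of the truth lemma; \<open>eq\<close> is the truth lemma for equality of
  members, which \<open>val_eq_iff\<close> supplies by induction.\<close>

lemma val_subset_iff:
  assumes H: "generic M cohen_poset H" and A: "A \<in> M" "\<And>y. y \<in> elts A \<Longrightarrow> elts y \<subseteq> elts A"
    and st: "\<sigma> \<in> elts A" "\<tau> \<in> elts A"
    and eq: "\<And>\<rho> s \<rho>' s'. pair \<rho> s \<in> elts \<sigma> \<Longrightarrow> pair \<rho>' s' \<in> elts \<tau> \<Longrightarrow> val H \<rho> = val H \<rho>' \<longleftrightarrow>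
      (\<exists>r\<in>H. pair r (pair \<rho> \<rho>') \<in> elts (frc A) \<and> pair r (pair \<rho>' \<rho>) \<in> elts (frc A))"
  shows "elts (val H \<sigma>) \<subseteq> elts (val H \<tau>) \<longleftrightarrow> (\<exists>p\<in>H. pair p (pair \<sigma> \<tau>) \<in> elts (frc A))"
proof
  define U where "U = frc A"
  have U: "U \<in> M" using A(1) frc_in_M by (simp add: U_def)
  have AM: "a \<in> M" if "a \<in> elts A" for a using that A(1) M_trans by blast
  define K where "K = (\<lambda>\<rho> r. \<exists>\<rho>'\<in>elts A. \<exists>s'\<in>cohen_poset. pair \<rho>' s' \<in> elts \<tau> \<and> elts s' \<subseteq> elts r \<and>
      pair r (pair \<rho> \<rho>') \<in> elts U \<and> pair r (pair \<rho>' \<rho>) \<in> elts U)"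
  {
    assume "\<exists>p\<in>H. pair p (pair \<sigma> \<tau>) \<in> elts (frc A)"
    then obtain p where p: "p \<in> H" "gam A U p \<sigma> \<tau>" unfolding frc_iff[OF A(1)] U_def by blast
    show "elts (val H \<sigma>) \<subseteq> elts (val H \<tau>)"
    proof
      fix v assume "v \<in> elts (val H \<sigma>)"
      then obtain \<rho> s where \<rho>: "s \<in> H" "pair \<rho> s \<in> elts \<sigma>" "v = val H \<rho>" unfolding elts_val by blast
      have \<rho>A: "\<rho> \<in> elts A" by (rule pair_mem_trans[OF \<rho>(2) st(1) A(2)])
      obtain q0 where q0: "q0 \<in> H" "elts p \<subseteq> elts q0" "elts s \<subseteq> elts q0"
        using generic_common[OF H p(1) \<rho>(1)] by blast
      \<comment> \<open>\<open>K \<rho> r\<close> says that r matches \<rho> with an active member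
        of \<tau>. By \<open>gam\<close> such r are dense below q0, so one of them lies in
        \<open>H\<close>.\<close>
      let ?D = "mk {r \<in> cohen_poset. K \<rho> r}"
      have "lv 6 (\<lambda>e. \<exists>\<rho>'\<in>elts (e 1). \<exists>s'\<in>elts (e 2). pair \<rho>' s' \<in> elts (e 3) \<and> elts s' \<subseteq> elts (e 0) \<and>
        pair (e 0) (pair (e 4) \<rho>') \<in> elts (e 5) \<and> pair (e 0) (pair \<rho>' (e 4)) \<in> elts (e 5))"
        by (rule lv_rules | simp)+
      from separation[OF PP_in_M this, of "[A, PP, \<tau>, \<rho>, U]"]
      have DM: "?D \<in> M" using A(1) st AM \<rho>A U by (simp add: K_def)
      have e: "elts ?D = {r \<in> cohen_poset. K \<rho> r}"
        by (rule elts_mk) (rule countable_subset[OF _ countable_cohen_poset], auto)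
      have "\<exists>d\<in>H. d \<in> elts ?D"
      proof (rule generic_dense_below[OF H DM _ q0(1)])
        fix q assume "q \<in> cohen_poset" "elts q0 \<subseteq> elts q"
        then show "\<exists>d\<in>elts ?D. elts q \<subseteq> elts d"
          using p(2) \<rho>A \<rho>(2) generic_subset[OF H \<rho>(1)] q0(2,3) unfolding e unfolding gam_def K_def by blast
      qed (auto simp: e)
      then obtain r \<rho>' s' where r: "r \<in> H" "s' \<in> cohen_poset" "pair \<rho>' s' \<in> elts \<tau>" "elts s' \<subseteq> elts r"
        "pair r (pair \<rho> \<rho>') \<in> elts U" "pair r (pair \<rho>' \<rho>) \<in> elts U"
        unfolding e unfolding K_def by blast
      then have "val H \<rho> = val H \<rho>'" using eq[OF \<rho>(2) r(3)] unfolding U_def by blast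
      moreover have "s' \<in> H" using generic_up[OF H r(1,2,4)] .
      ultimately show "v \<in> elts (val H \<tau>)" using r(3) \<rho>(3) unfolding elts_val by blast
    qed
  next
    assume sub: "elts (val H \<sigma>) \<subseteq> elts (val H \<tau>)"
    \<comment> \<open>Conditions that refute inclusion: p activates \<rho> in \<sigma>, and no
      extension of p matches it with a member of \<tau>. A condition outside the relation has an
      extension of this kind, which makes \<open>?D\<close> dense.\<close>
    define L where "L = (\<lambda>p. \<exists>\<rho>\<in>elts A. \<exists>s\<in>cohen_poset. pair \<rho> s \<in> elts \<sigma> \<and> elts s \<subseteq> elts p \<and>
      (\<forall>r\<in>cohen_poset. elts p \<subseteq> elts r \<longrightarrow> \<not> K \<rho> r))"
    let ?D = "mk {p \<in> cohen_poset. pair p (pair \<sigma> \<tau>) \<in> elts U \<or> L p}"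
    have "lv 6 (\<lambda>e. pair (e 0) (pair (e 4) (e 3)) \<in> elts (e 5) \<or> (\<exists>\<rho>\<in>elts (e 1). \<exists>s\<in>elts (e 2). pair \<rho> s \<in> elts (e 4) \<and> elts s \<subseteq> elts (e 0) \<and>
      (\<forall>r\<in>elts (e 2). elts (e 0) \<subseteq> elts r \<longrightarrow> \<not> (\<exists>\<rho>'\<in>elts (e 1). \<exists>s'\<in>elts (e 2). pair \<rho>' s' \<in> elts (e 3) \<and> elts s' \<subseteq> elts r \<and>
        pair r (pair \<rho> \<rho>') \<in> elts (e 5) \<and> pair r (pair \<rho>' \<rho>) \<in> elts (e 5)))))"
      by (rule lv_rules | simp)+
    from separation[OF PP_in_M this, of "[A, PP, \<tau>, \<sigma>, U]"]
    have DM: "?D \<in> M" using A(1) st AM U by (simp add: K_def L_def)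
    have e: "elts ?D = {p \<in> cohen_poset. pair p (pair \<sigma> \<tau>) \<in> elts U \<or> L p}"
      by (rule elts_mk) (rule countable_subset[OF _ countable_cohen_poset], auto)
    have "dense cohen_poset (elts ?D)"
      unfolding dense_def
    proof (intro conjI ballI)
      fix p assume p: "p \<in> cohen_poset"
      show "\<exists>d\<in>elts ?D. elts p \<subseteq> elts d"
      proof (cases "pair p (pair \<sigma> \<tau>) \<in> elts U")
        case True
        then show ?thesis using p unfolding e by blast
      next
        case False
        then have "\<not> gam A U p \<sigma> \<tau>" using p st unfolding U_def frc_iff[OF A(1)] by blast
        then obtain \<rho> s q where q: "\<rho> \<in> elts A" "s \<in> cohen_poset" "pair \<rho> s \<in> elts \<sigma>" "q \<in> cohen_poset"
          "elts p \<subseteq> elts q" "elts s \<subseteq> elts q" "\<forall>r\<in>cohen_poset. elts q \<subseteq> elts r \<longrightarrow> \<not> K \<rho> r"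
          unfolding gam_def K_def by blast
        then have "L q" unfolding L_def by blast
        with q show ?thesis unfolding e by blast
      qed
    qed (auto simp: e)
    then have "elts ?D \<inter> H \<noteq> {}" using H DM unfolding generic_def by blast
    then obtain p where p: "p \<in> H" "pair p (pair \<sigma> \<tau>) \<in> elts U \<or> L p" unfolding e by blast
    have "\<not> L p"
    proof
      assume "L p"
      then obtain \<rho> s where \<rho>: "\<rho> \<in> elts A" "s \<in> cohen_poset" "pair \<rho> s \<in> elts \<sigma>" "elts s \<subseteq> elts p"
        "\<And>r. r \<in> cohen_poset \<Longrightarrow> elts p \<subseteq> elts r \<Longrightarrow> \<not> K \<rho> r" unfolding L_def by blast
      have "s \<in> H" using generic_up[OF H p(1) \<rho>(2,4)] .
      then have "val H \<rho> \<in> elts (val H \<sigma>)" using \<rho>(3) unfolding elts_val by blast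
      then have "val H \<rho> \<in> elts (val H \<tau>)" using sub by blast
      then obtain \<rho>' s' where \<rho>': "s' \<in> H" "pair \<rho>' s' \<in> elts \<tau>" "val H \<rho> = val H \<rho>'" unfolding elts_val by blast
      then obtain r0 where r0: "r0 \<in> H" "pair r0 (pair \<rho> \<rho>') \<in> elts U" "pair r0 (pair \<rho>' \<rho>) \<in> elts U"
        using eq[OF \<rho>(3) \<rho>'(2)] unfolding U_def by blast
      obtain r1 where r1: "r1 \<in> H" "elts r0 \<subseteq> elts r1" "elts s' \<subseteq> elts r1"
        using generic_common[OF H r0(1) \<rho>'(1)] by blast
      obtain r where r: "r \<in> H" "elts p \<subseteq> elts r" "elts r1 \<subseteq> elts r"
        using generic_common[OF H p(1) r1(1)] by blast
      have "r \<in> cohen_poset" using generic_subset[OF H r(1)] .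
      moreover have "elts r0 \<subseteq> elts r" using r1 r by blast
      ultimately have "pair r (pair \<rho> \<rho>') \<in> elts U" "pair r (pair \<rho>' \<rho>) \<in> elts U"
        using r0 frc_stronger[OF A(1)] unfolding U_def by blast+
      moreover have "\<rho>' \<in> elts A" by (rule pair_mem_trans[OF \<rho>'(2) st(2) A(2)])
      moreover have "s' \<in> cohen_poset" using generic_subset[OF H \<rho>'(1)] .
      moreover have "elts s' \<subseteq> elts r" using r1 r by blast
      ultimately have "K \<rho> r" using \<rho>'(2) unfolding K_def by blast
      then show False using \<rho>(5)[OF \<open>r \<in> cohen_poset\<close> r(2)] by blast
    qed
    then show "\<exists>p\<in>H. pair p (pair \<sigma> \<tau>) \<in> elts (frc A)" using p unfolding U_def by blast
  }
qed

text \<open>Well-founded induction on names makes the fixed-point equation of \<open>frc\<close>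
  determine its meaning. The conditions for the two inclusions are merged by a common extension in
  \<open>H\<close>.\<close>

lemma val_eq_iff:
  assumes H: "generic M cohen_poset H" and A: "A \<in> M" "\<And>y. y \<in> elts A \<Longrightarrow> elts y \<subseteq> elts A"
    and "\<sigma> \<in> elts A" "\<tau> \<in> elts A"
  shows "val H \<sigma> = val H \<tau> \<longleftrightarrow>
      (\<exists>r\<in>H. pair r (pair \<sigma> \<tau>) \<in> elts (frc A) \<and> pair r (pair \<tau> \<sigma>) \<in> elts (frc A))"
  using assms(4,5)
proof (induction \<sigma> arbitrary: \<tau> rule: name_induct)
  case (name \<sigma>)
  have eq: "val H \<rho> = val H \<rho>' \<longleftrightarrow>
      (\<exists>r\<in>H. pair r (pair \<rho> \<rho>') \<in> elts (frc A) \<and> pair r (pair \<rho>' \<rho>) \<in> elts (frc A))"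
    if "pair \<rho> s \<in> elts \<sigma>" "pair \<rho>' s' \<in> elts \<tau>" for \<rho> s \<rho>' s'
    by (rule name.IH[OF that(1) pair_mem_trans[OF that(1) name.prems(1) A(2)] pair_mem_trans[OF that(2) name.prems(2) A(2)]])
  have "elts (val H \<sigma>) \<subseteq> elts (val H \<tau>) \<longleftrightarrow> (\<exists>p\<in>H. pair p (pair \<sigma> \<tau>) \<in> elts (frc A))"
    by (rule val_subset_iff[OF H A name.prems eq])
  moreover have "elts (val H \<tau>) \<subseteq> elts (val H \<sigma>) \<longleftrightarrow> (\<exists>p\<in>H. pair p (pair \<tau> \<sigma>) \<in> elts (frc A))"
  proof (rule val_subset_iff[OF H A name.prems(2,1)])
    fix \<rho>' s' \<rho> s assume "pair \<rho>' s' \<in> elts \<tau>" "pair \<rho> s \<in> elts \<sigma>"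
    then show "val H \<rho>' = val H \<rho> \<longleftrightarrow>
      (\<exists>r\<in>H. pair r (pair \<rho>' \<rho>) \<in> elts (frc A) \<and> pair r (pair \<rho> \<rho>') \<in> elts (frc A))"
      using eq[of \<rho> s \<rho>' s'] by (auto simp: eq_commute)
  qed
  moreover have "val H \<sigma> = val H \<tau> \<longleftrightarrow> elts (val H \<sigma>) \<subseteq> elts (val H \<tau>) \<and> elts (val H \<tau>) \<subseteq> elts (val H \<sigma>)"
    by (auto intro: hc_ext)
  moreover have "(\<exists>p\<in>H. pair p (pair \<sigma> \<tau>) \<in> elts (frc A)) \<and> (\<exists>p\<in>H. pair p (pair \<tau> \<sigma>) \<in> elts (frc A)) \<longleftrightarrow>
     (\<exists>r\<in>H. pair r (pair \<sigma> \<tau>) \<in> elts (frc A) \<and> pair r (pair \<tau> \<sigma>) \<in> elts (frc A))"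
    (is "?L \<longleftrightarrow> ?R")
  proof
    assume ?L
    then obtain p q where pq: "p \<in> H" "q \<in> H" "pair p (pair \<sigma> \<tau>) \<in> elts (frc A)" "pair q (pair \<tau> \<sigma>) \<in> elts (frc A)"
      by blast
    obtain r where r: "r \<in> H" "elts p \<subseteq> elts r" "elts q \<subseteq> elts r" using generic_common[OF H pq(1,2)] by blast
    then show ?R
      using frc_stronger[OF A(1) pq(3) r(2)] frc_stronger[OF A(1) pq(4) r(3)] generic_subset[OF H r(1)] by blast
  qed blast
  ultimately show ?case by blast
qed

text \<open>The condition p extends s, which activates some \<rho> in \<tau>, and r, which forces
  \<rho> and \<sigma> to be equal. Quantifying over all generic \<open>H\<close> lets the result be
  used for the preimage of \<open>G\<close>.\<close>

theorem truth_mem: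
  assumes G: "generic M cohen_poset G" and "\<sigma> \<in> M" "\<tau> \<in> M" "val G \<sigma> \<in> elts (val G \<tau>)"
  obtains p where "p \<in> G" "\<And>H. generic M cohen_poset H \<Longrightarrow> p \<in> H \<Longrightarrow> val H \<sigma> \<in> elts (val H \<tau>)"
proof -
  have "mk {\<sigma>, \<tau>} \<in> M" using assms by (intro upair_in_M)
  from trcl_in_M[OF this] obtain A where A: "A \<in> M" "\<And>y. y \<in> elts A \<Longrightarrow> elts y \<subseteq> elts A"
    and st: "\<sigma> \<in> elts A" "\<tau> \<in> elts A"
    by auto
  obtain \<rho> s where \<rho>: "s \<in> G" "pair \<rho> s \<in> elts \<tau>" "val G \<rho> = val G \<sigma>"
    using assms(4) unfolding elts_val by auto
  have \<rho>A: "\<rho> \<in> elts A" by (rule pair_mem_trans[OF \<rho>(2) st(2) A(2)])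
  obtain r where r: "r \<in> G" "pair r (pair \<rho> \<sigma>) \<in> elts (frc A)" "pair r (pair \<sigma> \<rho>) \<in> elts (frc A)"
    using \<rho>(3) val_eq_iff[OF G A \<rho>A st(1)] by blast
  obtain p where p: "p \<in> G" "elts r \<subseteq> elts p" "elts s \<subseteq> elts p"
    using generic_common[OF G r(1) \<rho>(1)] by blast
  show ?thesis
  proof (rule that[OF p(1)])
    fix H assume H: "generic M cohen_poset H" "p \<in> H"
    have "r \<in> H" "s \<in> H"
      using generic_up[OF H] generic_subset[OF G] r(1) \<rho>(1) p by blast+
    then have "val H \<rho> = val H \<sigma>" using r val_eq_iff[OF H(1) A \<rho>A st(1)] by blast
    moreover have "val H \<rho> \<in> elts (val H \<tau>)" using \<open>s \<in> H\<close> \<rho>(2) unfolding elts_val by blast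
    ultimately show "val H \<sigma> \<in> elts (val H \<tau>)" by simp
  qed
qed

end

section \<open>Absoluteness for transitive classes\<close>

text \<open>These closure properties make finiteness absolute: an enumeration of a finite set is
  reached from \<open>mk {}\<close> by adjunctions.\<close>

locale transitive_class =
  fixes U :: "hc set"
  assumes U_trans: "x \<in> U \<Longrightarrow> y \<in> elts x \<Longrightarrow> y \<in> U"
    and empty_in_U [simp]: "mk {} \<in> U"
    and ins_in_U [simp]: "a \<in> U \<Longrightarrow> x \<in> U \<Longrightarrow> ins a x \<in> U"
    and omega_in_U [simp]: "omega \<in> U"
begin

lemma finite_in_U: "finite A \<Longrightarrow> A \<subseteq> U \<Longrightarrow> mk A \<in> U"
  by (rule mk_finite_closed) auto

lemma pair_in_U [simp]: "a \<in> U \<Longrightarrow> b \<in> U \<Longrightarrow> pair a b \<in> U"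
  by (simp add: pair_ins)

lemma num_in_U [simp]: "num n \<in> U"
  using U_trans[OF omega_in_U] by simp

lemma is_empty_U: "x \<in> U \<Longrightarrow> is_empty U x \<longleftrightarrow> x = mk {}"
  using U_trans by (auto simp: is_empty_def eq_mk_iff)

lemma is_subset_U: "x \<in> U \<Longrightarrow> is_subset U x y \<longleftrightarrow> elts x \<subseteq> elts y"
  using U_trans by (auto simp: is_subset_def)

lemma is_upair_U: "a \<in> U \<Longrightarrow> b \<in> U \<Longrightarrow> x \<in> U \<Longrightarrow> is_upair U a b x \<longleftrightarrow> x = ins a (ins b (mk {}))"
proof -
  assume U: "a \<in> U" "b \<in> U" "x \<in> U"
  have "is_upair U a b x \<longleftrightarrow> elts x = {a, b}"
    using U_trans[OF U(3)] U(1,2) unfolding is_upair_def by blast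
  also have "\<dots> \<longleftrightarrow> x = ins a (ins b (mk {}))"
    by (metis elts_ins elts_mk countable_empty hc_ext)
  finally show ?thesis .
qed

lemma ins_idem: "ins a (ins a x) = ins a x"
  by (rule hc_ext) simp

lemma is_pair_U: "a \<in> U \<Longrightarrow> b \<in> U \<Longrightarrow> x \<in> U \<Longrightarrow> is_pair U a b x \<longleftrightarrow> x = pair a b"
  by (simp add: is_pair_def is_upair_U pair_ins ins_idem)

lemma is_Union_U: "x \<in> U \<Longrightarrow> u \<in> U \<Longrightarrow> is_Union U x u \<longleftrightarrow> elts u = \<Union> (elts ` elts x)"
proof -
  assume U: "x \<in> U" "u \<in> U"
  have eq: "(\<exists>y\<in>U. y \<in> elts x \<and> z \<in> elts y) \<longleftrightarrow> z \<in> \<Union> (elts ` elts x)" for z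
    using U_trans[OF U(1)] by auto
  have sub: "z \<in> U" if "z \<in> \<Union> (elts ` elts x)" for z
    using that U_trans U_trans[OF U(1)] by auto
  show ?thesis
    unfolding is_Union_def eq
  proof
    assume *: "\<forall>z\<in>U. z \<in> elts u \<longleftrightarrow> z \<in> \<Union> (elts ` elts x)"
    show "elts u = \<Union> (elts ` elts x)"
    proof (rule Set.set_eqI)
      fix z show "z \<in> elts u \<longleftrightarrow> z \<in> \<Union> (elts ` elts x)"
        using * U_trans[OF U(2), of z] sub[of z] by blast
    qed
  qed simp
qed

lemma is_succ_U: "x \<in> U \<Longrightarrow> s \<in> U \<Longrightarrow> is_succ U x s \<longleftrightarrow> s = ins x x"
  using U_trans[of x] U_trans[of s] by (auto simp: is_succ_def intro!: hc_ext)

lemma is_two_U: "t \<in> U \<Longrightarrow> is_two U t \<longleftrightarrow> t = num 2"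
  by (simp add: is_two_def is_empty_U is_succ_U numeral_2_eq_2 num_Suc_ins del: num.simps(2) cong: conj_cong)

lemma is_inductive_U: "x \<in> U \<Longrightarrow> is_inductive U x \<longleftrightarrow> mk {} \<in> elts x \<and> (\<forall>y\<in>elts x. ins y y \<in> elts x)"
  using U_trans[of x] by (auto simp: is_inductive_def is_empty_U is_succ_U)

text \<open>Every inductive set contains the numerals, and \<open>omega\<close>, being in
  \<open>U\<close>, is an inductive set with no other members.\<close>

lemma is_natural_U: "is_natural U n \<longleftrightarrow> n \<in> range num"
proof
  assume "is_natural U n"
  moreover have "is_inductive U omega"
    by (auto simp: is_inductive_U range_eqI[of _ _ 0]) (metis num_Suc_ins rangeI)
  ultimately show "n \<in> range num"
    using omega_in_U unfolding is_natural_def by fastforce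
next
  assume "n \<in> range num"
  moreover have "num k \<in> elts x" if "mk {} \<in> elts x \<and> (\<forall>y\<in>elts x. ins y y \<in> elts x)" for k x
    by (induction k) (use that in \<open>simp_all add: num_Suc_ins del: num.simps(2)\<close>)
  ultimately show "is_natural U n"
    by (auto simp: is_natural_def is_inductive_U simp del: num.simps)
qed

lemma is_app_U: "f \<in> U \<Longrightarrow> a \<in> U \<Longrightarrow> b \<in> U \<Longrightarrow> is_app U f a b \<longleftrightarrow> pair a b \<in> elts f"
  using U_trans[of f] by (auto simp: is_app_def is_pair_U)

lemma is_function_U:
  assumes "f \<in> U" "A \<in> U" "B \<in> U"
  shows "is_function U f A B \<longleftrightarrow> (\<forall>q\<in>elts f. \<exists>a\<in>elts A. \<exists>b\<in>elts B. q = pair a b) \<and>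
    (\<forall>a\<in>elts A. \<exists>!b. b \<in> U \<and> pair a b \<in> elts f)"
proof -
  have "(\<forall>q\<in>U. q \<in> elts f \<longrightarrow> (\<exists>a\<in>U. \<exists>b\<in>U. a \<in> elts A \<and> b \<in> elts B \<and> is_pair U a b q)) \<longleftrightarrow>
    (\<forall>q\<in>elts f. \<exists>a\<in>elts A. \<exists>b\<in>elts B. q = pair a b)"
    using U_trans[OF assms(1)] U_trans[OF assms(2)] U_trans[OF assms(3)] is_pair_U by (smt (verit))
  moreover have "(\<forall>a\<in>U. a \<in> elts A \<longrightarrow> (\<exists>!b. b \<in> U \<and> is_app U f a b)) \<longleftrightarrow>
    (\<forall>a\<in>elts A. \<exists>!b. b \<in> U \<and> pair a b \<in> elts f)"
    using U_trans[OF assms(2)] assms(1) by (auto simp: is_app_U cong: conj_cong)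
  ultimately show ?thesis by (simp add: is_function_def)
qed

lemma is_finite_U: assumes x: "x \<in> U" shows "is_finite U x \<longleftrightarrow> finite (elts x)"
proof
  assume "is_finite U x"
  then obtain n f where f: "f \<in> U" "is_bijection U f (num n) x"
    unfolding is_finite_def is_natural_U by blast
  have "is_function U f (num n) x" using f(2) by (simp add: is_bijection_def)
  then have "(\<forall>q\<in>elts f. \<exists>a\<in>elts (num n). \<exists>b\<in>elts x. q = pair a b) \<and>
    (\<forall>a\<in>elts (num n). \<exists>!b. b \<in> U \<and> pair a b \<in> elts f)"
    unfolding is_function_U[OF f(1) num_in_U x] .
  note fn = conjunct1[OF this] conjunct2[OF this]
  have "\<exists>a. pair a b \<in> elts f" if "b \<in> elts x" for b
  proof -
    have "b \<in> U" by (rule U_trans[OF x that])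
    then have "\<exists>a. a \<in> U \<and> is_app U f a b" using f(2) that unfolding is_bijection_def by blast
    then show ?thesis using is_app_U[OF f(1) _ \<open>b \<in> U\<close>] by blast
  qed
  then obtain g where g: "\<And>b. b \<in> elts x \<Longrightarrow> pair (g b) b \<in> elts f" by metis
  have gn: "g b \<in> elts (num n)" if "b \<in> elts x" for b using fn(1) g[OF that] by auto
  have "inj_on g (elts x)"
  proof (rule inj_onI)
    fix b b' assume b: "b \<in> elts x" "b' \<in> elts x" "g b = g b'"
    have "b \<in> U \<and> pair (g b) b \<in> elts f" "b' \<in> U \<and> pair (g b) b' \<in> elts f"
      using b g[OF b(1)] g[OF b(2)] U_trans[OF x] by auto
    then show "b = b'" using fn(2) gn[OF b(1)] by blast
  qed
  moreover have "finite (g ` elts x)"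
    by (rule finite_subset[of _ "elts (num n)"]) (use gn in \<open>auto simp: elts_num simp del: num.simps\<close>)
  ultimately show "finite (elts x)" by (rule finite_imageD[rotated])
next
  assume "finite (elts x)"
  then obtain h and n :: nat where h: "elts x = h ` {i. i < n}" "inj_on h {i. i < n}"
    using finite_imp_nat_seg_image_inj_on by metis
  let ?f = "mk ((\<lambda>i. pair (num i) (h i)) ` {i. i < n})"
  have e: "elts ?f = (\<lambda>i. pair (num i) (h i)) ` {i. i < n}" by simp
  have hU: "h i \<in> U" if "i < n" for i using that h U_trans[OF x] by auto
  have f: "?f \<in> U"
    by (rule finite_in_U) (use hU in auto)
  have "is_function U ?f (num n) x"
    unfolding is_function_U[OF f num_in_U x] e h elts_num using hU by (auto simp del: num.simps)
  moreover have "\<exists>!a. a \<in> U \<and> is_app U ?f a b" if b: "b \<in> elts x" for b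
  proof -
    obtain i where i: "i < n" "b = h i" using b h by auto
    have "is_app U ?f a b \<longleftrightarrow> a = num i" if "a \<in> U" for a
      using that i h(2) hU f by (subst is_app_U) (auto simp: e inj_on_def simp del: num.simps elts_mk)
    then show ?thesis by (metis num_in_U)
  qed
  ultimately have "is_bijection U ?f (num n) x" unfolding is_bijection_def by blast
  then show "is_finite U x" using f is_natural_U num_in_U unfolding is_finite_def by blast
qed

end


section \<open>The symmetric model\<close>

lemma name_act_ins: "name_act \<alpha> (ins (pair \<tau> p) \<sigma>) = ins (pair (name_act \<alpha> \<tau>) (\<alpha> p)) (name_act \<alpha> \<sigma>)"
  by (rule hc_ext) (auto simp: elts_name_act)

lemma name_act_empty [simp]: "name_act \<alpha> (mk {}) = mk {}"
  by (rule hc_ext) (simp add: elts_name_act)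

lemma name_act_chk: "name_act (cohen_act \<pi>) (chk n) = chk n"
  by (induction n) (simp_all add: name_act_ins)

lemma name_act_opn: "name_act (cohen_act \<pi>) (opn \<sigma> \<tau>) = opn (name_act (cohen_act \<pi>) \<sigma>) (name_act (cohen_act \<pi>) \<tau>)"
  by (simp add: opn_def name_act_ins)

lemma elts_name_act_image:
  assumes "elts \<tau> = (\<lambda>i. pair (f i) (q i)) ` I"
  shows "elts (name_act \<alpha> \<tau>) = (\<lambda>i. pair (name_act \<alpha> (f i)) (\<alpha> (q i))) ` I"
  unfolding elts_name_act assms
proof (intro equalityI subsetI)
  fix z assume "z \<in> (\<lambda>i. pair (name_act \<alpha> (f i)) (\<alpha> (q i))) ` I"
  then obtain i where "i \<in> I" "z = pair (name_act \<alpha> (f i)) (\<alpha> (q i))" by blast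
  then show "z \<in> {pair (name_act \<alpha> \<sigma>) (\<alpha> p) | \<sigma> p. pair \<sigma> p \<in> (\<lambda>i. pair (f i) (q i)) ` I}"
    by (intro CollectI exI[of _ "f i"] exI[of _ "q i"]) simp
qed auto

lemma name_act_xn: assumes "bij \<pi>" shows "name_act (cohen_act \<pi>) (xn n) = xn (\<pi> n)"
proof (rule hc_ext)
  let ?\<rho> = "inv_into UNIV \<pi>"
  have "elts (name_act (cohen_act \<pi>) (xn n)) =
    {pair (chk m) (cohen_act \<pi> p) | m p. p \<in> cohen_poset \<and> tr n m True \<in> elts p}"
    unfolding elts_name_act elts_xn using name_act_chk by auto (metis name_act_chk)+
  also have "\<dots> = {pair (chk m) q | m q. q \<in> cohen_poset \<and> tr (\<pi> n) m True \<in> elts q}"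
  proof (intro equalityI subsetI; elim CollectE exE conjE)
    fix z m p assume "z = pair (chk m) (cohen_act \<pi> p)" "p \<in> cohen_poset" "tr n m True \<in> elts p"
    then show "z \<in> {pair (chk m) q | m q. q \<in> cohen_poset \<and> tr (\<pi> n) m True \<in> elts q}"
      using cohen_act_in_poset[OF assms] tr_mem_cohen_act_bij[OF assms] by blast
  next
    fix z m q assume z: "z = pair (chk m) q" and q: "q \<in> cohen_poset" "tr (\<pi> n) m True \<in> elts q"
    let ?p = "cohen_act ?\<rho> q"
    have p: "?p \<in> cohen_poset" by (rule cohen_act_in_poset[OF bij_imp_bij_inv[OF assms] q(1)])
    have pq: "cohen_act \<pi> ?p = q"
      using q(1) assms cohen_act_comp[of \<pi> ?\<rho> q] by (simp add: bij_is_surj surj_iff[THEN iffD1])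
    then have "tr n m True \<in> elts ?p" using q(2) tr_mem_cohen_act_bij[OF assms] by metis
    then show "z \<in> {pair (chk m) (cohen_act \<pi> p) | m p. p \<in> cohen_poset \<and> tr n m True \<in> elts p}"
      using z p pq by (intro CollectI exI[of _ m] exI[of _ ?p]) simp
  qed
  also have "\<dots> = elts (xn (\<pi> n))" by (simp add: elts_xn)
  finally show "elts (name_act (cohen_act \<pi>) (xn n)) = elts (xn (\<pi> n))" .
qed

lemma xn_inject [simp]: "xn m = xn n \<longleftrightarrow> m = n"
proof
  assume eq: "xn m = xn n"
  \<comment> \<open>If m and n differ, this condition has bit 1 in row 0 of column m and bit 0 in
    row 0 of column n, so it occurs in only one of the two names.\<close>
  obtain q where q0: "q \<in> cohen_poset" "\<And>i j. (i, j) \<in> {(m, 0), (n, 0)} \<Longrightarrow> tr i j (i = m) \<in> elts q"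
    by (rule cohen_extend[OF empty_in_poset, of "{(m, 0), (n, 0)}" "\<lambda>k _. k = m"]) auto
  have q: "q \<in> cohen_poset" "tr m 0 True \<in> elts q" "tr n 0 (n = m) \<in> elts q"
    using q0(1) q0(2)[of m 0] q0(2)[of n 0] by simp_all
  then have "pair (chk 0) q \<in> elts (xn m)" unfolding elts_xn by blast
  then have "pair (chk 0) q \<in> elts (xn n)" using eq by simp
  then have "tr n 0 True \<in> elts q" unfolding elts_xn by (auto simp del: chk.simps)
  then show "m = n" using cohen_poset_fun[OF q(1) q(3)] by blast
qed simp

definition sg :: "nat set \<Rightarrow> hc" where
  "sg F = mk ((\<lambda>n. pair (xn n) (mk {})) ` F)"

lemma elts_sg: "elts (sg F) = (\<lambda>n. pair (xn n) (mk {})) ` F"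
  unfolding sg_def by (intro elts_mk) simp

lemma sg_insert: "sg (insert n F) = ins (pair (xn n) (mk {})) (sg F)"
  by (rule hc_ext) (simp add: elts_sg)

lemma elts_Fin_Xname: "elts (Fin Xname) = sg ` {F. finite F}"
proof (intro equalityI subsetI)
  fix s assume "s \<in> elts (Fin Xname)"
  then obtain F where "finite F" "elts s = (\<lambda>n. pair (xn n) (mk {})) ` F"
    unfolding elts_Fin elts_Xname by (auto dest: finite_subset_image)
  then have "s = sg F" using elts_sg hc_ext by simp
  with \<open>finite F\<close> show "s \<in> sg ` {F. finite F}" by blast
qed (auto simp: elts_sg elts_Xname)

lemma sg_singleton_iff: "(\<exists>t. elts (sg F) = {t}) \<longleftrightarrow> (\<exists>n. F = {n})"
proof -
  have "inj_on (\<lambda>n. pair (xn n) (mk {})) F" by (auto simp: inj_on_def)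
  then have "card (elts (sg F)) = card F" unfolding elts_sg by (rule card_image)
  then show ?thesis by (metis card_1_singleton_iff One_nat_def)
qed

lemma name_act_sg: assumes "bij \<pi>" shows "name_act (cohen_act \<pi>) (sg F) = sg (\<pi> ` F)"
proof (rule hc_ext)
  have "elts (name_act (cohen_act \<pi>) (sg F)) = (\<lambda>n. pair (name_act (cohen_act \<pi>) (xn n)) (cohen_act \<pi> (mk {}))) ` F"
    by (rule elts_name_act_image[OF elts_sg])
  then show "elts (name_act (cohen_act \<pi>) (sg F)) = elts (sg (\<pi> ` F))"
    by (simp add: elts_sg image_image name_act_xn[OF assms])
qed

lemma bij_image_finite_sets: fixes \<pi> :: "'a \<Rightarrow> 'a" assumes "bij \<pi>" shows "(`) \<pi> ` {F. finite F} = {F. finite F}"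
proof (intro equalityI subsetI)
  fix F assume "F \<in> {F. finite (F :: 'a set)}"
  moreover have "\<pi> ` (inv_into UNIV \<pi> ` F) = F" using assms by (simp add: bij_is_surj image_f_inv_f)
  ultimately show "F \<in> (`) \<pi> ` {F. finite F}" by (metis finite_imageI imageI mem_Collect_eq)
qed auto

text \<open>With trivial conditions only, \<pi> merely permutes the indices through
  \<open>g\<close>. This gives empty support to the names of omega, X, its finite subsets and the
  colouring.\<close>

lemma name_act_top:
  assumes "elts \<tau> = (\<lambda>i. pair (f i) (mk {})) ` I" "\<And>i. i \<in> I \<Longrightarrow> name_act (cohen_act \<pi>) (f i) = f (g i)" "g ` I = I"
  shows "name_act (cohen_act \<pi>) \<tau> = \<tau>"
proof (rule hc_ext)
  have "elts (name_act (cohen_act \<pi>) \<tau>) = (\<lambda>i. pair (name_act (cohen_act \<pi>) (f i)) (mk {})) ` I"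
    using elts_name_act_image[OF assms(1), of "cohen_act \<pi>"] by simp
  also have "\<dots> = (\<lambda>i. pair (f (g i)) (mk {})) ` I"
    by (rule image_cong) (simp_all add: assms(2))
  also have "\<dots> = (\<lambda>i. pair (f i) (mk {})) ` (g ` I)" by (simp add: image_image)
  finally show "elts (name_act (cohen_act \<pi>) \<tau>) = elts \<tau>" using assms by simp
qed

lemma elts_Sname: "elts Sname = (\<lambda>F. pair (sg F) (mk {})) ` {F. finite F}"
  unfolding Sname_def elts_cart elts_Fin_Xname by auto

lemma elts_cname: "elts cname = (\<lambda>F. pair (opn (sg F) (chk (of_bool (\<exists>n. F = {n})))) (mk {})) ` {F. finite F}"
proof -
  have "elts cname = (\<lambda>s. pair (opn s (chk (of_bool (\<exists>t. elts s = {t})))) (mk {})) ` elts (Fin Xname)"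
    unfolding cname_def by (intro elts_mk countable_image countable_elts)
  then show ?thesis unfolding elts_Fin_Xname image_image sg_singleton_iff .
qed

lemma elts_omega_name: "elts omega_name = range (\<lambda>n. pair (chk n) (mk {}))"
  by (simp add: omega_name_def)

section \<open>Hereditarily symmetric names\<close>

context ctm
begin

lemma hered_sym_pair: "hered_sym M \<tau> \<Longrightarrow> pair \<sigma> p \<in> elts \<tau> \<Longrightarrow> hered_sym M \<sigma>"
  by (erule hered_sym.cases) (metis pair_inject)

lemma hs_empty [simp]: "hered_sym M (mk {})"
  by (rule hered_symI[where E = "{}"]) auto

lemma hs_ins: assumes "hered_sym M \<sigma>" "hered_sym M \<tau>" shows "hered_sym M (ins (pair \<tau> (mk {})) \<sigma>)"
proof -
  obtain E1 where E1: "finite E1" "\<And>\<pi>. \<pi> \<in> fix_group M E1 \<Longrightarrow> name_act (cohen_act \<pi>) \<sigma> = \<sigma>"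
    using hered_symE[OF assms(1)] by metis
  obtain E2 where E2: "finite E2" "\<And>\<pi>. \<pi> \<in> fix_group M E2 \<Longrightarrow> name_act (cohen_act \<pi>) \<tau> = \<tau>"
    using hered_symE[OF assms(2)] by metis
  show ?thesis
  proof (rule hered_symI[where E = "E1 \<union> E2"])
    show "ins (pair \<tau> (mk {})) \<sigma> \<in> M" using assms by (simp add: hered_sym_in_M)
    fix z assume "z \<in> elts (ins (pair \<tau> (mk {})) \<sigma>)"
    moreover have "\<exists>\<sigma>' p. z = pair \<sigma>' p \<and> p \<in> cohen_poset \<and> hered_sym M \<sigma>'" if "z \<in> elts \<sigma>"
      using assms(1) that by (cases rule: hered_sym.cases) blast
    ultimately show "\<exists>\<sigma>' p. z = pair \<sigma>' p \<and> p \<in> cohen_poset \<and> hered_sym M \<sigma>'"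
      using assms(2) by (auto intro: exI[of _ "mk {}"])
  next
    fix \<pi> assume "\<pi> \<in> fix_group M (E1 \<union> E2)"
    then have "\<pi> \<in> fix_group M E1" "\<pi> \<in> fix_group M E2" by (auto simp: fix_group_def)
    then show "name_act (cohen_act \<pi>) (ins (pair \<tau> (mk {})) \<sigma>) = ins (pair \<tau> (mk {})) \<sigma>"
      using E1 E2 by (simp add: name_act_ins)
  qed (use E1 E2 in simp)
qed

lemma hs_chk [simp]: "hered_sym M (chk n)"
  by (induction n) (simp_all add: hs_ins)

lemma hs_opn: "hered_sym M \<sigma> \<Longrightarrow> hered_sym M \<tau> \<Longrightarrow> hered_sym M (opn \<sigma> \<tau>)"
  by (simp add: opn_def hs_ins)

lemma fix_group_bij: "\<pi> \<in> fix_group M E \<Longrightarrow> bij \<pi>"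
  by (simp add: fix_group_def carrier_cohen)

lemma hs_xn [simp]: "hered_sym M (xn n)"
proof (rule hered_symI[where E = "{n}"])
  fix \<pi> assume "\<pi> \<in> fix_group M {n}"
  then show "name_act (cohen_act \<pi>) (xn n) = xn n"
    using name_act_xn[OF fix_group_bij, of \<pi> "{n}" n] by (simp add: fix_group_def)
qed (auto simp: elts_xn)

lemma hs_sg [simp]: "finite F \<Longrightarrow> hered_sym M (sg F)"
  by (induction F rule: finite_induct) (simp_all add: sg_insert hs_ins, simp add: sg_def)

lemma hs_top:
  assumes "\<tau> \<in> M" "elts \<tau> = (\<lambda>i. pair (f i) (mk {})) ` I" "\<And>i. i \<in> I \<Longrightarrow> hered_sym M (f i)"
    and "\<And>\<pi>. bij \<pi> \<Longrightarrow> \<exists>g. (\<forall>i\<in>I. name_act (cohen_act \<pi>) (f i) = f (g i)) \<and> g ` I = I"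
  shows "hered_sym M \<tau>"
proof (rule hered_symI[where E = "{}"])
  fix \<pi> assume "\<pi> \<in> fix_group M {}"
  from assms(4)[OF fix_group_bij[OF this]] obtain g
    where "\<And>i. i \<in> I \<Longrightarrow> name_act (cohen_act \<pi>) (f i) = f (g i)" "g ` I = I" by blast
  then show "name_act (cohen_act \<pi>) \<tau> = \<tau>" by (rule name_act_top[OF assms(2)])
next
  fix z assume "z \<in> elts \<tau>"
  then show "\<exists>\<sigma> p. z = pair \<sigma> p \<and> p \<in> cohen_poset \<and> hered_sym M \<sigma>"
    unfolding assms(2) using assms(3) empty_in_poset by blast
qed (use assms in auto)

lemma hs_omega_name: "hered_sym M omega_name"
  by (rule hs_top[OF _ elts_omega_name]) (auto simp: name_act_chk intro: exI[of _ id])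

lemma hs_Xname: "hered_sym M Xname"
proof (rule hs_top[OF _ elts_Xname])
  fix \<pi> :: "nat \<Rightarrow> nat" assume "bij \<pi>"
  then show "\<exists>g. (\<forall>i\<in>UNIV. name_act (cohen_act \<pi>) (xn i) = xn (g i)) \<and> g ` UNIV = UNIV"
    by (intro exI[of _ \<pi>]) (auto simp: name_act_xn bij_is_surj)
qed auto

lemma hs_Sname: "hered_sym M Sname"
proof (rule hs_top[OF _ elts_Sname])
  fix \<pi> :: "nat \<Rightarrow> nat" assume "bij \<pi>"
  then show "\<exists>g. (\<forall>F\<in>{F. finite F}. name_act (cohen_act \<pi>) (sg F) = sg (g F)) \<and> g ` {F. finite F} = {F. finite F}"
    by (intro exI[of _ "(`) \<pi>"]) (simp add: name_act_sg bij_image_finite_sets)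
qed auto

lemma hs_cname: "hered_sym M cname"
proof (rule hs_top[OF _ elts_cname])
  fix \<pi> :: "nat \<Rightarrow> nat" assume \<pi>: "bij \<pi>"
  \<comment> \<open>A permutation preserves the size of F and hence its colour, so the name of the
    colouring is fixed.\<close>
  have "(\<exists>n. \<pi> ` F = {n}) \<longleftrightarrow> (\<exists>n. F = {n})" for F
    using \<pi> by (metis bij_def card_1_singleton_iff card_image inj_on_subset subset_UNIV One_nat_def)
  then show "\<exists>g. (\<forall>F\<in>{F. finite F}. name_act (cohen_act \<pi>) (opn (sg F) (chk (of_bool (\<exists>n. F = {n})))) =
    opn (sg (g F)) (chk (of_bool (\<exists>n. g F = {n})))) \<and> g ` {F. finite F} = {F. finite F}"
    using \<pi> by (intro exI[of _ "(`) \<pi>"])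
      (simp add: name_act_opn name_act_sg name_act_chk bij_image_finite_sets del: chk.simps)
qed (auto simp: hs_opn simp del: chk.simps)

end

section \<open>The symmetric model and its Cohen reals\<close>

locale cohen_generic = ctm +
  fixes G :: "hc set"
  assumes generic: "generic M cohen_poset G"
begin

definition N :: "hc set" where
  "N = basic_cohen_model M G"

lemma val_in_N: "hered_sym M \<tau> \<Longrightarrow> val G \<tau> \<in> N"
  unfolding N_def basic_cohen_model_def by blast

lemma N_E: assumes "x \<in> N" obtains \<tau> where "hered_sym M \<tau>" "x = val G \<tau>"
  using assms unfolding N_def basic_cohen_model_def by blast

lemma top_in_G [simp]: "mk {} \<in> G"
proof -
  obtain p where "p \<in> G" using generic unfolding generic_def is_filter_def by blast
  then show ?thesis using generic_up[OF generic, of p "mk {}"] by simp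
qed

lemma val_empty [simp]: "val G (mk {}) = mk {}"
  by (rule hc_ext) (simp add: elts_val)

lemma val_ins: "val G (ins (pair \<tau> (mk {})) \<sigma>) = ins (val G \<tau>) (val G \<sigma>)"
proof (rule hc_ext)
  have "{\<sigma>'. \<exists>p\<in>G. pair \<sigma>' p \<in> elts (ins (pair \<tau> (mk {})) \<sigma>)} = insert \<tau> {\<sigma>'. \<exists>p\<in>G. pair \<sigma>' p \<in> elts \<sigma>}"
    by auto
  then show "elts (val G (ins (pair \<tau> (mk {})) \<sigma>)) = elts (ins (val G \<tau>) (val G \<sigma>))"
    by (simp add: elts_val)
qed

lemma val_chk [simp]: "val G (chk n) = num n"
  by (induction n) (simp_all only: chk.simps val_ins num_Suc_ins, simp)

lemma val_opn [simp]: "val G (opn \<sigma> \<tau>) = pair (val G \<sigma>) (val G \<tau>)"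
  by (simp only: opn_def val_ins val_empty) (simp only: pair_ins)

lemma elts_val_top: "elts \<tau> = (\<lambda>i. pair (f i) (mk {})) ` I \<Longrightarrow> elts (val G \<tau>) = (\<lambda>i. val G (f i)) ` I"
  unfolding elts_val by (auto intro!: image_eqI bexI[of _ "mk {}"])

sublocale transitive_class N
proof
  fix x y assume "x \<in> N" and y: "y \<in> elts x"
  then obtain \<tau> where \<tau>: "hered_sym M \<tau>" "x = val G \<tau>" using N_E by metis
  then obtain \<sigma> p where s: "pair \<sigma> p \<in> elts \<tau>" "y = val G \<sigma>" using y unfolding \<tau>(2) elts_val by blast
  then have "hered_sym M \<sigma>" using hered_sym_pair[OF \<tau>(1)] by blast
  then show "y \<in> N" using s val_in_N by simp
next
  show "mk {} \<in> N" using val_in_N[OF hs_empty] by simp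
next
  fix a x assume "a \<in> N" "x \<in> N"
  then show "ins a x \<in> N" using val_in_N[OF hs_ins] by (metis N_E val_ins)
next
  have "elts (val G omega_name) = elts omega" using elts_val_top[OF elts_omega_name] by simp
  then show "omega \<in> N" using val_in_N[OF hs_omega_name] hc_ext by metis
qed

definition creal :: "nat \<Rightarrow> hc" where
  "creal n = val G (xn n)"

lemma mem_creal_iff: "num m \<in> elts (creal n) \<longleftrightarrow> (\<exists>p\<in>G. tr n m True \<in> elts p)"
proof -
  have "elts (creal n) = {num m | m. \<exists>p\<in>G. tr n m True \<in> elts p}"
  proof (intro equalityI subsetI)
    fix z assume "z \<in> {num m | m. \<exists>p\<in>G. tr n m True \<in> elts p}"
    then obtain m p where m: "z = num m" "p \<in> G" "tr n m True \<in> elts p" by blast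
    then have "pair (chk m) p \<in> elts (xn n)" using generic_subset[OF generic] unfolding elts_xn by blast
    then have "val G (chk m) \<in> elts (creal n)" using m(2) unfolding creal_def elts_val by blast
    then show "z \<in> elts (creal n)" by (simp only: m(1) val_chk)
  qed (auto simp: creal_def elts_val elts_xn)
  then show ?thesis by (auto simp del: num.simps)
qed

text \<open>Genericity for a dense set given by a predicate: separation from \<open>PP\<close> turns
  it into an element of \<open>M\<close>.\<close>

lemma generic_meets:
  assumes "lv k P" "set ps \<subseteq> M" "\<And>p. p \<in> cohen_poset \<Longrightarrow> \<exists>q\<in>cohen_poset. elts p \<subseteq> elts q \<and> P (env (q # ps))"
  shows "\<exists>q\<in>G. P (env (q # ps))"
proof -
  let ?D = "mk {q \<in> cohen_poset. P (env (q # ps))}"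
  have D: "?D \<in> M" using separation[OF PP_in_M assms(1,2)] by simp
  have e: "elts ?D = {q \<in> cohen_poset. P (env (q # ps))}"
    by (rule elts_mk) (rule countable_subset[OF _ countable_cohen_poset], auto)
  have "dense cohen_poset (elts ?D)" unfolding dense_def e using assms(3) by auto
  then have "elts ?D \<inter> G \<noteq> {}" using generic D unfolding generic_def by blast
  then show ?thesis unfolding e by blast
qed

lemma creal_inject [simp]: "creal k = creal l \<longleftrightarrow> k = l"
proof (rule ccontr)
  assume "\<not> (creal k = creal l \<longleftrightarrow> k = l)"
  then have kl: "creal k = creal l" "k \<noteq> l" by auto
  have "\<exists>q\<in>G. \<exists>m\<in>elts (env [q, omega] 1). pair (pair (num k) m) (num 1) \<in> elts (env [q, omega] 0) \<and>
     pair (pair (num l) m) (num 0) \<in> elts (env [q, omega] 0)"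
  proof (rule generic_meets)
    show "lv 2 (\<lambda>e. \<exists>m\<in>elts (e 1). pair (pair (num k) m) (num 1) \<in> elts (e 0) \<and> pair (pair (num l) m) (num 0) \<in> elts (e 0))"
      by (rule lv_rules | simp)+
    fix p assume p: "p \<in> cohen_poset"
    obtain F n f where F: "p = cohen_condition F n f" using p by (auto simp: cohen_poset_def)
    \<comment> \<open>Row n is the first one outside the rectangle of p, so the bits of both columns
      there are still free.\<close>
    obtain q where q0: "q \<in> cohen_poset" "elts p \<subseteq> elts q"
      "\<And>i j. (i, j) \<in> {(k, n), (l, n)} \<Longrightarrow> tr i j (i = k) \<in> elts q"
      by (rule cohen_extend[OF p, of "{(k, n), (l, n)}" "\<lambda>i _. i = k"])
        (auto simp: F tr_mem_cohen_condition)
    have q: "q \<in> cohen_poset" "elts p \<subseteq> elts q" "tr k n True \<in> elts q" "tr l n False \<in> elts q"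
      using q0(1,2) q0(3)[of k n] q0(3)[of l n] kl(2) by simp_all
    then show "\<exists>q\<in>cohen_poset. elts p \<subseteq> elts q \<and> (\<exists>m\<in>elts (env [q, omega] 1).
      pair (pair (num k) m) (num 1) \<in> elts (env [q, omega] 0) \<and> pair (pair (num l) m) (num 0) \<in> elts (env [q, omega] 0))"
      by (auto simp: tr_def simp del: num.simps intro!: bexI[of _ q])
  qed simp
  then obtain q m where q: "q \<in> G" "tr k m True \<in> elts q" "tr l m False \<in> elts q"
    by (auto simp: tr_def simp del: num.simps)
  then have "num m \<in> elts (creal l)" using kl(1) mem_creal_iff by metis
  then obtain p where p: "p \<in> G" "tr l m True \<in> elts p" unfolding mem_creal_iff by blast
  obtain r where "r \<in> G" "elts q \<subseteq> elts r" "elts p \<subseteq> elts r" using generic_common[OF generic q(1) p(1)] by blast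
  then show False using cohen_poset_fun[of r l m True False] generic_subset[OF generic] p q by blast
qed

definition creals :: "nat set \<Rightarrow> hc" where
  "creals F = val G (sg F)"

lemma elts_creals [simp]: "elts (creals F) = creal ` F"
  using elts_val_top[OF elts_sg] by (simp add: creals_def creal_def)

lemma creals_inject [simp]: "creals F = creals F' \<longleftrightarrow> F = F'"
proof -
  have "inj creal" by (simp add: inj_on_def)
  then show ?thesis by (metis elts_creals inj_image_eq_iff)
qed

lemma creals_in_N: "finite F \<Longrightarrow> creals F \<in> N"
  unfolding creals_def by (intro val_in_N hs_sg)

text \<open>
  A condition that puts \<open>creals F\<close> into a set with support \<open>E\<close> mentions finitely many columns; by genericity
  some fresh column repeats the column of \<open>k\<close>, and the transposition of the two preserves the condition.
\<close>

lemma moved_member: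
  assumes \<tau>: "hered_sym M \<tau>" and E: "finite E" "\<And>\<pi>. \<pi> \<in> fix_group M E \<Longrightarrow> name_act (cohen_act \<pi>) \<tau> = \<tau>"
    and F: "finite F" "creals F \<in> elts (val G \<tau>)" and k: "k \<in> F" "k \<notin> E"
  shows "\<exists>l. l \<notin> F \<and> creals (transpose k l ` F) \<in> elts (val G \<tau>)"
proof -
  have sgM: "sg F \<in> M" using F(1) hered_sym_in_M[OF hs_sg] by blast
  obtain p where p: "p \<in> G" "\<And>H. generic M cohen_poset H \<Longrightarrow> p \<in> H \<Longrightarrow> val H (sg F) \<in> elts (val H \<tau>)"
    using truth_mem[OF generic sgM hered_sym_in_M[OF \<tau>]] F(2) unfolding creals_def by metis
  have pP: "p \<in> cohen_poset" by (rule generic_subset[OF generic p(1)])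
  then obtain Fp n f where Fp: "finite Fp" "p = cohen_condition Fp n f" by (auto simp: cohen_poset_def)
  \<comment> \<open>The fresh column l must avoid E so that the transposition fixes E, F so that the
    image of F is a different set, and Fp so that p says nothing about l.\<close>
  let ?B = "E \<union> F \<union> Fp"
  let ?b = "mk (num ` ?B)"
  have fB: "finite ?B" using E F Fp by simp
  have eb: "elts ?b = num ` ?B" using fB by (intro elts_mk countable_finite) simp
  have bM: "?b \<in> M" using fB by (intro finite_in_M) auto
  have "\<exists>q\<in>G. \<exists>l\<in>elts (env [q, omega, ?b, p] 1). l \<notin> elts (env [q, omega, ?b, p] 2) \<and>
     (\<forall>m\<in>elts (env [q, omega, ?b, p] 1). \<forall>i\<in>elts (num 2). pair (pair (num k) m) i \<in> elts (env [q, omega, ?b, p] 3) \<longrightarrow>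
       pair (pair l m) i \<in> elts (env [q, omega, ?b, p] 0))"
  proof (rule generic_meets)
    show "lv 4 (\<lambda>e. \<exists>l\<in>elts (e 1). l \<notin> elts (e 2) \<and>
     (\<forall>m\<in>elts (e 1). \<forall>i\<in>elts (num 2). pair (pair (num k) m) i \<in> elts (e 3) \<longrightarrow> pair (pair l m) i \<in> elts (e 0)))"
      by (rule lv_rules | simp)+
    fix q0 assume q0: "q0 \<in> cohen_poset"
    obtain F0 n0 f0 where F0: "finite F0" "q0 = cohen_condition F0 n0 f0" using q0 by (auto simp: cohen_poset_def)
    have "finite (?B \<union> F0)" using fB F0(1) by simp
    \<comment> \<open>Avoiding also the columns of q0 leaves column l free to copy what p says about
      column k.\<close>
    from ex_new_if_finite[OF infinite_UNIV_nat this] obtain l where l: "l \<notin> ?B \<union> F0" ..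
    obtain q where q: "q \<in> cohen_poset" "elts q0 \<subseteq> elts q" "\<And>m. m < n \<Longrightarrow> tr l m (f k m) \<in> elts q"
    proof (rule cohen_extend[OF q0, of "{l} \<times> {..<n}" "\<lambda>_ m. f k m"])
      show "tr i m (\<not> f k m) \<notin> elts q0" if "(i, m) \<in> {l} \<times> {..<n}" for i m
        using that l by (auto simp: F0 tr_mem_cohen_condition)
    qed auto
    have "num l \<in> elts omega" "num l \<notin> elts ?b" using l unfolding eb by auto
    moreover have "pair (pair (num l) (num m)) (num (of_bool b)) \<in> elts q" if "pair (pair (num k) (num m)) (num (of_bool b)) \<in> elts p" for m b
      using that q(3) unfolding Fp tr_def[symmetric] by (auto simp: tr_mem_cohen_condition)
    then have "\<forall>m\<in>elts omega. \<forall>i\<in>elts (num 2). pair (pair (num k) m) i \<in> elts p \<longrightarrow> pair (pair (num l) m) i \<in> elts q"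
      unfolding elts_num_2 by (auto simp del: num.simps) (metis of_bool_eq(1), metis of_bool_eq(2) One_nat_def)
    ultimately have "\<exists>l\<in>elts omega. l \<notin> elts ?b \<and> (\<forall>m\<in>elts omega. \<forall>i\<in>elts (num 2). pair (pair (num k) m) i \<in> elts p \<longrightarrow> pair (pair l m) i \<in> elts q)"
      by blast
    with q(1,2) show "\<exists>q\<in>cohen_poset. elts q0 \<subseteq> elts q \<and> (\<exists>l\<in>elts (env [q, omega, ?b, p] 1). l \<notin> elts (env [q, omega, ?b, p] 2) \<and>
     (\<forall>m\<in>elts (env [q, omega, ?b, p] 1). \<forall>i\<in>elts (num 2). pair (pair (num k) m) i \<in> elts (env [q, omega, ?b, p] 3) \<longrightarrow>
       pair (pair l m) i \<in> elts (env [q, omega, ?b, p] 0)))"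
      by (intro bexI[of _ q]) (simp_all del: num.simps elts_omega elts_mk)
  qed (use bM pP in simp)
  then obtain q l where q: "q \<in> G" "num l \<notin> elts ?b" and
    ql: "\<forall>m\<in>elts omega. \<forall>i\<in>elts (num 2). pair (pair (num k) m) i \<in> elts p \<longrightarrow> pair (pair (num l) m) i \<in> elts q"
    by (auto simp del: num.simps elts_mk)
  have l: "l \<notin> ?B" using q(2) unfolding eb by (auto simp del: num.simps)
  have kl: "tr l m b \<in> elts q" if "tr k m b \<in> elts p" for m b
  proof -
    have "num (of_bool b) \<in> elts (num 2)" unfolding elts_num_2 by (cases b) auto
    then show ?thesis using ql that unfolding tr_def elts_omega by blast
  qed
  let ?\<pi> = "transpose k l"
  obtain r where r: "r \<in> G" "elts p \<subseteq> elts r" "elts q \<subseteq> elts r"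
    using generic_common[OF generic p(1) q(1)] by blast
  \<comment> \<open>The transposition moves the entries of p in column k to column l, where q has
    them; p has none in column l, and the others stay in place.\<close>
  have "elts (cohen_act ?\<pi> p) \<subseteq> elts r"
  proof
    fix t assume t: "t \<in> elts (cohen_act ?\<pi> p)"
    obtain i m b where i: "t = tr i m b" by (rule cohen_poset_tr[OF cohen_act_in_poset[OF bij_transpose pP] t])
    then obtain j where j: "i = ?\<pi> j" "tr j m b \<in> elts p" using t unfolding i tr_mem_cohen_act by blast
    then have "j \<noteq> l" using l by (auto simp: Fp tr_mem_cohen_condition)
    then show "t \<in> elts r" using i j kl r by (cases "j = k") auto
  qed
  then have "cohen_act ?\<pi> p \<in> G"
    using generic_up[OF generic r(1) cohen_act_in_poset[OF bij_transpose pP]] by blast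
  \<comment> \<open>Hence p also guarantees the membership along the preimage filter, and
    \<open>val_pull\<close> reads this as membership of the permuted set in the value of the fixed
    name \<tau>.\<close>
  then have "p \<in> pull ?\<pi> G" using pP by (simp add: pull_def)
  moreover have c: "?\<pi> \<in> carrier (cohen_group M)" by (simp add: carrier_cohen perm_graph_swap)
  ultimately have "val (pull ?\<pi> G) (sg F) \<in> elts (val (pull ?\<pi> G) \<tau>)"
    using p(2)[OF generic_pull[OF generic c]] by blast
  moreover have "?\<pi> \<in> fix_group M E" using c k(2) l by (auto simp: fix_group_def transpose_def)
  ultimately have "creals (?\<pi> ` F) \<in> elts (val G \<tau>)"
    using E(2) by (simp add: val_pull hered_sym_pname[OF \<tau>] hered_sym_pname[OF hs_sg] F(1) name_act_sg creals_def)
  then show ?thesis using l by blast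
qed

lemma support_singleton:
  assumes Y: "Y \<in> N" "elts Y \<subseteq> creals ` {F. finite F}" and disj: "is_pairwise_disjoint N Y"
  obtains E where "finite E" "\<And>F. finite F \<Longrightarrow> creals F \<in> elts Y \<Longrightarrow> F \<inter> E = {} \<Longrightarrow> F \<noteq> {} \<Longrightarrow> \<exists>n. F = {n}"
proof -
  obtain \<tau> where \<tau>: "hered_sym M \<tau>" "Y = val G \<tau>" using Y(1) N_E by metis
  obtain E where E: "finite E" "\<And>\<pi>. \<pi> \<in> fix_group M E \<Longrightarrow> name_act (cohen_act \<pi>) \<tau> = \<tau>"
    using hered_symE[OF \<tau>(1)] by metis
  show ?thesis
  proof (rule that[OF E(1)])
    fix F :: "nat set" assume F: "finite F" "creals F \<in> elts Y" "F \<inter> E = {}" "F \<noteq> {}"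
    obtain k where k: "k \<in> F" "k \<notin> E" using F by blast
    show "\<exists>n. F = {n}"
    proof (rule ccontr)
      assume "\<nexists>n. F = {n}"
      then obtain j where j: "j \<in> F" "j \<noteq> k" using k by blast
      obtain l where l: "l \<notin> F" "creals (transpose k l ` F) \<in> elts Y"
        using moved_member[OF \<tau>(1) E F(1) _ k] F(2) unfolding \<tau>(2) by blast
      \<comment> \<open>The second index j stays in both sets, while l belongs only to the image;
        this contradicts disjointness.\<close>
      have "transpose k l j = j" using j l(1) by (auto simp: transpose_def)
      then have jj: "j \<in> transpose k l ` F" using j(1) by (metis imageI)
      have "l \<in> transpose k l ` F" using k(1) by (metis imageI transpose_apply_first)
      then have "creals F \<noteq> creals (transpose k l ` F)" using l(1) by auto
      moreover have "creal j \<in> elts (creals F)" "creal j \<in> elts (creals (transpose k l ` F))" using j(1) jj by auto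
      moreover have "creals F \<in> N" "creals (transpose k l ` F) \<in> N" "creal j \<in> N"
        using F(1) creals_in_N U_trans[OF creals_in_N[OF F(1)], of "creal j"] j(1) by auto
      ultimately show False
        using disj F(2) l(2) unfolding is_pairwise_disjoint_def by blast
    qed
  qed
qed

section \<open>Failure of HT for the singleton colouring\<close>

lemma not_HT: "\<not> HT N"
proof
  assume HT: "HT N"
  let ?X = "val G Xname" and ?S = "val G Sname" and ?c = "val G cname"
  have eX: "elts ?X = range creal" using elts_val_top[OF elts_Xname] by (simp add: creal_def)
  have eS: "elts ?S = creals ` {F. finite F}" using elts_val_top[OF elts_Sname] by (simp add: creals_def)
  have ec: "elts ?c = (\<lambda>F. pair (creals F) (num (of_bool (\<exists>n. F = {n})))) ` {F. finite F}"
    using elts_val_top[OF elts_cname] by (simp add: creals_def del: chk.simps num.simps)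
  have inN: "?X \<in> N" "?S \<in> N" "?c \<in> N" "num 2 \<in> N"
    using val_in_N hs_Xname hs_Sname hs_cname num_in_U by blast+
  have graph: "pair (creals F) b \<in> (\<lambda>F. pair (creals F) (g F)) ` A \<longleftrightarrow> F \<in> A \<and> b = g F" for F b A and g :: "nat set \<Rightarrow> hc"
    by auto
  have "inj creal" by (simp add: inj_on_def)
  then have "\<not> finite (elts ?X)" unfolding eX by (simp add: finite_image_iff)
  then have "\<not> is_finite N ?X" using is_finite_U[OF inN(1)] by simp
  moreover have "is_Fin N ?X ?S"
    unfolding is_Fin_def
  proof
    fix s assume s: "s \<in> N"
    have "s \<in> creals ` {F. finite F} \<longleftrightarrow> elts s \<subseteq> range creal \<and> finite (elts s)"
    proof
      assume "elts s \<subseteq> range creal \<and> finite (elts s)"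
      then obtain F where "finite F" "elts s = creal ` F" by (auto dest: finite_subset_image)
      then have "s = creals F" by (intro hc_ext) simp
      then show "s \<in> creals ` {F. finite F}" using \<open>finite F\<close> by blast
    qed auto
    then show "s \<in> elts ?S \<longleftrightarrow> is_subset N s ?X \<and> is_finite N s"
      using s by (simp add: is_subset_U is_finite_U eS eX)
  qed
  moreover have "is_two N (num 2)" by (simp add: is_two_U del: num.simps)
  moreover have "is_function N ?c ?S (num 2)"
    unfolding is_function_U[OF inN(3,2,4)] ec eS elts_num_2
  proof (intro conjI ballI)
    fix a assume "a \<in> creals ` {F. finite F}"
    then obtain F where F: "finite F" "a = creals F" by blast
    then have "pair a b \<in> (\<lambda>F. pair (creals F) (num (of_bool (\<exists>n. F = {n})))) ` {F. finite F} \<longleftrightarrow>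
      b = num (of_bool (\<exists>n. F = {n}))" for b
      using graph[of F b "\<lambda>F. num (of_bool (\<exists>n. F = {n}))" "{F. finite F}"] F by blast
    then show "\<exists>!b. b \<in> N \<and> pair a b \<in> (\<lambda>F. pair (creals F) (num (of_bool (\<exists>n. F = {n})))) ` {F. finite F}"
      by (simp only:) (metis num_in_U)
  next
    fix q assume "q \<in> (\<lambda>F. pair (creals F) (num (of_bool (\<exists>n. F = {n})))) ` {F. finite F}"
    then obtain F where F: "finite F" "q = pair (creals F) (num (of_bool (\<exists>n. F = {n})))" by blast
    moreover have "num (of_bool (\<exists>n. F = {n})) \<in> {num 0, num 1}" by (cases "\<exists>n. F = {n}") auto
    ultimately show "\<exists>a\<in>creals ` {F. finite F}. \<exists>b\<in>{num 0, num 1}. q = pair a b" by blast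
  qed
  ultimately obtain Y where Y: "Y \<in> N" "is_subset N Y ?S" "\<not> is_finite N Y" "is_pairwise_disjoint N Y"
    "FU_monochromatic N ?c Y"
    using HT inN unfolding HT_def by blast
  have YS: "elts Y \<subseteq> creals ` {F. finite F}" using Y(1,2) by (simp add: is_subset_U eS)
  have Yinf: "infinite (elts Y)" using Y(1,3) is_finite_U by blast
  obtain i where i: "\<And>z. z \<in> N \<Longrightarrow> in_FU N Y z \<Longrightarrow> pair z i \<in> elts ?c" "i \<in> N"
    using Y(5) is_app_U[OF inN(3)] unfolding FU_monochromatic_def by blast
  have FU: "in_FU N Y (creals (F1 \<union> F2))" if "finite F1" "finite F2" "creals F1 \<in> elts Y" "creals F2 \<in> elts Y" for F1 F2
    unfolding in_FU_def
  proof (intro bexI conjI)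
    let ?Z = "ins (creals F1) (ins (creals F2) (mk {}))"
    show Z: "?Z \<in> N" using that by (simp add: creals_in_N)
    show "is_subset N ?Z Y" using Z that by (simp add: is_subset_U)
    show "is_finite N ?Z" using Z by (simp add: is_finite_U)
    show "\<not> is_empty N ?Z" using Z by (metis is_empty_U elts_ins elts_mk countable_empty insert_not_empty)
    show "is_Union N ?Z (creals (F1 \<union> F2))"
      using Z that creals_in_N by (simp add: is_Union_U image_Un)
  qed
  \<comment> \<open>The case F1 = F2 is included and gives the colour of a single member of
    Y.\<close>
  have col: "i = num (of_bool (\<exists>n. F1 \<union> F2 = {n}))"
    if "finite F1" "finite F2" "creals F1 \<in> elts Y" "creals F2 \<in> elts Y" for F1 F2
    using i(1)[OF creals_in_N FU[OF that]] that unfolding ec by (auto simp del: num.simps)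
  obtain E where E: "finite E"
    "\<And>F. finite F \<Longrightarrow> creals F \<in> elts Y \<Longrightarrow> F \<inter> E = {} \<Longrightarrow> F \<noteq> {} \<Longrightarrow> \<exists>n. F = {n}"
    using support_singleton[OF Y(1) YS Y(4)] by metis
  let ?\<Y> = "{F. finite F \<and> creals F \<in> elts Y}"
  have "elts Y = creals ` ?\<Y>" using YS by blast
  then have inf: "infinite ?\<Y>" using Yinf by (metis finite_imageI)
  have disj: "F1 \<inter> F2 = {}" if "F1 \<in> ?\<Y>" "F2 \<in> ?\<Y>" "F1 \<noteq> F2" for F1 F2
  proof (rule ccontr)
    assume "F1 \<inter> F2 \<noteq> {}"
    then obtain n where n: "n \<in> F1" "n \<in> F2" by blast
    have "creal n \<in> elts (creals F1)" "creal n \<in> elts (creals F2)" using n by auto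
    moreover have "creals F1 \<in> N" "creals F2 \<in> N" using that creals_in_N by auto
    moreover have "creal n \<in> N" using U_trans[OF \<open>creals F1 \<in> N\<close> \<open>creal n \<in> elts (creals F1)\<close>] .
    moreover have "creals F1 \<noteq> creals F2" using that by simp
    ultimately show False using Y(4) that unfolding is_pairwise_disjoint_def by blast
  qed
  \<comment> \<open>Choosing a point of E in each such F is injective because different members are
    disjoint.\<close>
  have "finite {F \<in> ?\<Y>. F \<inter> E \<noteq> {}}"
  proof -
    define g where "g = (\<lambda>F. SOME k. k \<in> F \<inter> E)"
    have g: "g F \<in> F \<inter> E" if "F \<in> {F \<in> ?\<Y>. F \<inter> E \<noteq> {}}" for F
      using that unfolding g_def some_in_eq by simp
    have "inj_on g {F \<in> ?\<Y>. F \<inter> E \<noteq> {}}"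
    proof (rule inj_onI)
      fix F1 F2 assume F: "F1 \<in> {F \<in> ?\<Y>. F \<inter> E \<noteq> {}}" "F2 \<in> {F \<in> ?\<Y>. F \<inter> E \<noteq> {}}" "g F1 = g F2"
      then have "g F1 \<in> F1 \<inter> F2" using g[OF F(1)] g[OF F(2)] by simp
      then show "F1 = F2" using disj F by blast
    qed
    moreover have "finite (g ` {F \<in> ?\<Y>. F \<inter> E \<noteq> {}})"
      by (rule finite_subset[OF _ E(1)]) (use g in blast)
    ultimately show ?thesis by (rule finite_imageD[rotated])
  qed
  define Z where "Z = ?\<Y> - ({F \<in> ?\<Y>. F \<inter> E \<noteq> {}} \<union> {{}})"
  have "infinite Z" using inf \<open>finite {F \<in> ?\<Y>. F \<inter> E \<noteq> {}}\<close> unfolding Z_def by simp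
  then obtain F1 where F1: "F1 \<in> Z" using infinite_imp_nonempty by blast
  have "infinite (Z - {F1})" using \<open>infinite Z\<close> by simp
  then obtain F2 where F2: "F2 \<in> Z - {F1}" using infinite_imp_nonempty by blast
  have Z: "finite F \<and> creals F \<in> elts Y \<and> F \<inter> E = {} \<and> F \<noteq> {}" if "F \<in> Z" for F
    using that unfolding Z_def by blast
  have "\<exists>n. F1 = {n}" "\<exists>n. F2 = {n}" using E(2) Z[of F1] Z[of F2] F1 F2 by simp_all
  then obtain n1 n2 where n: "F1 = {n1}" "F2 = {n2}" "n1 \<noteq> n2" using F2 by blast
  then have "\<nexists>n. F1 \<union> F2 = {n}" by auto
  then have "i = num 0" using col[of F1 F2] Z[of F1] Z[of F2] F1 F2 by simp
  \<comment> \<open>The union of F1 with itself is a singleton, so the common colour would also have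
    to be 1.\<close>
  moreover have "i = num 1" using col[of F1 F1] Z[OF F1] n by (auto simp del: num.simps)
  ultimately show False by (metis num_inject zero_neq_one)
qed

end

theorem theorem3p8:
  fixes M G :: "hc set"
  assumes "transitive_model_ZFC M"
    and "generic M cohen_poset G"
  shows "\<not> HT (basic_cohen_model M G)"
proof -
  interpret cohen_generic M G
    using assms by unfold_locales
  show ?thesis using not_HT by (simp add: N_def)
qed

end
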